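(* Let $I=(\alpha,\beta)\subset\mathbb{R}_{>0}^n$ be an open polysegment and let $P$ be a free $\nabla$-module of rank $r$ over $A_K^n(I)$ satisfying the Robba condition. Let $A$ be an exponent of $P$ and let $B$ be a multisubset of $\mathbb{Z}_p^n$ which is weakly equivalent to $A$. Then $B$ is also an exponent of $P$.
   Context: $K$ is a complete nonarchimedean valued field of mixed characteristic $(0,p)$, $\overline K$ an algebraic closure, $n\ge1$. For $\alpha=(\alpha_i),\beta=(\beta_i)$, $(\alpha,\beta)=\prod_{i=1}^n(\alpha_i,\beta_i)$. A polysegment is a product $I=\prod_{i=1}^nI_i\subset\mathbb{R}_{>0}^n$ of intervals (with non-empty interior when exponents are considered). $A_K^n(I)=\{x\in\mathbb{A}_K^{n,\mathrm{an}}:|t_i(x)|\in I_i\}$ has ring of functions $K_I=\{\sum_{i\in\mathbb{Z}^n}f_it^i:\ |f_i|\rho^i\to0\ \forall\rho\in I\}$; $|f|_\rho=\max_i|f_i|\rho^i$, $|f|_I=\sup_{\rho\in I}|f|_\rho$ (for matrices: maximum over entries). A $\nabla$-module over $A_K^n(I)$ is a coherent locally free module $P$ with an integrable connection $P\to P\otimes\Omega^1_{A_K^n(I)/K}$. It satisfies the Robba condition if for all $\rho\in I$, $1\le i\le n$: $|\partial_{t_i}|_{\mathrm{sp},F_\rho}=|\nabla(\partial_{t_i})|_{\mathrm{sp},P_\rho}$, where $F_\rho$ is the completion of $K(t_1,\dots,t_n)$ for $|\cdot|_\rho$, $P_\rho=P\otimes_{K_I}F_\rho$, $|D|_{\mathrm{sp}}=\lim_k|D^k|^{1/k}$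 (operator norms). Exponents. Let $\mu_{p^k}\subset\overline K$ be the $p^k$-th roots of unity, $\mu_{p^\infty}=\bigcup_k\mu_{p^k}$. If $P$ satisfies the Robba condition, $\zeta\in\mu_{p^\infty}^n$ acts on $P\otimes_KK(\mu_{p^\infty})$ by $\zeta^*(v)=\sum_{\alpha\in\mathbb{Z}_{\ge0}^n}\prod_i(\zeta_i-1)^{\alpha_i}\prod_i\binom{t_iD_i}{\alpha_i}(v)$, $D_i=\nabla(\partial_{t_i})$. If $P$ is free with basis $e_1,\dots,e_r$, an exponent of $P$ is an $n$-tuple $A=(A^1,\dots,A^n)$ of $r\times r$ diagonal matrices over $\mathbb{Z}_p$ for which there are $S_{k,A}\in\mathrm{Mat}_{r\times r}(K_I)$ ($k\ge1$) such that: (1) $(v_1,\dots,v_r)=(e_1,\dots,e_r)S_{k,A}$ satisfies $\zeta^*(v_1,\dots,v_r)=(v_1,\dots,v_r)\prod_i\zeta_i^{A^i}$ for all $\zeta\in\mu_{p^k}^n$; (2) there is $l>0$ with $|S_{k,A}|_I\le p^{lk}$ for all $k$; (3) $|\det S_{k,A}|_\rho\ge1$ for all $k$ and $\rho\in I$. For $I$ open and $P$ locally free, an exponent of $P$ is an exponent of $P|_{A_K^n(J)}$ for some polysegment $J\subset I$ with non-empty interior such that $P|_{A_K^n(J)}$ is free. $A$ is also regarded as the multisubset $\{A_1,\dots,A_r\}$ of $\mathbb{Z}_p^n$, where $A_j=(A^1_j,\dots,A^n_j)$ collects the $j$-th diagonal entries. Weak equivalence. For $a\in\mathbb{Z}_p$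 put $\langle a\rangle_h=\min\{m\in\mathbb{Z}_{\ge0}:a+m\in p^h\mathbb{Z}_p\text{ or }a-m\in p^h\mathbb{Z}_p\}$. Multisubsets $A=(A_1,\dots,A_r)$, $B=(B_1,\dots,B_r)$ of $\mathbb{Z}_p^n$ are weakly equivalent if there are $c>0$ and permutations $\sigma_h$ ($h\ge1$) of $\{1,\dots,r\}$ with $\langle A^i_{\sigma_h(j)}-B^i_j\rangle_h\le ch$ for all $1\le i\le n$, $1\le j\le r$, $h\geq1$. *)

theory Defs
  imports
    "HOL-Analysis.Analysis"
    "HOL-Algebra.QuotRing"
    "HOL-Computational_Algebra.Computational_Algebra"
    "HOL-Computational_Algebra.Fraction_Field"
    "HOL-Library.Poly_Mapping"
begin

section \<open>Nonarchimedean valued fields\<close>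

class nonarch_field = field + metric_space +
  fixes absval :: "'a \<Rightarrow> real"
  assumes dist_absval: "dist x y = absval (x - y)"
    and absval_mult: "absval (x * y) = absval x * absval y"
    and absval_add: "absval (x + y) \<le> max (absval x) (absval y)"

instance nonarch_field \<subseteq> topological_comm_monoid_add
proof
  fix a b :: "'a::nonarch_field"
  show "LIM x nhds a \<times>\<^sub>F nhds b. fst x + snd x :> nhds (a + b)"
    unfolding tendsto_iff
  proof (intro allI impI)
    fix e :: real assume "e > 0"
    then have "eventually (\<lambda>x. dist x a < e) (nhds a)" "eventually (\<lambda>x. dist x b < e) (nhds b)"
      by (auto simp: eventually_nhds_metric)
    then have "eventually (\<lambda>z. dist (fst z) a < e \<and> dist (snd z) b < e) (nhds a \<times>\<^sub>F nhds b)"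
      by (intro eventually_prodI[THEN eventually_mono]) auto
    then show "eventually (\<lambda>z. dist (fst z + snd z) (a + b) < e) (nhds a \<times>\<^sub>F nhds b)"
    proof (rule eventually_mono)
      fix z :: "'a \<times> 'a" assume z: "dist (fst z) a < e \<and> dist (snd z) b < e"
      have "dist (fst z + snd z) (a + b) = absval ((fst z - a) + (snd z - b))"
        by (simp add: dist_absval algebra_simps)
      also have "\<dots> \<le> max (absval (fst z - a)) (absval (snd z - b))" by (rule absval_add)
      also have "\<dots> < e" using z by (simp add: dist_absval)
      finally show "dist (fst z + snd z) (a + b) < e" .
    qed
  qed
qed

text \<open>
  The map \<open>\<iota>\<close> embeds a field in an algebraic closure, carrying the absolute value that extends the one
  of the base field. For a complete base field this extension exists and is unique.
\<close>

definition algebraic_closure_map ::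
    "('k::nonarch_field \<Rightarrow> 'l::{nonarch_field,alg_closed_field}) \<Rightarrow> bool" where
  "algebraic_closure_map \<iota> \<longleftrightarrow>
     \<iota> 1 = 1 \<and> (\<forall>x y. \<iota> (x + y) = \<iota> x + \<iota> y) \<and> (\<forall>x y. \<iota> (x * y) = \<iota> x * \<iota> y) \<and>
     (\<forall>x. absval (\<iota> x) = absval x) \<and>
     (\<forall>y. \<exists>q. q \<noteq> 0 \<and> poly (map_poly \<iota> q) y = 0)"


section \<open>The \<open>p\<close>-adic integers\<close>

text \<open>
  A complete field of mixed characteristic \<open>(0,p)\<close> contains \<open>\<rat>\<^sub>p\<close>; there \<open>\<int>\<^sub>p\<close> is the closure of
  \<open>\<int>\<close>. (On \<open>\<rat>\<close> the absolute value is a power of the \<open>p\<close>-adic one.)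
\<close>

definition Zp :: "'k::nonarch_field set" where
  "Zp = closure \<int>"

definition pow_Zp :: "nat \<Rightarrow> nat \<Rightarrow> 'k::nonarch_field set" where
  "pow_Zp p h = (\<lambda>x. of_nat p ^ h * x) ` Zp"

definition angle :: "nat \<Rightarrow> nat \<Rightarrow> 'k::nonarch_field \<Rightarrow> nat" where
  "angle p h a = (LEAST m. a + of_nat m \<in> pow_Zp p h \<or> a - of_nat m \<in> pow_Zp p h)"

text \<open>\<open>\<zeta>\<^sup>a\<close> for \<open>\<zeta> \<in> \<mu>\<^bsub>p^\<infinity>\<^esub>\<close> and \<open>a \<in> \<int>\<^sub>p\<close>; neither \<open>k\<close> nor \<open>m\<close> matters.\<close>

definition root_pow :: "nat \<Rightarrow> 'l::field \<Rightarrow> 'k::nonarch_field \<Rightarrow> 'l" where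
  "root_pow p \<zeta> a =
     (THE z. \<exists>k m. \<zeta> ^ (p ^ k) = 1 \<and> a - of_int m \<in> pow_Zp p k \<and> z = \<zeta> powi m)"

text \<open>
  A multisubset of \<open>\<int>\<^sub>p\<^sup>n\<close> of cardinality \<open>r\<close> is listed as a family; only the members with index
  below \<open>r\<close> matter.
\<close>

definition weakly_equivalent ::
    "nat \<Rightarrow> nat \<Rightarrow> (nat \<Rightarrow> 'k::nonarch_field ^ 'n) \<Rightarrow> (nat \<Rightarrow> 'k ^ 'n) \<Rightarrow> bool" where
  "weakly_equivalent p r A B \<longleftrightarrow>
     (\<exists>c>0. \<exists>\<sigma>. \<forall>h\<ge>1. \<sigma> h permutes {..<r} \<and>
        (\<forall>j<r. \<forall>i. real (angle p h (A (\<sigma> h j) $ i - B j $ i)) \<le> c * real h))"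


section \<open>Functions on polyannuli\<close>

definition polysegment :: "(real ^ 'n) set \<Rightarrow> bool" where
  "polysegment I \<longleftrightarrow>
     (\<exists>S. (\<forall>i. is_interval (S i) \<and> S i \<subseteq> {0<..}) \<and> I = {\<rho>. \<forall>i. \<rho> $ i \<in> S i})"

text \<open>The endpoints \<open>0\<close> and \<open>\<infinity>\<close> are allowed.\<close>

definition open_polysegment :: "ereal ^ 'n \<Rightarrow> ereal ^ 'n \<Rightarrow> (real ^ 'n) set" where
  "open_polysegment \<alpha> \<beta> = {\<rho>. \<forall>i. \<alpha> $ i < ereal (\<rho> $ i) \<and> ereal (\<rho> $ i) < \<beta> $ i}"

type_synonym ('k, 'n) series = "int ^ 'n \<Rightarrow> 'k"

definition weight :: "real ^ 'n::finite \<Rightarrow> int ^ 'n \<Rightarrow> real" where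
  "weight \<rho> j = (\<Prod>i\<in>UNIV. (\<rho> $ i) powi (j $ i))"

definition gauss_norm ::
    "real ^ 'n::finite \<Rightarrow> ('k::nonarch_field, 'n) series \<Rightarrow> real" where
  "gauss_norm \<rho> f = (SUP j. absval (f j) * weight \<rho> j)"

definition gauss_norm_on ::
    "(real ^ 'n::finite) set \<Rightarrow> ('k::nonarch_field, 'n) series \<Rightarrow> ereal" where
  "gauss_norm_on I f = (SUP \<rho>\<in>I. ereal (gauss_norm \<rho> f))"

definition laurent_fun :: "(real ^ 'n::finite) set \<Rightarrow> ('k::nonarch_field, 'n) series set" where
  "laurent_fun I = {f. \<forall>\<rho>\<in>I. ((\<lambda>j. absval (f j) * weight \<rho> j) \<longlongrightarrow> 0) cofinite}"

definition lmonom :: "int ^ 'n \<Rightarrow> ('k::nonarch_field, 'n) series" where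
  "lmonom e = (\<lambda>j. if j = e then 1 else 0)"

definition laurent_ring ::
    "(real ^ 'n::finite) set \<Rightarrow> ('k::nonarch_field, 'n) series ring" where
  "laurent_ring I =
     \<lparr>carrier = laurent_fun I,
      monoid.mult = (\<lambda>f g j. \<Sum>\<^sub>\<infinity>l. f l * g (j - l)),
      one = lmonom 0,
      ring.zero = (\<lambda>j. 0),
      add = (\<lambda>f g j. f j + g j)\<rparr>"

definition laurent_deriv ::
    "'n::finite \<Rightarrow> ('k::nonarch_field, 'n) series \<Rightarrow> ('k, 'n) series" where
  "laurent_deriv i f = (\<lambda>j. of_int (j $ i + 1) * f (j + axis i 1))"


section \<open>Free modules of rank \<open>r\<close>\<close>

definition free_module :: "('x, 'm) ring_scheme \<Rightarrow> nat \<Rightarrow> (nat \<Rightarrow> 'x) set" where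
  "free_module R r = {..<r} \<rightarrow>\<^sub>E carrier R"

definition unit_vector :: "('x, 'm) ring_scheme \<Rightarrow> nat \<Rightarrow> nat \<Rightarrow> (nat \<Rightarrow> 'x)" where
  "unit_vector R r b = (\<lambda>a\<in>{..<r}. if a = b then \<one>\<^bsub>R\<^esub> else \<zero>\<^bsub>R\<^esub>)"

definition lincomb ::
    "('x, 'm) ring_scheme \<Rightarrow> nat \<Rightarrow> (nat \<Rightarrow> (nat \<Rightarrow> 'x)) \<Rightarrow> (nat \<Rightarrow> 'x) \<Rightarrow> (nat \<Rightarrow> 'x)" where
  "lincomb R r e c = (\<lambda>a\<in>{..<r}. \<Oplus>\<^bsub>R\<^esub>b\<in>{..<r}. c b \<otimes>\<^bsub>R\<^esub> e b a)"

definition module_basis :: "('x, 'm) ring_scheme \<Rightarrow> nat \<Rightarrow> (nat \<Rightarrow> (nat \<Rightarrow> 'x)) \<Rightarrow> bool" where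
  "module_basis R r e \<longleftrightarrow>
     (\<forall>b<r. e b \<in> free_module R r) \<and>
     (\<forall>x\<in>free_module R r. \<exists>!c. c \<in> free_module R r \<and> x = lincomb R r e c)"

definition ring_det :: "('x, 'm) ring_scheme \<Rightarrow> nat \<Rightarrow> (nat \<Rightarrow> nat \<Rightarrow> 'x) \<Rightarrow> 'x" where
  "ring_det R r S =
     (\<Oplus>\<^bsub>R\<^esub>\<sigma>\<in>{\<sigma>. \<sigma> permutes {..<r}}.
        (if evenperm \<sigma> then \<one>\<^bsub>R\<^esub> else \<ominus>\<^bsub>R\<^esub> \<one>\<^bsub>R\<^esub>) \<otimes>\<^bsub>R\<^esub> (\<Otimes>\<^bsub>R\<^esub>a\<in>{..<r}. S a (\<sigma> a)))"


section \<open>Connections\<close>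

text \<open>
  A free module of rank \<open>r\<close> over the polyannulus is \<open>K\<^sub>I\<^sup>r\<close>. As \<open>\<Omega>\<^sup>1\<close> is free on the \<open>dt\<^sub>i\<close>, a
  connection is given by the operators \<open>D i = \<nabla>(\<partial>\<^bsub>t\<^sub>i\<^esub>)\<close>, and it is integrable iff these commute.
  The Leibniz rule on constants gives \<open>K\<close>-linearity.
\<close>

definition integrable_connection ::
    "(real ^ 'n::finite) set \<Rightarrow> nat \<Rightarrow>
     ('n \<Rightarrow> (nat \<Rightarrow> ('k::nonarch_field, 'n) series) \<Rightarrow> (nat \<Rightarrow> ('k, 'n) series)) \<Rightarrow> bool" where
  "integrable_connection I r D \<longleftrightarrow>
     (let R = laurent_ring I; P = free_module R r in
       (\<forall>i. \<forall>x\<in>P. D i x \<in> P) \<and>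
       (\<forall>i. \<forall>x\<in>P. \<forall>y\<in>P.
          D i (\<lambda>a\<in>{..<r}. x a \<oplus>\<^bsub>R\<^esub> y a) = (\<lambda>a\<in>{..<r}. D i x a \<oplus>\<^bsub>R\<^esub> D i y a)) \<and>
       (\<forall>i. \<forall>f\<in>carrier R. \<forall>x\<in>P.
          D i (\<lambda>a\<in>{..<r}. f \<otimes>\<^bsub>R\<^esub> x a) =
            (\<lambda>a\<in>{..<r}. laurent_deriv i f \<otimes>\<^bsub>R\<^esub> x a \<oplus>\<^bsub>R\<^esub> f \<otimes>\<^bsub>R\<^esub> D i x a)) \<and>
       (\<forall>i j. \<forall>x\<in>P. D i (D j x) = D j (D i x)))"

text \<open>
  Base change of the operator \<open>Di\<close> on \<open>K\<^sub>I\<^sup>r\<close> along \<open>\<phi> : K\<^sub>I \<rightarrow> R\<close>, where \<open>d\<close> is the derivation of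
  \<open>R\<close> extending \<open>\<partial>\<^bsub>t\<^sub>i\<^esub>\<close>.
\<close>

definition base_change ::
    "(real ^ 'n::finite) set \<Rightarrow> nat \<Rightarrow> ('x, 'm) ring_scheme \<Rightarrow> ('x \<Rightarrow> 'x) \<Rightarrow>
     (('k::nonarch_field, 'n) series \<Rightarrow> 'x) \<Rightarrow>
     ((nat \<Rightarrow> ('k, 'n) series) \<Rightarrow> (nat \<Rightarrow> ('k, 'n) series)) \<Rightarrow> (nat \<Rightarrow> 'x) \<Rightarrow> (nat \<Rightarrow> 'x)" where
  "base_change I r R d \<phi> Di x =
     (\<lambda>a\<in>{..<r}. d (x a) \<oplus>\<^bsub>R\<^esub>
        (\<Oplus>\<^bsub>R\<^esub>b\<in>{..<r}. \<phi> (Di (unit_vector (laurent_ring I) r b) a) \<otimes>\<^bsub>R\<^esub> x b))"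

definition restrict_conn ::
    "(real ^ 'n::finite) set \<Rightarrow> (real ^ 'n) set \<Rightarrow> nat \<Rightarrow>
     ('n \<Rightarrow> (nat \<Rightarrow> ('k::nonarch_field, 'n) series) \<Rightarrow> (nat \<Rightarrow> ('k, 'n) series)) \<Rightarrow>
     ('n \<Rightarrow> (nat \<Rightarrow> ('k, 'n) series) \<Rightarrow> (nat \<Rightarrow> ('k, 'n) series))" where
  "restrict_conn I J r D i = base_change I r (laurent_ring J) (laurent_deriv i) (\<lambda>f. f) (D i)"


section \<open>The field \<open>F\<^sub>\<rho>\<close>\<close>

text \<open>The linear order on the index type of the variables only serves to make polynomials an \<open>idom\<close>.\<close>

type_synonym ('k, 'n) mpol = "('n \<Rightarrow>\<^sub>0 nat) \<Rightarrow>\<^sub>0 'k"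
type_synonym ('k, 'n) ratfun = "('k, 'n) mpol fract"

definition mpol_norm ::
    "real ^ 'n::finite \<Rightarrow> ('k::nonarch_field, 'n) mpol \<Rightarrow> real" where
  "mpol_norm \<rho> f =
     (SUP m. absval (Poly_Mapping.lookup f m) * (\<Prod>i\<in>UNIV. (\<rho> $ i) ^ Poly_Mapping.lookup m i))"

definition mpol_deriv :: "'n \<Rightarrow> ('k::nonarch_field, 'n) mpol \<Rightarrow> ('k, 'n) mpol" where
  "mpol_deriv i f =
     (\<Sum>m\<in>Poly_Mapping.keys f.
        Poly_Mapping.single (m - Poly_Mapping.single i 1)
          (of_nat (Poly_Mapping.lookup m i) * Poly_Mapping.lookup f m))"

definition ratfun_norm ::
    "real ^ 'n::{finite,linorder} \<Rightarrow> ('k::nonarch_field, 'n) ratfun \<Rightarrow> real" where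
  "ratfun_norm \<rho> x =
     (THE c. \<forall>f g. g \<noteq> 0 \<and> x = Fract f g \<longrightarrow> c = mpol_norm \<rho> f / mpol_norm \<rho> g)"

definition ratfun_deriv ::
    "'n::{finite,linorder} \<Rightarrow> ('k::nonarch_field, 'n) ratfun \<Rightarrow> ('k, 'n) ratfun" where
  "ratfun_deriv i x =
     (THE y. \<forall>f g. g \<noteq> 0 \<and> x = Fract f g \<longrightarrow>
        y = Fract (mpol_deriv i f * g - f * mpol_deriv i g) (g * g))"

definition cauchy_ring ::
    "real ^ 'n::{finite,linorder} \<Rightarrow> (nat \<Rightarrow> ('k::nonarch_field, 'n) ratfun) ring" where
  "cauchy_ring \<rho> =
     \<lparr>carrier = {X. \<forall>e>0. \<exists>N. \<forall>k\<ge>N. \<forall>l\<ge>N. ratfun_norm \<rho> (X k - X l) < e},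
      monoid.mult = (\<lambda>X Y k. X k * Y k),
      one = (\<lambda>k. 1),
      ring.zero = (\<lambda>k. 0),
      add = (\<lambda>X Y k. X k + Y k)\<rparr>"

definition null_sequences ::
    "real ^ 'n::{finite,linorder} \<Rightarrow> (nat \<Rightarrow> ('k::nonarch_field, 'n) ratfun) set" where
  "null_sequences \<rho> = {X. (\<lambda>k. ratfun_norm \<rho> (X k)) \<longlonglongrightarrow> 0}"

definition F_field ::
    "real ^ 'n::{finite,linorder} \<Rightarrow> (nat \<Rightarrow> ('k::nonarch_field, 'n) ratfun) set ring" where
  "F_field \<rho> = cauchy_ring \<rho> Quot null_sequences \<rho>"

definition F_norm ::
    "real ^ 'n::{finite,linorder} \<Rightarrow> (nat \<Rightarrow> ('k::nonarch_field, 'n) ratfun) set \<Rightarrow> real" where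
  "F_norm \<rho> x = (THE c. \<forall>X\<in>x. (\<lambda>k. ratfun_norm \<rho> (X k)) \<longlonglongrightarrow> c)"

text \<open>The union is over representatives of one coset, all of which give the same coset.\<close>

definition F_deriv ::
    "real ^ 'n::{finite,linorder} \<Rightarrow> 'n \<Rightarrow> (nat \<Rightarrow> ('k::nonarch_field, 'n) ratfun) set \<Rightarrow>
     (nat \<Rightarrow> ('k, 'n) ratfun) set" where
  "F_deriv \<rho> i x =
     (\<Union>X\<in>x. null_sequences \<rho> +>\<^bsub>cauchy_ring \<rho>\<^esub> (\<lambda>k. ratfun_deriv i (X k)))"

definition ratfun_term ::
    "'k::nonarch_field \<Rightarrow> int ^ 'n::{finite,linorder} \<Rightarrow> ('k, 'n) ratfun" where
  "ratfun_term c j =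
     Fract (Poly_Mapping.single 0 c) 1 *
     (\<Prod>i\<in>UNIV. Fract (Poly_Mapping.single (Poly_Mapping.single i 1) 1) 1 powi (j $ i))"

text \<open>The map \<open>K\<^sub>I \<rightarrow> F\<^sub>\<rho>\<close> for \<open>\<rho> \<in> I\<close> sends a series to the limit of its truncations.\<close>

definition F_embed ::
    "real ^ 'n::{finite,linorder} \<Rightarrow> ('k::nonarch_field, 'n) series \<Rightarrow>
     (nat \<Rightarrow> ('k, 'n) ratfun) set" where
  "F_embed \<rho> f =
     null_sequences \<rho> +>\<^bsub>cauchy_ring \<rho>\<^esub>
       (\<lambda>k. \<Sum>j | \<forall>i. \<bar>j $ i\<bar> \<le> int k. ratfun_term (f j) j)"


section \<open>The Robba condition\<close>

definition op_norm :: "'v set \<Rightarrow> ('v \<Rightarrow> real) \<Rightarrow> ('v \<Rightarrow> 'v) \<Rightarrow> real" where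
  "op_norm V nrm T = Inf {C. 0 \<le> C \<and> (\<forall>x\<in>V. nrm (T x) \<le> C * nrm x)}"

definition spectral_norm :: "'v set \<Rightarrow> ('v \<Rightarrow> real) \<Rightarrow> ('v \<Rightarrow> 'v) \<Rightarrow> real" where
  "spectral_norm V nrm T = lim (\<lambda>k. root k (op_norm V nrm (T ^^ k)))"

definition F_vec_norm ::
    "real ^ 'n::{finite,linorder} \<Rightarrow> nat \<Rightarrow>
     (nat \<Rightarrow> (nat \<Rightarrow> ('k::nonarch_field, 'n) ratfun) set) \<Rightarrow> real" where
  "F_vec_norm \<rho> r x = Max (insert 0 ((\<lambda>a. F_norm \<rho> (x a)) ` {..<r}))"

definition robba_condition ::
    "(real ^ 'n::{finite,linorder}) set \<Rightarrow> nat \<Rightarrow>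
     ('n \<Rightarrow> (nat \<Rightarrow> ('k::nonarch_field, 'n) series) \<Rightarrow> (nat \<Rightarrow> ('k, 'n) series)) \<Rightarrow> bool" where
  "robba_condition I r D \<longleftrightarrow>
     (\<forall>\<rho>\<in>I. \<forall>i.
        spectral_norm (carrier (F_field \<rho>)) (F_norm \<rho>)
          (F_deriv \<rho> i :: (nat \<Rightarrow> ('k, 'n) ratfun) set \<Rightarrow> _) =
        spectral_norm (free_module (F_field \<rho>) r) (F_vec_norm \<rho> r)
          (base_change I r (F_field \<rho>) (F_deriv \<rho> i) (F_embed \<rho>) (D i)))"


section \<open>Exponents\<close>

text \<open>\<open>binom_op T m\<close> is \<open>T (T - 1) \<dots> (T - m + 1) / m!\<close>.\<close>

primrec binom_op ::
    "nat \<Rightarrow> ((nat \<Rightarrow> ('k::nonarch_field, 'n) series) \<Rightarrow> (nat \<Rightarrow> ('k, 'n) series)) \<Rightarrow> nat \<Rightarrow>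
     (nat \<Rightarrow> ('k, 'n) series) \<Rightarrow> (nat \<Rightarrow> ('k, 'n) series)" where
  "binom_op r T 0 x = x"
| "binom_op r T (Suc m) x =
     (\<lambda>a\<in>{..<r}. \<lambda>j. (T (binom_op r T m x) a j - of_nat m * binom_op r T m x a j) / of_nat (Suc m))"

text \<open>\<open>\<Prod>\<^sub>i binom(t\<^sub>i D\<^sub>i, \<alpha>\<^sub>i)\<close>; the factors commute by integrability.\<close>

definition multi_binom_op ::
    "(real ^ 'n::{finite,linorder}) set \<Rightarrow> nat \<Rightarrow>
     ('n \<Rightarrow> (nat \<Rightarrow> ('k::nonarch_field, 'n) series) \<Rightarrow> (nat \<Rightarrow> ('k, 'n) series)) \<Rightarrow>
     nat ^ 'n::{finite,linorder} \<Rightarrow> (nat \<Rightarrow> ('k, 'n) series) \<Rightarrow> (nat \<Rightarrow> ('k, 'n) series)" where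
  "multi_binom_op J r D \<alpha> x =
     foldr (\<lambda>i. binom_op r
                  (\<lambda>y. \<lambda>a\<in>{..<r}. lmonom (axis i 1) \<otimes>\<^bsub>laurent_ring J\<^esub> D i y a) (\<alpha> $ i))
       (sorted_list_of_set UNIV) x"

text \<open>
  \<open>zeta_action \<iota> J r D \<zeta> v w\<close> says that the series defining \<open>\<zeta>\<^sup>*(v)\<close> converges with sum \<open>w\<close>, for \<open>v\<close> in
  \<open>K\<^sub>J\<^sup>r\<close>. The topology is the one given by the norms at all \<open>\<rho> \<in> J\<close>, which coincides with that of
  uniform convergence on closed polysegments, as a Gauss norm on a box is attained at a vertex.
\<close>

definition zeta_action ::
    "('k::nonarch_field \<Rightarrow> 'l::nonarch_field) \<Rightarrow> (real ^ 'n::{finite,linorder}) set \<Rightarrow> nat \<Rightarrow>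
     ('n \<Rightarrow> (nat \<Rightarrow> ('k, 'n) series) \<Rightarrow> (nat \<Rightarrow> ('k, 'n) series)) \<Rightarrow> 'l ^ 'n::{finite,linorder} \<Rightarrow>
     (nat \<Rightarrow> ('k, 'n) series) \<Rightarrow> (nat \<Rightarrow> ('l, 'n) series) \<Rightarrow> bool" where
  "zeta_action \<iota> J r D \<zeta> v w \<longleftrightarrow>
     (\<forall>a<r. w a \<in> laurent_fun J) \<and>
     (\<forall>\<rho>\<in>J. \<forall>a<r.
        ((\<lambda>F. gauss_norm \<rho>
            (\<lambda>j. (\<Sum>\<alpha>\<in>F. (\<Prod>i\<in>UNIV. (\<zeta> $ i - 1) ^ (\<alpha> $ i)) * \<iota> (multi_binom_op J r D \<alpha> v a j))
                 - w a j))
          \<longlongrightarrow> 0) (finite_subsets_at_top UNIV))"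

text \<open>
  Here \<open>D\<close> is a connection on \<open>K\<^sub>J\<^sup>r\<close>, and \<open>A c $ i\<close> is the \<open>c\<close>-th diagonal entry of the matrix
  \<open>A\<^sup>i\<close>. The vector \<open>lincomb _ r e (\<lambda>b. S k b c)\<close> is the \<open>c\<close>-th entry of the row \<open>(e\<^sub>1,\<dots>,e\<^sub>r) S\<^sub>k\<close>.
\<close>

definition exponent_free ::
    "nat \<Rightarrow> ('k::nonarch_field \<Rightarrow> 'l::nonarch_field) \<Rightarrow> (real ^ 'n::{finite,linorder}) set \<Rightarrow>
     nat \<Rightarrow> ('n \<Rightarrow> (nat \<Rightarrow> ('k, 'n) series) \<Rightarrow> (nat \<Rightarrow> ('k, 'n) series)) \<Rightarrow>
     (nat \<Rightarrow> 'k ^ 'n::{finite,linorder}) \<Rightarrow> bool" where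
  "exponent_free p \<iota> J r D A \<longleftrightarrow>
     (\<forall>c<r. \<forall>i. A c $ i \<in> Zp) \<and>
     (\<exists>e. module_basis (laurent_ring J) r e \<and>
       (\<exists>S.
         (\<forall>k\<ge>1. \<forall>b<r. \<forall>c<r. S k b c \<in> carrier (laurent_ring J)) \<and>
         (\<forall>k\<ge>1. \<forall>\<zeta>. (\<forall>i. (\<zeta> $ i) ^ (p ^ k) = 1) \<longrightarrow>
            (\<forall>c<r. let v = lincomb (laurent_ring J) r e (\<lambda>b. S k b c) in
               zeta_action \<iota> J r D \<zeta> v
                 (\<lambda>a j. (\<Prod>i\<in>UNIV. root_pow p (\<zeta> $ i) (A c $ i)) * \<iota> (v a j)))) \<and>
         (\<exists>l>0. \<forall>k\<ge>1.
            (SUP b\<in>{..<r}. SUP c\<in>{..<r}. gauss_norm_on J (S k b c))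
              \<le> ereal (real p powr (l * real k))) \<and>
         (\<forall>k\<ge>1. \<forall>\<rho>\<in>J. 1 \<le> gauss_norm \<rho> (ring_det (laurent_ring J) r (S k)))))"

text \<open>Exponents over an open polysegment \<open>I\<close> only depend on the restriction to some \<open>J\<close>.\<close>

definition exponent ::
    "nat \<Rightarrow> ('k::nonarch_field \<Rightarrow> 'l::nonarch_field) \<Rightarrow> (real ^ 'n::{finite,linorder}) set \<Rightarrow>
     nat \<Rightarrow> ('n \<Rightarrow> (nat \<Rightarrow> ('k, 'n) series) \<Rightarrow> (nat \<Rightarrow> ('k, 'n) series)) \<Rightarrow>
     (nat \<Rightarrow> 'k ^ 'n::{finite,linorder}) \<Rightarrow> bool" where
  "exponent p \<iota> I r D A \<longleftrightarrow>
     (\<exists>J. polysegment J \<and> J \<subseteq> I \<and> interior J \<noteq> {} \<and>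
          exponent_free p \<iota> J r (restrict_conn I J r D) A)"

end

(*
  Write m(k,j) for integers of size O(k) with A_{sigma_k(j)} + m(k,j) = B_j modulo p^k, as provided by
  weak equivalence. Multiplying the sigma_k(j)-th column of S_{k,A} by t^{m(k,j)} changes the character
  through which the p^k-th roots of unity act from A_{sigma_k(j)} to B_j. Over a compact box inside J
  the monomials t^{m(k,j)} and their inverses have norm at most C^k, so a further multiplication by
  p^{-Nk} makes the determinant at least as large as that of S_{k,A} and keeps the growth exponential.
*)
theory Submission
  imports Defs
begin

section \<open>Ultrametric absolute values\<close>

text \<open>The obstacle is the series defining the action of \<zeta>: its convergence on a twisted
  vector has to be derived from its convergence on the original one. Since an Euler operator T = t D
  satisfies T t = t (T + 1), Pascal's rule shows that multiplying the vector by t_i multiplies the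
  series, seen as a formal series in its index \<alpha>, by 1 + (\<zeta>_i - 1) s, where s raises
  \<alpha>_i by one. This keeps convergence and multiplies the sum by \<zeta>_i. Negative exponents
  require division by that factor. The algebraic closure need not be complete, so no limit can be
  constructed there; but the limit is known beforehand, and |\<zeta>_i - 1| < 1 forces the terms to
  tend to 0. The box must be compact because monomials are unbounded near an endpoint 0 or
  \<infinity>. Shrinking is allowed since an exponent is only tested on some polysegment, and
  functions are coefficient families, so the same basis and the same matrices can be reused on the
  box.\<close>

lemma absval_dist0: "absval x = dist x (0::'a::nonarch_field)"
  by (simp add: dist_absval)

lemma absval_zero [simp]: "absval (0::'a::nonarch_field) = 0"
  by (simp add: absval_dist0)

lemma absval_nonneg [simp]: "0 \<le> absval (x::'a::nonarch_field)"
  by (simp add: absval_dist0)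

lemma absval_eq_0_iff [simp]: "absval x = 0 \<longleftrightarrow> x = (0::'a::nonarch_field)"
  by (simp add: absval_dist0)

lemma absval_pos_iff [simp]: "0 < absval x \<longleftrightarrow> x \<noteq> (0::'a::nonarch_field)"
  by (simp add: absval_dist0)

lemma absval_one [simp]: "absval (1::'a::nonarch_field) = 1"
proof -
  have "absval (1::'a) * absval (1::'a) = absval (1::'a) * 1"
    by (metis absval_mult mult.right_neutral)
  moreover have "absval (1::'a) \<noteq> 0" by simp
  ultimately show ?thesis by (metis mult_left_cancel)
qed

lemma absval_minus [simp]: "absval (- x) = absval (x::'a::nonarch_field)"
  by (metis absval_dist0 diff_0 dist_absval dist_commute)

lemma absval_minus_commute: "absval (x - y) = absval (y - (x::'a::nonarch_field))"
  by (metis absval_minus minus_diff_eq)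

lemma absval_diff: "absval (x - y) \<le> max (absval x) (absval (y::'a::nonarch_field))"
  using absval_add[of x "- y"] by simp

lemma absval_power: "absval (x ^ n) = absval (x::'a::nonarch_field) ^ n"
  by (induction n) (simp_all add: absval_mult)

lemma absval_inverse: "absval (inverse x) = inverse (absval (x::'a::nonarch_field))"
proof (cases "x = 0")
  case False
  then have "absval x * absval (inverse x) = 1"
    by (metis absval_mult absval_one right_inverse)
  with False show ?thesis by (simp add: inverse_unique)
qed simp

lemma absval_add_le:
  fixes x y :: "'a::nonarch_field"
  shows "absval x \<le> c \<Longrightarrow> absval y \<le> c \<Longrightarrow> absval (x + y) \<le> c"
  using absval_add[of x y] by simp

lemma absval_diff_le:
  fixes x y :: "'a::nonarch_field"
  shows "absval x \<le> c \<Longrightarrow> absval y \<le> c \<Longrightarrow> absval (x - y) \<le> c"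
  using absval_diff[of x y] by simp

lemma absval_sum_le:
  fixes f :: "'i \<Rightarrow> 'a::nonarch_field"
  assumes "\<And>i. i \<in> F \<Longrightarrow> absval (f i) \<le> c" and "0 \<le> c"
  shows "absval (sum f F) \<le> c"
  using assms by (induction F rule: infinite_finite_induct) (auto intro: absval_add_le)

lemma absval_of_nat_le_1: "absval (of_nat n :: 'a::nonarch_field) \<le> 1"
  by (induction n) (auto intro: absval_add_le)

lemma absval_of_int_le_1: "absval (of_int n :: 'a::nonarch_field) \<le> 1"
  by (cases n) (simp_all add: absval_of_nat_le_1 del: of_nat_Suc)

lemma tendsto_absval:
  fixes f :: "'i \<Rightarrow> 'a::nonarch_field"
  shows "(f \<longlongrightarrow> L) F \<Longrightarrow> ((\<lambda>x. absval (f x)) \<longlongrightarrow> absval L) F"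
  unfolding absval_dist0 by (intro tendsto_intros)

text \<open>Required by the Fubini rule \<open>infsum_Sigma'\<close> in
  \<open>convolution_assoc\<close>. The ultrametric inequality allows d = e.\<close>

lemma uniformly_continuous_plus:
  "uniformly_continuous_on UNIV (\<lambda>(x::'a::nonarch_field, y). x + y)"
  unfolding uniformly_continuous_on_def
proof (intro allI impI)
  fix e :: real assume "e > 0"
  show "\<exists>d>0. \<forall>x\<in>UNIV. \<forall>x'\<in>UNIV. dist x' x < d \<longrightarrow>
      dist (case x' of (x::'a, y) \<Rightarrow> x + y) (case x of (x, y) \<Rightarrow> x + y) < e"
  proof (intro exI[of _ e] conjI ballI impI)
    fix u v :: "'a \<times> 'a" assume d: "dist v u < e"
    obtain x y x' y' where uv: "u = (x, y)" "v = (x', y')" by (cases u, cases v)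
    have "dist x' x < e" "dist y' y < e"
      using d dist_fst_le[of v u] dist_snd_le[of v u] by (auto simp: uv)
    moreover have "x' + y' - (x + y) = (x' - x) + (y' - y)" by simp
    then have "dist (x' + y') (x + y) \<le> max (dist x' x) (dist y' y)"
      using absval_add[of "x' - x" "y' - y"] by (simp only: dist_absval)
    ultimately show "dist (case v of (x, y) \<Rightarrow> x + y) (case u of (x, y) \<Rightarrow> x + y) < e"
      by (simp add: uv)
  qed (use \<open>e > 0\<close> in auto)
qed

lemma has_sum_absval_le:
  fixes f :: "'i \<Rightarrow> 'a::nonarch_field"
  assumes "(f has_sum s) S" and "\<And>i. i \<in> S \<Longrightarrow> absval (f i) \<le> c" and "0 \<le> c"
  shows "absval s \<le> c"
proof (rule tendsto_upperbound)
  show "((\<lambda>F. absval (sum f F)) \<longlongrightarrow> absval s) (finite_subsets_at_top S)"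
    using assms(1) unfolding has_sum_def by (rule tendsto_absval)
  show "\<forall>\<^sub>F F in finite_subsets_at_top S. absval (sum f F) \<le> c"
    using assms(2,3)
    by (intro eventually_finite_subsets_at_top_weakI absval_sum_le) auto
qed simp

text \<open>A family without a sum has \<open>infsum\<close> 0 by convention, so the bound covers
  every family.\<close>

lemma infsum_absval_le:
  fixes f :: "'i \<Rightarrow> 'a::nonarch_field"
  assumes "\<And>i. i \<in> S \<Longrightarrow> absval (f i) \<le> c" and "0 \<le> c"
  shows "absval (infsum f S) \<le> c"
  using assms has_sum_absval_le[where f=f and s="infsum f S" and S=S and c=c]
  by (cases "f summable_on S") (auto simp: infsum_not_exists)

lemma has_sum_mult_left_nonarch:
  fixes f :: "'i \<Rightarrow> 'a::nonarch_field"
  assumes "(f has_sum s) S"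
  shows "((\<lambda>i. c * f i) has_sum c * s) S"
proof -
  have "((\<lambda>x. c * x) \<longlongrightarrow> c * s) (at s)"
  proof (rule tendstoI)
    fix e :: real assume "e > 0"
    \<comment> \<open>The added 1 keeps the radius meaningful for c = 0.\<close>
    have "dist (c * x) (c * s) < e" if "dist x s < e / (absval c + 1)" for x
    proof -
      have "dist (c * x) (c * s) = absval c * dist x s"
        by (simp add: dist_absval absval_mult flip: right_diff_distrib)
      also have "\<dots> \<le> (absval c + 1) * dist x s" by (simp add: mult_right_mono)
      also have "\<dots> < e" using that by (simp add: pos_less_divide_eq add_nonneg_pos mult.commute)
      finally show ?thesis .
    qed
    then show "\<forall>\<^sub>F x in at s. dist (c * x) (c * s) < e"
      unfolding eventually_at using \<open>e > 0\<close>
      by (intro exI[of _ "e / (absval c + 1)"]) (auto intro!: divide_pos_pos add_nonneg_pos)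
  qed
  then show ?thesis
    using has_sum_comm_additive[of "\<lambda>x. c * x" s f S] assms
    by (simp add: Modules.additive_def distrib_left o_def)
qed

text \<open>For nonzero c, multiplication by \<open>inverse c\<close> carries summability back, so
  either both sides are genuine sums or both are the default 0. This is why
  \<open>convolution_scale_right\<close> can be stated for arbitrary families.\<close>

lemma infsum_mult_left_nonarch:
  fixes f :: "'i \<Rightarrow> 'a::nonarch_field"
  shows "infsum (\<lambda>i. c * f i) S = c * infsum f S"
proof (cases "f summable_on S \<or> c = 0")
  case True
  then show ?thesis
    using has_sum_mult_left_nonarch[where f=f and s="infsum f S" and S=S and c=c] by (auto intro!: infsumI)
next
  case False
  then have "\<not> (\<lambda>i. c * f i) summable_on S"
    using has_sum_mult_left_nonarch[where f="\<lambda>i. c * f i" and S=S and c="inverse c"]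
    by (auto simp: summable_on_def simp flip: mult.assoc)
  with False show ?thesis by (simp add: infsum_not_exists)
qed

section \<open>Families of reals tending to zero, and summability\<close>

definition null_family :: "('i \<Rightarrow> real) \<Rightarrow> bool" where
  "null_family h \<longleftrightarrow> (\<forall>e>0. finite {i. h i \<ge> e})"

text \<open>Finite exceptional sets are easier to handle than the filter when families are
  multiplied, reindexed or compared.\<close>

lemma null_family_iff:
  assumes "\<And>i. h i \<ge> 0"
  shows "(h \<longlongrightarrow> 0) cofinite \<longleftrightarrow> null_family h"
  using assms by (simp add: tendsto_iff null_family_def eventually_cofinite not_less)

lemma null_family_bounded:
  assumes "null_family h" obtains C where "C > 0" "\<And>i. h i \<le> C"
proof -
  have fin: "finite {i. h i \<ge> 1}" using assms by (simp add: null_family_def)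
  define C where "C = Max (insert 1 (h ` {i. h i \<ge> 1}))"
  have "h i \<le> C" for i
  proof (cases "h i \<ge> 1")
    case True
    then show ?thesis unfolding C_def using fin by (intro Max_ge) auto
  next
    case False
    moreover have "1 \<le> C" unfolding C_def using fin by (intro Max_ge) auto
    ultimately show ?thesis by simp
  qed
  moreover have "1 \<le> C" unfolding C_def using fin by (intro Max_ge) auto
  ultimately show ?thesis by (intro that[of C]) auto
qed

lemma null_family_le:
  assumes "null_family h" "\<And>i. g i \<le> C * h i" "C \<ge> 0"
  shows "null_family g"
  unfolding null_family_def
proof (intro allI impI)
  fix e :: real assume "e > 0"
  have "h i \<ge> e / (C + 1)" if "g i \<ge> e" for i
  proof -
    have "0 < C * h i" using that assms(2)[of i] \<open>e > 0\<close> by linarith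
    then have "h i > 0" using assms(3) by (simp add: zero_less_mult_iff)
    then have "e \<le> (C + 1) * h i" using that assms(2)[of i] by (simp add: distrib_right)
    then show ?thesis using assms(3) by (simp add: pos_divide_le_eq mult.commute)
  qed
  then have "{i. g i \<ge> e} \<subseteq> {i. h i \<ge> e / (C + 1)}" by auto
  moreover have "finite {i. h i \<ge> e / (C + 1)}"
    using assms \<open>e > 0\<close> by (simp add: null_family_def)
  ultimately show "finite {i. g i \<ge> e}" by (rule finite_subset)
qed

text \<open>Both families are bounded, so a product of size at least e forces each factor above a
  fixed positive threshold, which leaves finitely many pairs.\<close>

lemma null_family_mult:
  assumes "null_family g" "null_family h" "\<And>i. g i \<ge> 0" "\<And>i. h i \<ge> 0"
  shows "null_family (\<lambda>(i, j). g i * h j)"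
  unfolding null_family_def
proof (intro allI impI)
  fix e :: real assume "e > 0"
  obtain C where C: "C > 0" "\<And>i. g i \<le> C" using null_family_bounded[OF assms(1)] by blast
  obtain C' where C': "C' > 0" "\<And>i. h i \<le> C'" using null_family_bounded[OF assms(2)] by blast
  have "e / C' \<le> g i \<and> e / C \<le> h j" if "g i * h j \<ge> e" for i j
  proof -
    have "g i * h j \<le> g i * C'" "g i * h j \<le> C * h j"
      using C C' assms(3,4) by (auto intro: mult_left_mono mult_right_mono)
    then show ?thesis using that C C' by (simp add: pos_divide_le_eq mult.commute)
  qed
  then have "{ij. (case ij of (i, j) \<Rightarrow> g i * h j) \<ge> e} \<subseteq> {i. g i \<ge> e / C'} \<times> {j. h j \<ge> e / C}"
    by auto
  moreover have "finite \<dots>"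
    using assms(1,2) C C' \<open>e > 0\<close> by (simp add: null_family_def)
  ultimately show "finite {ij. (case ij of (i, j) \<Rightarrow> g i * h j) \<ge> e}" by (rule finite_subset)
qed

lemma null_family_inj:
  assumes "null_family h" "inj f"
  shows "null_family (\<lambda>i. h (f i))"
  unfolding null_family_def
proof (intro allI impI)
  fix e :: real assume "e > 0"
  have "finite (f -` {i. h i \<ge> e})"
    using assms \<open>e > 0\<close> by (intro finite_vimageI) (auto simp: null_family_def)
  then show "finite {i. h (f i) \<ge> e}" by (simp add: vimage_def)
qed

text \<open>In a complete ultrametric field null terms suffice: partial sums containing all terms of
  size at least e / 2 differ by at most e / 2, so the partial sums form a Cauchy filter.\<close>

lemma null_family_summable:
  fixes f :: "'i \<Rightarrow> 'a::{nonarch_field, complete_space}"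
  assumes "null_family (\<lambda>i. absval (f i))"
  shows "f summable_on S"
proof -
  have "cauchy_filter (filtermap (sum f) (finite_subsets_at_top S))"
    unfolding cauchy_filter_metric_filtermap
  proof (intro allI impI)
    fix e :: real assume "e > 0"
    define E where "E = S \<inter> {i. absval (f i) \<ge> e / 2}"
    have "finite {i. absval (f i) \<ge> e / 2}"
      using assms \<open>e > 0\<close> unfolding null_family_def by (meson half_gt_zero)
    then have E: "finite E" "E \<subseteq> S" by (simp_all add: E_def)
    define P where "P F \<longleftrightarrow> finite F \<and> E \<subseteq> F \<and> F \<subseteq> S" for F
    have "eventually P (finite_subsets_at_top S)"
      unfolding eventually_finite_subsets_at_top P_def using E by blast
    moreover have "dist (sum f F) (sum f G) < e" if "P F" "P G" for F G
    proof -
      have "absval (sum f H - sum f E) \<le> e / 2" if "P H" for H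
      proof -
        have "sum f H - sum f E = sum f (H - E)"
          using that by (simp add: P_def sum_diff)
        also have "absval \<dots> \<le> e / 2"
          using that \<open>e > 0\<close> by (intro absval_sum_le) (auto simp: P_def E_def)
        finally show ?thesis .
      qed
      from absval_diff_le[OF this[OF \<open>P F\<close>] this[OF \<open>P G\<close>]] show ?thesis
        using \<open>e > 0\<close> by (simp add: dist_absval)
    qed
    ultimately show "\<exists>P. eventually P (finite_subsets_at_top S) \<and>
        (\<forall>x y. P x \<and> P y \<longrightarrow> dist (sum f x) (sum f y) < e)"
      by blast
  qed
  moreover have "complete (UNIV::'a set)"
    by (meson Cauchy_convergent UNIV_I complete_def convergent_def)
  ultimately obtain L where "(sum f \<longlongrightarrow> L) (finite_subsets_at_top S)"
    using complete_uniform[where S=UNIV] by (force simp add: filterlim_def)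
  then show ?thesis
    using summable_on_def has_sum_def by blast
qed

section \<open>The ring of a polyannulus\<close>

lemma weight_pos: "(\<And>i. 0 < \<rho> $ i) \<Longrightarrow> 0 < weight \<rho> j"
  by (simp add: weight_def prod_pos)

lemma weight_add: "(\<And>i. 0 < \<rho> $ i) \<Longrightarrow> weight \<rho> (j + k) = weight \<rho> j * weight \<rho> k"
  by (simp add: weight_def power_int_add less_imp_neq[symmetric] prod.distrib)

lemma laurent_fun_iff:
  fixes J :: "(real ^ 'n::finite) set"
  assumes "\<And>\<rho> i. \<rho> \<in> J \<Longrightarrow> 0 < \<rho> $ i"
  shows "f \<in> laurent_fun J \<longleftrightarrow> (\<forall>\<rho>\<in>J. null_family (\<lambda>j. absval (f j) * weight \<rho> j))"
  unfolding laurent_fun_def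
  using assms by (auto simp: null_family_iff weight_pos less_imp_le)

text \<open>Positive radii make the weights multiplicative. A point of J is needed to make Cauchy
  products summable: over the empty set every family would belong to
  \<open>laurent_fun\<close>.\<close>

locale polyannulus =
  fixes J :: "(real ^ 'n::finite) set"
  assumes nonempty: "J \<noteq> {}"
    and pos: "\<And>\<rho> i. \<rho> \<in> J \<Longrightarrow> 0 < \<rho> $ i"
begin

lemma laurent_iff:
  "f \<in> laurent_fun J \<longleftrightarrow> (\<forall>\<rho>\<in>J. null_family (\<lambda>j. absval (f j) * weight \<rho> j))"
  by (rule laurent_fun_iff) (rule pos)

lemma laurent_null:
  "f \<in> laurent_fun J \<Longrightarrow> \<rho> \<in> J \<Longrightarrow> null_family (\<lambda>j. absval (f j) * weight \<rho> j)"
  by (simp add: laurent_iff)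

lemma wpos [simp]: "\<rho> \<in> J \<Longrightarrow> 0 < weight \<rho> j"
  by (rule weight_pos) (rule pos)

lemma wnonneg [simp]: "\<rho> \<in> J \<Longrightarrow> 0 \<le> weight \<rho> j"
  by (simp add: less_imp_le)

lemma wadd: "\<rho> \<in> J \<Longrightarrow> weight \<rho> (j + k) = weight \<rho> j * weight \<rho> k"
  by (simp add: weight_add pos)

lemma wdiff:
  assumes "\<rho> \<in> J"
  shows "weight \<rho> (j - k) = weight \<rho> j / weight \<rho> k"
proof -
  have "weight \<rho> k \<noteq> 0" using wpos[OF assms, of k] by simp
  moreover have "weight \<rho> (j - k) * weight \<rho> k = weight \<rho> j"
    by (simp add: wadd[OF assms, symmetric])
  ultimately show ?thesis by (metis nonzero_mult_div_cancel_right)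
qed

lemma laurent_bounded:
  assumes "f \<in> laurent_fun J" "\<rho> \<in> J"
  shows "bdd_above (range (\<lambda>j. absval (f j) * weight \<rho> j))"
proof -
  obtain C where "\<And>j. absval (f j) * weight \<rho> j \<le> C"
    using null_family_bounded[OF laurent_null[OF assms]] by blast
  then show ?thesis by (intro bdd_aboveI2)
qed

lemma gauss_norm_upper:
  assumes "f \<in> laurent_fun J" "\<rho> \<in> J"
  shows "absval (f j) * weight \<rho> j \<le> gauss_norm \<rho> f"
  unfolding gauss_norm_def by (rule cSUP_upper[OF _ laurent_bounded[OF assms]]) simp

lemma laurent_add:
  assumes "f \<in> laurent_fun J" "g \<in> laurent_fun J"
  shows "(\<lambda>j. f j + g j) \<in> laurent_fun J"
  unfolding laurent_iff null_family_def
proof (intro ballI allI impI)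
  fix \<rho> and e :: real assume "\<rho> \<in> J" "e > 0"
  have "e \<le> absval (f j) * weight \<rho> j \<or> e \<le> absval (g j) * weight \<rho> j"
    if "e \<le> absval (f j + g j) * weight \<rho> j" for j
  proof -
    have "e \<le> max (absval (f j)) (absval (g j)) * weight \<rho> j"
      using that \<open>\<rho> \<in> J\<close> by (meson absval_add mult_right_mono order_trans wnonneg)
    then show ?thesis by (auto simp: max_def split: if_splits)
  qed
  then have "{j. e \<le> absval (f j + g j) * weight \<rho> j}
      \<subseteq> {j. e \<le> absval (f j) * weight \<rho> j} \<union> {j. e \<le> absval (g j) * weight \<rho> j}"
    by auto
  moreover have "finite \<dots>"
    using laurent_null[OF assms(1) \<open>\<rho> \<in> J\<close>] laurent_null[OF assms(2) \<open>\<rho> \<in> J\<close>] \<open>e > 0\<close>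
    by (simp add: null_family_def)
  ultimately show "finite {j. e \<le> absval (f j + g j) * weight \<rho> j}" by (rule finite_subset)
qed

text \<open>Serves both for constants and for the factor j_i produced by the derivation, an integer
  and hence of absolute value at most 1.\<close>

lemma laurent_bounded_mult:
  assumes "f \<in> laurent_fun J" "\<And>j. absval (u j :: 'b::nonarch_field) \<le> C" "0 \<le> C"
  shows "(\<lambda>j. u j * f j) \<in> laurent_fun J"
  unfolding laurent_iff
proof
  fix \<rho> assume "\<rho> \<in> J"
  have "absval (u j * f j) * weight \<rho> j \<le> C * (absval (f j) * weight \<rho> j)" for j
    unfolding absval_mult mult.assoc
    by (rule mult_right_mono[OF assms(2)]) (simp add: \<open>\<rho> \<in> J\<close>)
  then show "null_family (\<lambda>j. absval (u j * f j) * weight \<rho> j)"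
    by (rule null_family_le[OF laurent_null[OF assms(1) \<open>\<rho> \<in> J\<close>]]) (rule assms(3))
qed

lemma laurent_scale: "f \<in> laurent_fun J \<Longrightarrow> (\<lambda>j. c * f j) \<in> laurent_fun J"
  by (rule laurent_bounded_mult[of f "\<lambda>_. c" "absval c"]) auto

lemma laurent_uminus: "f \<in> laurent_fun J \<Longrightarrow> (\<lambda>j. - f j) \<in> laurent_fun J"
  using laurent_scale[of f "-1"] by simp

lemma laurent_shift:
  assumes "f \<in> laurent_fun J"
  shows "(\<lambda>j. f (j - m)) \<in> laurent_fun J"
  unfolding laurent_iff
proof
  fix \<rho> assume \<rho>: "\<rho> \<in> J"
  have "inj (\<lambda>j. j - m)" by (simp add: inj_def)
  from null_family_inj[OF laurent_null[OF assms \<rho>] this]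
  have "null_family (\<lambda>j. absval (f (j - m)) * weight \<rho> (j - m))" .
  then show "null_family (\<lambda>j. absval (f (j - m)) * weight \<rho> j)"
    by (rule null_family_le[of _ _ "weight \<rho> m"])
       (use \<rho> wpos[OF \<rho>, of m] less_imp_neq[OF wpos[OF \<rho>, of m]] in \<open>simp_all add: wdiff\<close>)
qed

lemma laurent_finite_support:
  assumes "finite {j. f j \<noteq> 0}"
  shows "f \<in> laurent_fun J"
  unfolding laurent_iff null_family_def
proof (intro ballI allI impI)
  fix \<rho> and e :: real assume "\<rho> \<in> J" "e > 0"
  then have "{j. e \<le> absval (f j) * weight \<rho> j} \<subseteq> {j. f j \<noteq> 0}" by auto
  then show "finite {j. e \<le> absval (f j) * weight \<rho> j}" using assms finite_subset by blast
qed

lemma laurent_sum: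
  "(\<And>b. b \<in> F \<Longrightarrow> f b \<in> laurent_fun J) \<Longrightarrow> (\<lambda>j. \<Sum>b\<in>F. f b j) \<in> laurent_fun J"
  by (induction F rule: infinite_finite_induct)
     (simp_all add: laurent_add laurent_finite_support)

end

section \<open>The Cauchy product and the ring axioms\<close>

definition convolution :: "('k::nonarch_field, 'n::finite) series \<Rightarrow> ('k, 'n) series \<Rightarrow> ('k, 'n) series" where
  "convolution f g = (\<lambda>j. \<Sum>\<^sub>\<infinity>l. f l * g (j - l))"

lemma laurent_ring_simps [simp]:
  "carrier (laurent_ring J) = laurent_fun J"
  "f \<otimes>\<^bsub>laurent_ring J\<^esub> g = convolution f g"
  "\<one>\<^bsub>laurent_ring J\<^esub> = lmonom 0"
  "\<zero>\<^bsub>laurent_ring J\<^esub> = (\<lambda>j. 0)"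
  "f \<oplus>\<^bsub>laurent_ring J\<^esub> g = (\<lambda>j. f j + g j)"
  by (simp_all add: laurent_ring_def convolution_def)

lemma convolution_shift_right:
  "convolution f (\<lambda>j. g (j - m)) = (\<lambda>j. convolution f g (j - m))"
  by (simp add: convolution_def algebra_simps)

lemma convolution_scale_right:
  "convolution f (\<lambda>j. c * g j) = (\<lambda>j. c * convolution f g j)"
  by (simp add: convolution_def mult.left_commute[of _ c] infsum_mult_left_nonarch)

lemma convolution_monomial:
  "convolution (\<lambda>j. if j = m then c else 0) g = (\<lambda>j. c * g (j - m))"
proof
  fix j
  have "((\<lambda>l. (if l = m then c else 0) * g (j - l)) has_sum (\<Sum>l\<in>{m}. (if l = m then c else 0) * g (j - l))) UNIV"
    by (rule has_sum_finite_neutralI[of "{m}"]) simp_all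
  then show "convolution (\<lambda>j. if j = m then c else 0) g j = c * g (j - m)"
    unfolding convolution_def by (simp add: infsumI)
qed

lemma convolution_commute:
  fixes f g :: "('k::nonarch_field, 'n::finite) series"
  shows "convolution f g = convolution g f"
proof
  fix j :: "int ^ 'n"
  have "bij_betw (\<lambda>l. j - l) UNIV UNIV"
    by (rule bij_betw_byWitness[of _ "\<lambda>l. j - l"]) simp_all
  from infsum_reindex_bij_betw[OF this, of "\<lambda>l. g l * f (j - l)"]
  show "convolution f g j = convolution g f j"
    by (simp add: convolution_def mult.commute)
qed

context polyannulus
begin

lemma convolution_bound:
  assumes "\<rho> \<in> J" "\<And>l. absval (f l) * weight \<rho> l * (absval (g (j - l)) * weight \<rho> (j - l)) \<le> c" "0 \<le> c"
  shows "absval (convolution f g j) * weight \<rho> j \<le> c"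
proof -
  have "absval (f l * g (j - l)) \<le> c / weight \<rho> j" for l
  proof -
    have "absval (f l * g (j - l)) * weight \<rho> j \<le> c"
      using assms(2)[of l] wpos[OF assms(1), of l] by (simp add: wdiff assms(1) absval_mult)
    then show ?thesis using assms(1) by (simp add: pos_le_divide_eq)
  qed
  then have "absval (convolution f g j) \<le> c / weight \<rho> j"
    unfolding convolution_def using assms(1,3) by (intro infsum_absval_le) auto
  then show ?thesis using assms(1) by (simp add: pos_le_divide_eq)
qed

text \<open>A coefficient of weighted size at least e must contain a pair (l, j - l) whose product
  has size at least e / 2; there are finitely many such pairs, hence finitely many j. The half is
  needed because a bound on all terms passes to the infinite sum only as a weak inequality.\<close>

lemma laurent_convolution:
  assumes "f \<in> laurent_fun J" "g \<in> laurent_fun J"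
  shows "convolution f g \<in> laurent_fun J"
  unfolding laurent_iff null_family_def
proof (intro ballI allI impI)
  fix \<rho> and e :: real assume \<rho>: "\<rho> \<in> J" and "e > 0"
  let ?E = "{ij. e / 2 \<le> (case ij of (i, j) \<Rightarrow> absval (f i) * weight \<rho> i * (absval (g j) * weight \<rho> j))}"
  have "null_family (\<lambda>(i, j). absval (f i) * weight \<rho> i * (absval (g j) * weight \<rho> j))"
    using \<rho> assms by (intro null_family_mult laurent_null) auto
  then have fin: "finite ?E"
    unfolding null_family_def using \<open>e > 0\<close> half_gt_zero by blast
  have "j \<in> (\<lambda>(a, b). a + b) ` ?E" if j: "e \<le> absval (convolution f g j) * weight \<rho> j" for j
  proof (rule ccontr)
    assume j': "j \<notin> (\<lambda>(a, b). a + b) ` ?E"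
    have "(l, j - l) \<notin> ?E" for l
    proof
      assume "(l, j - l) \<in> ?E"
      then have "(\<lambda>(a, b). a + b) (l, j - l) \<in> (\<lambda>(a, b). a + b) ` ?E" by (rule imageI)
      with j' show False by simp
    qed
    then have "absval (convolution f g j) * weight \<rho> j \<le> e / 2"
      using \<rho> \<open>e > 0\<close> by (intro convolution_bound) (auto simp: not_le less_imp_le)
    with j \<open>e > 0\<close> show False by simp
  qed
  then have "{j. e \<le> absval (convolution f g j) * weight \<rho> j} \<subseteq> (\<lambda>(a, b). a + b) ` ?E"
    by blast
  then show "finite {j. e \<le> absval (convolution f g j) * weight \<rho> j}"
    using fin by (meson finite_imageI finite_subset)
qed

text \<open>At one fixed radius the third factor is at most C divided by its weight, and that weight
  is the weight of j divided by those of a and b. The family is thus dominated by the product family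
  of f and g.\<close>

lemma convolution_pair_null:
  assumes "f \<in> laurent_fun J" "g \<in> laurent_fun J" "h \<in> laurent_fun J"
  shows "null_family (\<lambda>(a, b). absval (f a * g b * h (j - a - b)))"
proof -
  obtain \<rho> where \<rho>: "\<rho> \<in> J" using nonempty by blast
  obtain C where C: "C > 0" "\<And>j. absval (h j) * weight \<rho> j \<le> C"
    using null_family_bounded[OF laurent_null[OF assms(3) \<rho>]] by blast
  have "null_family (\<lambda>(i, j). absval (f i) * weight \<rho> i * (absval (g j) * weight \<rho> j))"
    using \<rho> assms by (intro null_family_mult laurent_null) auto
  then show ?thesis
  proof (rule null_family_le[of _ _ "C / weight \<rho> j"])
    fix ab :: "(int ^ 'n) \<times> (int ^ 'n)"
    obtain a b where ab: "ab = (a, b)" by (cases ab)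
    have "absval (h (j - a - b)) \<le> C / weight \<rho> (j - a - b)"
      using C(2)[of "j - a - b"] \<rho> by (simp add: pos_le_divide_eq)
    then have "absval (f a) * absval (g b) * absval (h (j - a - b))
        \<le> absval (f a) * absval (g b) * (C / weight \<rho> (j - a - b))"
      by (intro mult_left_mono) auto
    then show "(case ab of (a, b) \<Rightarrow> absval (f a * g b * h (j - a - b))) \<le> C / weight \<rho> j *
        (case ab of (i, j) \<Rightarrow> absval (f i) * weight \<rho> i * (absval (g j) * weight \<rho> j))"
      by (simp add: ab absval_mult wdiff \<rho> mult_ac)
  qed (use C \<rho> in auto)
qed

lemma lmonom_closed: "lmonom m \<in> laurent_fun J"
  by (rule laurent_finite_support) (simp add: lmonom_def)

lemma monomial_closed: "(\<lambda>j. if j = m then c else 0) \<in> laurent_fun J"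
  by (rule laurent_finite_support) simp

lemma convolution_summable:
  fixes f g :: "('k::{nonarch_field,complete_space}, 'n) series"
  assumes "f \<in> laurent_fun J" "g \<in> laurent_fun J"
  shows "(\<lambda>l. f l * g (j - l)) summable_on UNIV"
proof (rule null_family_summable)
  \<comment> \<open>With the unit \<open>lmonom 0\<close> as middle factor and b = 0, the triple
    family is the one defining the product of f and g.\<close>
  have "inj (\<lambda>l::int^'n. (l, 0 :: int^'n))" by (simp add: inj_def)
  from null_family_inj[OF convolution_pair_null[OF assms(1) lmonom_closed[of 0] assms(2), of j] this]
  show "null_family (\<lambda>l. absval (f l * g (j - l)))"
    by (simp add: lmonom_def)
qed

lemma convolution_add_right:
  fixes f g h :: "('k::{nonarch_field,complete_space}, 'n) series"
  assumes "f \<in> laurent_fun J" "g \<in> laurent_fun J" "h \<in> laurent_fun J"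
  shows "convolution f (\<lambda>j. g j + h j) = (\<lambda>j. convolution f g j + convolution f h j)"
  unfolding convolution_def
  by (simp add: distrib_left infsum_add[OF convolution_summable convolution_summable] assms)

text \<open>Both iterated sums are sums of the one family f_a g_b h_(j-a-b) over pairs, which is
  summable because it is null.\<close>

lemma convolution_assoc:
  fixes f g h :: "('k::{nonarch_field,complete_space}, 'n) series"
  assumes "f \<in> laurent_fun J" "g \<in> laurent_fun J" "h \<in> laurent_fun J"
  shows "convolution (convolution f g) h = convolution f (convolution g h)"
proof
  fix j
  let ?t = "\<lambda>(a, b). f a * g b * h (j - a - b)"
  have s: "?t summable_on UNIV \<times> UNIV"
  proof (rule null_family_summable)
    have "(\<lambda>i. absval (?t i)) = (\<lambda>(a, b). absval (f a * g b * h (j - a - b)))" by auto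
    then show "null_family (\<lambda>i. absval (?t i))"
      using convolution_pair_null[OF assms, of j] by (simp only:)
  qed
  have s1: "(\<lambda>b. f a * (g b * h (j - a - b))) summable_on UNIV" for a
    using has_sum_mult_left_nonarch[OF has_sum_infsum[OF convolution_summable[OF assms(2,3)]]]
    by (rule has_sum_imp_summable)
  have "convolution f (convolution g h) j = (\<Sum>\<^sub>\<infinity>a. \<Sum>\<^sub>\<infinity>b. f a * (g b * h (j - a - b)))"
    by (simp add: convolution_def infsum_mult_left_nonarch)
  also have "\<dots> = infsum (\<lambda>(a, b). f a * (g b * h (j - a - b))) (UNIV \<times> UNIV)"
    using s s1 by (intro infsum_Sigma' uniformly_continuous_plus) (auto simp: mult.assoc)
  also have "\<dots> = infsum ?t (UNIV \<times> UNIV)" by (simp add: mult.assoc)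
  finally have 1: "convolution f (convolution g h) j = infsum ?t (UNIV \<times> UNIV)" .
  \<comment> \<open>Here c = a + b is the index of the inner product of f and g.\<close>
  let ?b = "\<lambda>(c, a). (a, c - a :: int ^ 'n)"
  have bij: "bij_betw ?b (UNIV \<times> UNIV) (UNIV \<times> UNIV)"
    by (rule bij_betw_byWitness[of _ "\<lambda>(a, b). (a + b, a)"]) auto
  have tb: "?t (?b ca) = (case ca of (c, a) \<Rightarrow> h (j - c) * (f a * g (c - a)))" for ca
    by (cases ca) (simp add: algebra_simps)
  have s': "(\<lambda>(c, a). h (j - c) * (f a * g (c - a))) summable_on UNIV \<times> UNIV"
    using s unfolding summable_on_reindex_bij_betw[OF bij, of ?t, symmetric] tb .
  have s2: "(\<lambda>a. h (j - c) * (f a * g (c - a))) summable_on UNIV" for c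
    using has_sum_mult_left_nonarch[OF has_sum_infsum[OF convolution_summable[OF assms(1,2)]]]
    by (rule has_sum_imp_summable)
  have "convolution (convolution f g) h j = (\<Sum>\<^sub>\<infinity>c. \<Sum>\<^sub>\<infinity>a. h (j - c) * (f a * g (c - a)))"
    by (simp add: convolution_def infsum_mult_left_nonarch mult.commute)
  also have "\<dots> = infsum (\<lambda>(c, a). h (j - c) * (f a * g (c - a))) (UNIV \<times> UNIV)"
    using s' s2 by (intro infsum_Sigma' uniformly_continuous_plus)
  also have "\<dots> = infsum ?t (UNIV \<times> UNIV)"
    unfolding infsum_reindex_bij_betw[OF bij, of ?t, symmetric] tb ..
  finally show "convolution (convolution f g) h j = convolution f (convolution g h) j"
    using 1 by simp
qed

lemma convolution_lmonom: "convolution (lmonom m) f = (\<lambda>j. f (j - m))"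
  using convolution_monomial[of m 1 f] by (simp add: lmonom_def)

lemma laurent_ring_cring:
  "cring (laurent_ring J :: ('k::{nonarch_field,complete_space}, 'n) series ring)"
    (is "cring ?R")
proof (rule cringI)
  show "abelian_group ?R"
  proof (rule abelian_groupI)
    fix f assume "f \<in> carrier ?R"
    then show "\<exists>y\<in>carrier ?R. y \<oplus>\<^bsub>?R\<^esub> f = \<zero>\<^bsub>?R\<^esub>"
      by (intro bexI[of _ "\<lambda>j. - f j"]) (auto intro: laurent_uminus)
  qed (simp_all add: laurent_add laurent_finite_support algebra_simps)
  show "comm_monoid ?R"
    by (rule comm_monoidI)
       (simp_all add: laurent_convolution lmonom_closed convolution_assoc convolution_lmonom,
        rule convolution_commute)
  show "(x \<oplus>\<^bsub>?R\<^esub> y) \<otimes>\<^bsub>?R\<^esub> z = x \<otimes>\<^bsub>?R\<^esub> z \<oplus>\<^bsub>?R\<^esub> y \<otimes>\<^bsub>?R\<^esub> z"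
    if "x \<in> carrier ?R" "y \<in> carrier ?R" "z \<in> carrier ?R" for x y z
    using convolution_add_right[of z x y] that
    unfolding laurent_ring_simps convolution_commute[of x z] convolution_commute[of y z]
      convolution_commute[of "\<lambda>j. x j + y j" z] by simp
qed

lemma laurent_finsum:
  fixes f :: "'b \<Rightarrow> ('k::{nonarch_field,complete_space}, 'n) series"
  assumes "finite F" "\<And>b. b \<in> F \<Longrightarrow> f b \<in> laurent_fun J"
  shows "(\<Oplus>\<^bsub>laurent_ring J\<^esub>b\<in>F. f b) = (\<lambda>j. \<Sum>b\<in>F. f b j)"
  using assms
proof (induction F)
  case empty
  interpret R: cring "laurent_ring J :: ('k, 'n) series ring" by (rule laurent_ring_cring)
  show ?case by simp
next
  case (insert b F)
  interpret R: cring "laurent_ring J :: ('k, 'n) series ring" by (rule laurent_ring_cring)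
  have "(\<Oplus>\<^bsub>laurent_ring J\<^esub>b\<in>insert b F. f b)
      = f b \<oplus>\<^bsub>laurent_ring J\<^esub> (\<Oplus>\<^bsub>laurent_ring J\<^esub>b\<in>F. f b)"
    using insert by (intro R.finsum_insert) auto
  then show ?case using insert by simp
qed

end

section \<open>Bases and determinants over commutative rings\<close>

context cring
begin

lemma finsum_kronecker:
  assumes "finite X" "a \<in> X" "\<And>d. d \<in> X \<Longrightarrow> x d \<in> carrier R"
  shows "(\<Oplus>d\<in>X. x d \<otimes> (if a = d then \<one> else \<zero>)) = x a"
proof -
  have "(\<Oplus>d\<in>X. x d \<otimes> (if a = d then \<one> else \<zero>)) = (\<Oplus>d\<in>X. if a = d then x d else \<zero>)"
    using assms by (intro finsum_cong') auto
  then show ?thesis using finsum_singleton[of a X x] assms by auto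
qed

lemma finsum_swap:
  assumes "finite X" "finite Y" "\<And>a b. a \<in> X \<Longrightarrow> b \<in> Y \<Longrightarrow> f a b \<in> carrier R"
  shows "(\<Oplus>a\<in>X. \<Oplus>b\<in>Y. f a b) = (\<Oplus>b\<in>Y. \<Oplus>a\<in>X. f a b)"
  using assms(1,3)
proof (induction X)
  case empty
  then show ?case by simp
next
  case (insert x X)
  have "(\<Oplus>a\<in>insert x X. \<Oplus>b\<in>Y. f a b) = (\<Oplus>b\<in>Y. f x b) \<oplus> (\<Oplus>b\<in>Y. \<Oplus>a\<in>X. f a b)"
    using insert by (subst finsum_insert) auto
  also have "\<dots> = (\<Oplus>b\<in>Y. f x b \<oplus> (\<Oplus>a\<in>X. f a b))"
    using insert by (subst finsum_addf) auto
  also have "\<dots> = (\<Oplus>b\<in>Y. \<Oplus>a\<in>insert x X. f a b)"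
    using insert by (intro finsum_cong') (auto simp: Pi_def)
  finally show ?case .
qed

text \<open>This is (x M) n = x (M n) for a row x, a matrix M and a column n.\<close>

lemma finsum_mult_assoc:
  assumes "finite X" "finite Y" "\<And>d. d \<in> Y \<Longrightarrow> x d \<in> carrier R"
    and "\<And>d a. d \<in> Y \<Longrightarrow> a \<in> X \<Longrightarrow> M d a \<in> carrier R"
    and "\<And>a. a \<in> X \<Longrightarrow> n a \<in> carrier R"
  shows "(\<Oplus>a\<in>X. (\<Oplus>d\<in>Y. x d \<otimes> M d a) \<otimes> n a) = (\<Oplus>d\<in>Y. x d \<otimes> (\<Oplus>a\<in>X. M d a \<otimes> n a))"
proof -
  have "(\<Oplus>a\<in>X. (\<Oplus>d\<in>Y. x d \<otimes> M d a) \<otimes> n a) = (\<Oplus>a\<in>X. \<Oplus>d\<in>Y. x d \<otimes> M d a \<otimes> n a)"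
    using assms by (intro finsum_cong') (auto simp: finsum_ldistr Pi_def)
  also have "\<dots> = (\<Oplus>d\<in>Y. \<Oplus>a\<in>X. x d \<otimes> M d a \<otimes> n a)"
    using assms by (intro finsum_swap) auto
  also have "\<dots> = (\<Oplus>d\<in>Y. x d \<otimes> (\<Oplus>a\<in>X. M d a \<otimes> n a))"
    using assms by (intro finsum_cong') (auto simp: finsum_rdistr Pi_def m_assoc intro!: finsum_cong')
  finally show ?thesis .
qed

text \<open>A basis is the same thing as an invertible matrix, so it stays a basis over any larger ring.\<close>

lemma module_basis_inverse:
  assumes "module_basis R r e"
  obtains C where "\<And>b a. b < r \<Longrightarrow> a < r \<Longrightarrow> C b a \<in> carrier R"
    "\<And>b a. b < r \<Longrightarrow> a < r \<Longrightarrow> (\<Oplus>d\<in>{..<r}. C b d \<otimes> e d a) = (if a = b then \<one> else \<zero>)"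
    "\<And>b a. b < r \<Longrightarrow> a < r \<Longrightarrow> (\<Oplus>d\<in>{..<r}. e b d \<otimes> C d a) = (if a = b then \<one> else \<zero>)"
proof -
  have e: "e b a \<in> carrier R" if "b < r" "a < r" for a b
    using assms that by (auto simp: module_basis_def free_module_def)
  have unit: "unit_vector R r b \<in> free_module R r" for b
    by (auto simp: unit_vector_def free_module_def)
  have "\<exists>c. c \<in> free_module R r \<and> unit_vector R r b = lincomb R r e c" for b
    using assms unit[of b] unfolding module_basis_def by blast
  then obtain C where C: "C b \<in> free_module R r" "unit_vector R r b = lincomb R r e (C b)" for b
    by metis
  have Cc: "C b a \<in> carrier R" if "a < r" for a b
    using C(1)[of b] that by (auto simp: free_module_def)
  have 1: "(\<Oplus>d\<in>{..<r}. C b d \<otimes> e d a) = (if a = b then \<one> else \<zero>)" if "b < r" "a < r" for a b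
    using fun_cong[OF C(2)[of b], of a] that by (simp add: unit_vector_def lincomb_def)
  have 2: "(\<Oplus>d\<in>{..<r}. e b d \<otimes> C d a) = (if a = b then \<one> else \<zero>)" if "b < r" "a < r" for a b
  proof -
    \<comment> \<open>y is row b of e C. From C e = 1 it follows that y and the unit vector are both
      coordinates of \<open>e b\<close>, so uniqueness of coordinates turns the left inverse C into
      a right inverse.\<close>
    define y where "y = (\<lambda>a\<in>{..<r}. \<Oplus>d\<in>{..<r}. e b d \<otimes> C d a)"
    have eb: "e b \<in> free_module R r" using assms that by (simp add: module_basis_def)
    have y: "y \<in> free_module R r"
      using e Cc that by (auto simp: y_def free_module_def intro!: finsum_closed)
    have "lincomb R r e y = e b"
    proof
      fix a'
      show "lincomb R r e y a' = e b a'"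
      proof (cases "a' < r")
        case True
        have "lincomb R r e y a' = (\<Oplus>a\<in>{..<r}. (\<Oplus>d\<in>{..<r}. e b d \<otimes> C d a) \<otimes> e a a')"
          using True e Cc that by (auto simp: lincomb_def y_def intro!: finsum_cong')
        also have "\<dots> = (\<Oplus>d\<in>{..<r}. e b d \<otimes> (\<Oplus>a\<in>{..<r}. C d a \<otimes> e a a'))"
          using True e Cc that by (intro finsum_mult_assoc) auto
        also have "\<dots> = (\<Oplus>d\<in>{..<r}. e b d \<otimes> (if a' = d then \<one> else \<zero>))"
          using True e that by (intro finsum_cong') (auto simp: 1)
        also have "\<dots> = e b a'"
          using True e that by (intro finsum_kronecker) auto
        finally show ?thesis .
      next
        case False
        then show ?thesis
            using PiE_arb[OF eb[unfolded free_module_def], of a'] by (simp add: lincomb_def)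
      qed
    qed
    moreover have "lincomb R r e (unit_vector R r b) = e b"
    proof
      fix a'
      show "lincomb R r e (unit_vector R r b) a' = e b a'"
      proof (cases "a' < r")
        case True
        have "lincomb R r e (unit_vector R r b) a'
            = (\<Oplus>d\<in>{..<r}. e d a' \<otimes> (if b = d then \<one> else \<zero>))"
          using True e that
          by (auto simp: lincomb_def unit_vector_def intro!: finsum_cong')
        also have "\<dots> = e b a'"
          using True e that by (intro finsum_kronecker) auto
        finally show ?thesis .
      next
        case False
        then show ?thesis
            using PiE_arb[OF eb[unfolded free_module_def], of a'] by (simp add: lincomb_def)
      qed
    qed
    ultimately have "y = unit_vector R r b"
      using assms eb y unit[of b] unfolding module_basis_def by metis
    then show ?thesis
      using that by (auto simp: y_def unit_vector_def dest: fun_cong[of _ _ a])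
  qed
  show ?thesis using that[of C] Cc 1 2 by blast
qed

text \<open>The coordinates of x form the row x C: C e = 1 shows that they represent x, and e C = 1
  that any coordinates y with x = y e equal x C.\<close>

lemma module_basis_if_inverse:
  assumes e: "\<And>b. b < r \<Longrightarrow> e b \<in> free_module R r"
    and C: "\<And>b a. b < r \<Longrightarrow> a < r \<Longrightarrow> C b a \<in> carrier R"
    and 1: "\<And>b a. b < r \<Longrightarrow> a < r \<Longrightarrow> (\<Oplus>d\<in>{..<r}. C b d \<otimes> e d a) = (if a = b then \<one> else \<zero>)"
    and 2: "\<And>b a. b < r \<Longrightarrow> a < r \<Longrightarrow> (\<Oplus>d\<in>{..<r}. e b d \<otimes> C d a) = (if a = b then \<one> else \<zero>)"
  shows "module_basis R r e"
  unfolding module_basis_def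
proof (intro conjI allI impI ballI)
  fix x assume x: "x \<in> free_module R r"
  have ec: "e b a \<in> carrier R" if "b < r" "a < r" for a b
    using e[OF that(1)] that by (auto simp: free_module_def)
  have xc: "x a \<in> carrier R" if "a < r" for a
    using x that by (auto simp: free_module_def)
  define c where "c = (\<lambda>a\<in>{..<r}. \<Oplus>d\<in>{..<r}. x d \<otimes> C d a)"
  show "\<exists>!c. c \<in> free_module R r \<and> x = lincomb R r e c"
  proof (rule ex1I[of _ c])
    have "x = lincomb R r e c"
    proof
      fix a
      show "x a = lincomb R r e c a"
      proof (cases "a < r")
        case True
        have "lincomb R r e c a = (\<Oplus>b\<in>{..<r}. (\<Oplus>d\<in>{..<r}. x d \<otimes> C d b) \<otimes> e b a)"
          using True ec C xc by (auto simp: lincomb_def c_def intro!: finsum_cong')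
        also have "\<dots> = (\<Oplus>d\<in>{..<r}. x d \<otimes> (\<Oplus>b\<in>{..<r}. C d b \<otimes> e b a))"
          using True ec C xc by (intro finsum_mult_assoc) auto
        also have "\<dots> = (\<Oplus>d\<in>{..<r}. x d \<otimes> (if a = d then \<one> else \<zero>))"
          using True xc by (intro finsum_cong') (auto simp: 1)
        also have "\<dots> = x a"
          using True xc by (intro finsum_kronecker) auto
        finally show ?thesis ..
      next
        case False
        then show ?thesis
          using PiE_arb[OF x[unfolded free_module_def], of a] by (simp add: lincomb_def)
      qed
    qed
    moreover have "c \<in> free_module R r"
      using C xc by (auto simp: c_def free_module_def intro!: finsum_closed)
    ultimately show "c \<in> free_module R r \<and> x = lincomb R r e c" by simp
  next
    fix y assume y: "y \<in> free_module R r \<and> x = lincomb R r e y"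
    have yc: "y a \<in> carrier R" if "a < r" for a
      using y that by (auto simp: free_module_def)
    show "y = c"
    proof
      fix a
      show "y a = c a"
      proof (cases "a < r")
        case True
        have "c a = (\<Oplus>d\<in>{..<r}. (\<Oplus>b\<in>{..<r}. y b \<otimes> e b d) \<otimes> C d a)"
          using True ec C yc y by (auto simp: lincomb_def c_def intro!: finsum_cong')
        also have "\<dots> = (\<Oplus>b\<in>{..<r}. y b \<otimes> (\<Oplus>d\<in>{..<r}. e b d \<otimes> C d a))"
          using True ec C yc by (intro finsum_mult_assoc) auto
        also have "\<dots> = (\<Oplus>b\<in>{..<r}. y b \<otimes> (if a = b then \<one> else \<zero>))"
          using True yc by (intro finsum_cong') (auto simp: 2)
        also have "\<dots> = y a"
          using True yc by (intro finsum_kronecker) auto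
        finally show ?thesis ..
      next
        case False
        then show ?thesis
          using PiE_arb[OF conjunct1[OF y, unfolded free_module_def], of a] by (simp add: c_def)
      qed
    qed
  qed
qed (rule e)

lemma ring_det_term_closed:
  assumes "\<And>a b. a < r \<Longrightarrow> b < r \<Longrightarrow> S a b \<in> carrier R" "\<sigma> permutes {..<r}"
  shows "(\<Otimes>a\<in>{..<r}. S a (\<sigma> a)) \<in> carrier R"
  using assms permutes_in_image[OF assms(2)] by (auto intro!: finprod_closed)

lemma ring_det_closed:
  assumes "\<And>a b. a < r \<Longrightarrow> b < r \<Longrightarrow> S a b \<in> carrier R"
  shows "ring_det R r S \<in> carrier R"
proof -
  have "(\<Otimes>a\<in>{..<r}. S a (\<sigma> a)) \<in> carrier R" if "\<sigma> permutes {..<r}" for \<sigma>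
    by (rule ring_det_term_closed[OF assms that])
  then show ?thesis unfolding ring_det_def by (intro finsum_closed) auto
qed

text \<open>In the summand of \<sigma> the factors u multiply to the full product, since \<sigma>
  permutes the indices, and the rest is the summand of \<tau> \<circ> \<sigma> for S. Left
  composition with \<tau> then reindexes the sum.\<close>

lemma ring_det_scale_permute_columns:
  assumes S: "\<And>a b. a < r \<Longrightarrow> b < r \<Longrightarrow> S a b \<in> carrier R"
    and u: "\<And>b. b < r \<Longrightarrow> u b \<in> carrier R"
    and \<tau>: "\<tau> permutes {..<r}"
  shows "ring_det R r (\<lambda>a b. u b \<otimes> S a (\<tau> b)) =
    (\<Otimes>b\<in>{..<r}. u b) \<otimes> ((if evenperm \<tau> then \<one> else \<ominus> \<one>) \<otimes> ring_det R r S)"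
proof -
  define sg where "sg \<sigma> = (if evenperm \<sigma> then \<one> else \<ominus> \<one>)" for \<sigma> :: "nat \<Rightarrow> nat"
  let ?P = "{\<sigma>. \<sigma> permutes {..<r}}"
  define t where "t \<sigma> = (\<Otimes>a\<in>{..<r}. S a (\<sigma> a))" for \<sigma>
  let ?U = "\<Otimes>b\<in>{..<r}. u b"
  have [simp]: "sg \<sigma> \<in> carrier R" for \<sigma> by (simp add: sg_def)
  have U: "?U \<in> carrier R" using u by (intro finprod_closed) auto
  have t: "t \<sigma> \<in> carrier R" if "\<sigma> permutes {..<r}" for \<sigma>
    unfolding t_def by (rule ring_det_term_closed[OF S that])
  have in_r: "\<sigma> a < r" if "\<sigma> permutes {..<r}" "a < r" for \<sigma> a
    using permutes_in_image[OF that(1), of a] that(2) by simp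
  have fin: "finite ?P" by (simp add: finite_permutations)
  \<comment> \<open>Multiplicativity of the sign, combined with the square of the sign of \<tau>
    being 1.\<close>
  have sg: "sg \<sigma> = sg \<tau> \<otimes> sg (\<tau> \<circ> \<sigma>)" if "\<sigma> permutes {..<r}" for \<sigma>
  proof -
    have "permutation \<tau>" "permutation \<sigma>"
      using \<tau> that finite_lessThan permutation_permutes by blast+
    then show ?thesis by (auto simp: sg_def evenperm_comp l_minus r_minus)
  qed
  have summand: "(\<Otimes>a\<in>{..<r}. u (\<sigma> a) \<otimes> S a (\<tau> (\<sigma> a))) = ?U \<otimes> t (\<tau> \<circ> \<sigma>)"
    if "\<sigma> permutes {..<r}" for \<sigma>
  proof -
    have "(\<Otimes>a\<in>{..<r}. u (\<sigma> a)) = (\<Otimes>b\<in>\<sigma> ` {..<r}. u b)"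
      using u permutes_image[OF that] permutes_inj_on[OF that]
      by (intro finprod_reindex[symmetric]) auto
    then have "(\<Otimes>a\<in>{..<r}. u (\<sigma> a)) = ?U" by (simp add: permutes_image[OF that])
    then show ?thesis
      using u S in_r that \<tau> unfolding t_def by (subst finprod_multf) auto
  qed
  have "ring_det R r (\<lambda>a b. u b \<otimes> S a (\<tau> b)) = (\<Oplus>\<sigma>\<in>?P. (?U \<otimes> sg \<tau>) \<otimes> (sg (\<tau> \<circ> \<sigma>) \<otimes> t (\<tau> \<circ> \<sigma>)))"
    unfolding ring_det_def sg_def[symmetric]
  proof (intro finsum_cong' refl)
    fix \<sigma> assume "\<sigma> \<in> ?P"
    then have \<sigma>: "\<sigma> permutes {..<r}" by simp
    have "t (\<tau> \<circ> \<sigma>) \<in> carrier R" by (rule t[OF permutes_compose[OF \<sigma> \<tau>]])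
    then show "sg \<sigma> \<otimes> (\<Otimes>a\<in>{..<r}. u (\<sigma> a) \<otimes> S a (\<tau> (\<sigma> a)))
        = (?U \<otimes> sg \<tau>) \<otimes> (sg (\<tau> \<circ> \<sigma>) \<otimes> t (\<tau> \<circ> \<sigma>))"
      unfolding summand[OF \<sigma>] using sg[OF \<sigma>] U by (simp add: m_ac)
  qed (use U t permutes_compose[OF _ \<tau>] in auto)
  also have "\<dots> = (?U \<otimes> sg \<tau>) \<otimes> (\<Oplus>\<sigma>\<in>?P. sg (\<tau> \<circ> \<sigma>) \<otimes> t (\<tau> \<circ> \<sigma>))"
    using fin U t permutes_compose[OF _ \<tau>] by (subst finsum_rdistr) auto
  also have "(\<Oplus>\<sigma>\<in>?P. sg (\<tau> \<circ> \<sigma>) \<otimes> t (\<tau> \<circ> \<sigma>)) = (\<Oplus>\<sigma>\<in>(\<lambda>\<sigma>. \<tau> \<circ> \<sigma>) ` ?P. sg \<sigma> \<otimes> t \<sigma>)"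
  proof (rule finsum_reindex[symmetric])
    show "inj_on ((\<circ>) \<tau>) ?P"
    proof (rule inj_onI)
      fix \<sigma> \<sigma>' assume "\<tau> \<circ> \<sigma> = \<tau> \<circ> \<sigma>'"
      then have "inv_into UNIV \<tau> \<circ> (\<tau> \<circ> \<sigma>) = inv_into UNIV \<tau> \<circ> (\<tau> \<circ> \<sigma>')" by simp
      then show "\<sigma> = \<sigma>'" by (simp only: o_assoc permutes_inv_o[OF \<tau>] id_comp)
    qed
    show "(\<lambda>\<sigma>. sg \<sigma> \<otimes> t \<sigma>) \<in> (\<circ>) \<tau> ` ?P \<rightarrow> carrier R"
      using t permutes_compose[OF _ \<tau>] by auto
  qed
  also have "(\<lambda>\<sigma>. \<tau> \<circ> \<sigma>) ` ?P = ?P"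
    using image_compose_permutations_left[OF \<tau>] by blast
  also have "(\<Oplus>\<sigma>\<in>?P. sg \<sigma> \<otimes> t \<sigma>) = ring_det R r S"
    by (simp add: ring_det_def sg_def t_def)
  finally show ?thesis
    using U ring_det_closed[OF S] by (simp add: m_assoc flip: sg_def)
qed

end

section \<open>The \<open>p\<close>-adic integers and roots of unity\<close>

text \<open>In a Bezout relation u p + v n = 1 the first term has absolute value below 1, so the
  second must have at least 1.\<close>

lemma absval_of_int_eq_1:
  fixes p :: nat
  assumes "prime p" "absval (of_nat p :: 'k::nonarch_field) < 1" "\<not> int p dvd n"
  shows "absval (of_int n :: 'k) = 1"
proof -
  have "coprime (int p) n"
    using assms(1,3) by (simp add: prime_imp_coprime)
  then obtain u v where uv: "u * int p + v * n = 1"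
    using bezout_int[of "int p" n] by auto
  have "(of_int u :: 'k) * of_nat p + of_int v * of_int n = 1"
    using arg_cong[OF uv, of "of_int :: int \<Rightarrow> 'k"] by simp
  then have "1 \<le> max (absval ((of_int u :: 'k) * of_nat p)) (absval ((of_int v :: 'k) * of_int n))"
    by (metis absval_add absval_one)
  moreover have "absval ((of_int u :: 'k) * of_nat p) < 1"
    using assms(2) absval_of_int_le_1[of u, where 'a='k] unfolding absval_mult
    by (metis absval_nonneg le_less_trans mult_left_le_one_le)
  moreover have "absval ((of_int v :: 'k) * of_int n) \<le> absval (of_int n :: 'k)"
    using absval_of_int_le_1[of v, where 'a='k] unfolding absval_mult by (simp add: mult_left_le_one_le)
  ultimately show ?thesis using absval_of_int_le_1[of n, where 'a='k] by linarith
qed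

text \<open>Recovers divisibility from size whatever the normalisation of |p|; an integer prime to p
  has absolute value 1, so each further factor |p| costs a factor p.\<close>

lemma power_dvd_if_absval_le:
  fixes p :: nat
  assumes "prime p" "absval (of_nat p :: 'k::{nonarch_field,field_char_0}) < 1"
    and "absval (of_int n :: 'k) \<le> absval (of_nat p :: 'k) ^ k"
  shows "int p ^ k dvd n"
  using assms(3)
proof (induction k)
  case (Suc k)
  have p0: "absval (of_nat p :: 'k) > 0" using assms(1) by (simp add: prime_gt_0_nat)
  have "absval (of_nat p :: 'k) ^ Suc k \<le> absval (of_nat p :: 'k) ^ k"
    using assms(2) by (intro power_decreasing) auto
  then obtain m where m: "n = int p ^ k * m" using Suc by fastforce
  have "absval (of_nat p :: 'k) ^ k * absval (of_int m :: 'k) \<le> absval (of_nat p :: 'k) ^ k * absval (of_nat p :: 'k)"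
    using Suc.prems by (simp add: m absval_mult absval_power mult.commute)
  then have "absval (of_int m :: 'k) \<le> absval (of_nat p :: 'k)" using p0 by simp
  then have "int p dvd m"
    using absval_of_int_eq_1[OF assms(1,2), of m] assms(2) by fastforce
  then show ?case by (auto simp: m mult.commute)
qed simp

lemma Zp_iff: "x \<in> Zp \<longleftrightarrow> (\<forall>e>0. \<exists>n. absval (x - of_int n) < e)"
  by (auto simp: Zp_def closure_approachable Ints_def dist_absval absval_minus_commute)

lemma Zp_absval: "x \<in> Zp \<Longrightarrow> absval x \<le> 1"
proof -
  assume "x \<in> Zp"
  then obtain n where "absval (x - of_int n) < 1" unfolding Zp_iff by (meson zero_less_one)
  then have "absval ((x - of_int n) + of_int n) \<le> 1"
    by (intro absval_add_le absval_of_int_le_1) simp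
  then show ?thesis by simp
qed

lemma Zp_of_int: "of_int n \<in> Zp"
  unfolding Zp_iff by (metis absval_zero cancel_comm_monoid_add_class.diff_cancel)

lemma Zp_diff:
  assumes "x \<in> Zp" "y \<in> Zp" shows "x - y \<in> Zp"
  unfolding Zp_iff
proof (intro allI impI)
  fix e :: real assume "e > 0"
  then obtain m n where mn: "absval (x - of_int m) < e" "absval (y - of_int n) < e"
    using assms unfolding Zp_iff by metis
  have "x - y - of_int (m - n) = (x - of_int m) - (y - of_int n)" by simp
  then have "absval (x - y - of_int (m - n)) < e"
    using absval_diff[of "x - of_int m" "y - of_int n"] mn by (simp only:)
  then show "\<exists>k. absval (x - y - of_int k) < e" by blast
qed

text \<open>Describing p^k Z_p as a ball in Z_p reduces congruences to the ultrametric
  inequality.\<close>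

lemma pow_Zp_iff:
  fixes p :: nat and x :: "'k::{nonarch_field,field_char_0}"
  assumes p: "prime p" "absval (of_nat p :: 'k) < 1"
  shows "x \<in> pow_Zp p k \<longleftrightarrow> x \<in> Zp \<and> absval x \<le> absval (of_nat p :: 'k) ^ k"
proof
  let ?q = "absval (of_nat p :: 'k) ^ k"
  have p0: "(of_nat p :: 'k) \<noteq> 0" using p(1) by auto
  have q: "0 < ?q" "?q \<le> 1" using p p0 by (auto intro: power_le_one)
  {
    assume "x \<in> pow_Zp p k"
    then obtain y where y: "x = of_nat p ^ k * y" "y \<in> Zp" by (auto simp: pow_Zp_def)
    have "absval x \<le> ?q"
      using Zp_absval[OF y(2)] q by (simp add: y absval_mult absval_power mult_left_le)
    moreover have "x \<in> Zp" unfolding Zp_iff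
    proof (intro allI impI)
      fix e :: real assume "e > 0"
      then obtain n where n: "absval (y - of_int n) < e" using y(2) unfolding Zp_iff by blast
      have "x - of_int (int p ^ k * n) = of_nat p ^ k * (y - of_int n)"
        by (simp add: y algebra_simps)
      then have "absval (x - of_int (int p ^ k * n)) = ?q * absval (y - of_int n)"
        by (simp add: absval_mult absval_power)
      also have "\<dots> \<le> absval (y - of_int n)" using q by (simp add: mult_left_le_one_le)
      finally show "\<exists>n. absval (x - of_int n) < e" using n by (meson le_less_trans)
    qed
    ultimately show "x \<in> Zp \<and> absval x \<le> ?q" by simp
  next
    assume x: "x \<in> Zp \<and> absval x \<le> ?q"
    define y where "y = x / of_nat p ^ k"
    have xy: "x = of_nat p ^ k * y" using p0 by (simp add: y_def)
    have "y \<in> Zp" unfolding Zp_iff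
    proof (intro allI impI)
      fix e :: real assume "e > 0"
      \<comment> \<open>The first bound gives precision e after division by p^k. The second makes n
        as small as p^k, so that p^k divides n and n / p^k is again an integer.\<close>
      then have "min (e * ?q) ?q > 0" using q by simp
      then obtain n where n: "absval (x - of_int n) < min (e * ?q) ?q"
        using x unfolding Zp_iff by blast
      have "absval (x - (x - of_int n)) \<le> ?q"
        by (rule absval_diff_le) (use x n in auto)
      then have "absval (of_int n :: 'k) \<le> ?q" by simp
      then have "int p ^ k dvd n" by (rule power_dvd_if_absval_le[OF p])
      then obtain m where m: "n = int p ^ k * m" by blast
      have "x - of_int n = of_nat p ^ k * (y - of_int m)" by (simp add: xy m algebra_simps)
      then have "absval (x - of_int n) = ?q * absval (y - of_int m)"
        by (simp add: absval_mult absval_power)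
      then have "absval (y - of_int m) < e" using n q(1) by (simp add: mult.commute)
      then show "\<exists>n. absval (y - of_int n) < e" by blast
    qed
    then show "x \<in> pow_Zp p k" by (auto simp: pow_Zp_def xy)
  }
qed

context
  fixes p :: nat
  assumes p: "prime p" "absval (of_nat p :: 'k::{nonarch_field,field_char_0}) < 1"
begin

lemma pow_Zp_diff: "x \<in> pow_Zp p k \<Longrightarrow> y \<in> pow_Zp p k \<Longrightarrow> x - y \<in> (pow_Zp p k :: 'k set)"
  by (simp add: pow_Zp_iff[OF p] Zp_diff absval_diff_le)

lemma pow_Zp_antimono: "k \<le> k' \<Longrightarrow> pow_Zp p k' \<subseteq> (pow_Zp p k :: 'k set)"
proof -
  assume "k \<le> k'"
  then have "absval (of_nat p :: 'k) ^ k' \<le> absval (of_nat p :: 'k) ^ k"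
    using p by (intro power_decreasing) auto
  then show ?thesis by (auto simp: pow_Zp_iff[OF p])
qed

lemma Zp_int_approx:
  assumes "(a::'k) \<in> Zp" obtains n where "a - of_int n \<in> pow_Zp p k"
proof -
  have "absval (of_nat p :: 'k) ^ k > 0" using p(1) by (simp add: prime_gt_0_nat)
  then obtain n where "absval (a - of_int n) < absval (of_nat p :: 'k) ^ k"
    using assms unfolding Zp_iff by blast
  then show ?thesis
    by (intro that[of n]) (simp add: pow_Zp_iff[OF p] Zp_diff Zp_of_int assms)
qed

text \<open>Density of the integers shows that the minimum defining \<open>angle\<close> is
  attained; the sign of m records which of the two alternatives holds there.\<close>

lemma angle_witness:
  assumes "(a::'k) \<in> Zp"
  obtains m :: int where "\<bar>m\<bar> = int (angle p h a)" "a - of_int m \<in> pow_Zp p h"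
proof -
  let ?P = "\<lambda>m. a + of_nat m \<in> pow_Zp p h \<or> a - of_nat m \<in> pow_Zp p h"
  obtain n where n: "a - of_int n \<in> pow_Zp p h" using Zp_int_approx[OF assms] by blast
  have "?P (nat \<bar>n\<bar>)" using n by (cases "n \<ge> 0") (simp_all add: abs_if)
  then have "?P (angle p h a)" unfolding angle_def by (rule LeastI)
  then show ?thesis
    using that[of "int (angle p h a)"] that[of "- int (angle p h a)"] by auto
qed

text \<open>The description by \<open>THE\<close> is unambiguous: two admissible pairs are compared
  at the smaller level l, where \<zeta> is still a p^l-th root of unity and both exponents agree
  modulo p^l.\<close>

lemma root_pow_eq:
  assumes "(\<zeta>::'l::field) ^ (p ^ k) = 1" "(a::'k) - of_int m \<in> pow_Zp p k"
  shows "root_pow p \<zeta> a = \<zeta> powi m"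
  unfolding root_pow_def
proof (rule the_equality)
  show "\<exists>k' m'. \<zeta> ^ p ^ k' = 1 \<and> a - of_int m' \<in> pow_Zp p k' \<and> \<zeta> powi m = \<zeta> powi m'"
    using assms by blast
next
  fix z assume "\<exists>k' m'. \<zeta> ^ p ^ k' = 1 \<and> a - of_int m' \<in> pow_Zp p k' \<and> z = \<zeta> powi m'"
  then obtain k' m' where z: "\<zeta> ^ p ^ k' = 1" "a - of_int m' \<in> pow_Zp p k'" "z = \<zeta> powi m'"
    by blast
  define l where "l = min k k'"
  have l: "\<zeta> ^ p ^ l = 1" using assms(1) z(1) by (simp add: l_def min_def)
  have "a - of_int m \<in> pow_Zp p l" "a - of_int m' \<in> pow_Zp p l"
    using assms(2) z(2) pow_Zp_antimono[of l k] pow_Zp_antimono[of l k'] by (auto simp: l_def)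
  from pow_Zp_diff[OF this] have "(of_int (m' - m) :: 'k) \<in> pow_Zp p l" by simp
  then have "int p ^ l dvd m' - m"
    by (intro power_dvd_if_absval_le[OF p]) (simp add: pow_Zp_iff[OF p])
  then obtain d where d: "m' = m + int p ^ l * d" by (auto simp: dvd_def algebra_simps)
  have "\<zeta> \<noteq> 0" using l p(1) by (auto simp: power_0_left prime_gt_0_nat split: if_splits)
  then have "z = \<zeta> powi m * (\<zeta> powi int (p ^ l)) powi d"
    by (simp add: z(3) d power_int_add power_int_mult)
  then show "z = \<zeta> powi m" by (simp only: power_int_of_nat l power_int_1_left mult_1_right)
qed

text \<open>Turns the congruence supplied by weak equivalence into equality of characters: an
  integer close to a, plus m, is an integer close to b modulo p^k.\<close>

lemma root_pow_shift:
  assumes "(a::'k) \<in> Zp" "a + of_int m - b \<in> pow_Zp p k" "(\<zeta>::'l::field) ^ (p ^ k) = 1"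
  shows "\<zeta> powi m * root_pow p \<zeta> a = root_pow p \<zeta> b"
proof -
  obtain n where n: "a - of_int n \<in> pow_Zp p k" using Zp_int_approx[OF assms(1)] by blast
  have "b - of_int (m + n) = (a - of_int n) - (a + of_int m - b)" by simp
  then have "b - of_int (m + n) \<in> pow_Zp p k"
    using pow_Zp_diff[OF n assms(2)] by (simp only:)
  moreover have "\<zeta> \<noteq> 0"
    using assms(3) p(1) by (auto simp: power_0_left prime_gt_0_nat split: if_splits)
  ultimately show ?thesis
    by (simp add: root_pow_eq[OF assms(3) n] root_pow_eq[OF assms(3), of b "m + n"] power_int_add)
qed

end

section \<open>Absolute values of roots of unity of p-power order\<close>

lemma absval_root_of_unity:
  fixes \<zeta> :: "'a::nonarch_field"
  assumes "\<zeta> ^ n = 1" "n > 0"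
  shows "absval \<zeta> = 1"
proof (rule power_eq_imp_eq_base)
  show "absval \<zeta> ^ n = 1 ^ n" by (simp add: assms(1) flip: absval_power)
qed (use assms in auto)

text \<open>Put x = \<zeta> - 1. By induction (1 + x)^p - 1 is small, and the inner binomial
  coefficients are divisible by p, so |x^p| < 1 and therefore |x| < 1.\<close>

lemma absval_root_of_unity_diff_one:
  fixes \<zeta> :: "'a::nonarch_field"
  assumes p: "prime p" "absval (of_nat p :: 'a) < 1" and "\<zeta> ^ p ^ k = 1"
  shows "absval (\<zeta> - 1) < 1"
  using assms(3)
proof (induction k arbitrary: \<zeta>)
  case (Suc k)
  have p0: "p > 0" using p(1) by (rule prime_gt_0_nat)
  have "absval (\<zeta> ^ p - 1) < 1"
    using Suc.IH[of "\<zeta> ^ p"] Suc.prems by (simp add: power_mult)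
  moreover have "absval (\<zeta> - 1) \<le> 1"
    using absval_root_of_unity[OF Suc.prems] p0 by (intro absval_diff_le) auto
  moreover define x where "x = \<zeta> - 1"
  ultimately have x: "absval ((x + 1) ^ p - 1) < 1" "absval x \<le> 1" by simp_all
  have "(x + 1) ^ p = (\<Sum>j\<le>p. of_nat (p choose j) * x ^ j)" by (simp add: binomial_ring)
  also have "{..p} = insert 0 (insert p {0<..<p})" using p0 by auto
  also have "(\<Sum>j\<in>insert 0 (insert p {0<..<p}). of_nat (p choose j) * x ^ j)
      = 1 + (x ^ p + (\<Sum>j\<in>{0<..<p}. of_nat (p choose j) * x ^ j))"
    using p0 by simp
  finally have xp: "x ^ p = ((x + 1) ^ p - 1) - (\<Sum>j\<in>{0<..<p}. of_nat (p choose j) * x ^ j)"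
    by (simp add: algebra_simps)
  have "absval (\<Sum>j\<in>{0<..<p}. of_nat (p choose j) * x ^ j) \<le> absval (of_nat p :: 'a)"
  proof (rule absval_sum_le)
    fix j assume "j \<in> {0<..<p}"
    then obtain c where c: "p choose j = p * c"
      using dvd_choose_prime[of j p] p(1) by (auto simp: dvd_def)
    have "absval (of_nat c * x ^ j) \<le> 1"
      using absval_of_nat_le_1[of c, where 'a='a] x(2)
      by (simp add: absval_mult absval_power mult_le_one power_le_one)
    then show "absval (of_nat (p choose j) * x ^ j) \<le> absval (of_nat p :: 'a)"
      by (simp add: c absval_mult mult.assoc mult_left_le)
  qed simp
  then have "absval (x ^ p) < 1"
    unfolding xp using absval_diff[of "(x + 1) ^ p - 1"] x(1) p(2)
    by (meson le_less_trans max_less_iff_conj)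
  then have "absval x < 1"
    using one_le_power[of "absval x" p] unfolding absval_power by linarith
  then show ?case by (simp add: x_def)
qed simp

section \<open>Binomials of Euler operators\<close>

text \<open>These operations are restricted to indices below r, so that results lie in
  \<open>extensional\<close> and equations between vectors hold as equations between
  functions.\<close>

definition vadd :: "nat \<Rightarrow> (nat \<Rightarrow> ('k::nonarch_field, 'n::finite) series) \<Rightarrow> (nat \<Rightarrow> ('k, 'n) series) \<Rightarrow> (nat \<Rightarrow> ('k, 'n) series)" where
  "vadd r x y = (\<lambda>a\<in>{..<r}. \<lambda>j. x a j + y a j)"

definition vscale :: "nat \<Rightarrow> 'k::nonarch_field \<Rightarrow> (nat \<Rightarrow> ('k, 'n::finite) series) \<Rightarrow> (nat \<Rightarrow> ('k, 'n) series)" where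
  "vscale r c x = (\<lambda>a\<in>{..<r}. \<lambda>j. c * x a j)"

text \<open>Multiplication of a vector by the monomial t^m; exponents of either sign are
  allowed.\<close>

definition vshift :: "nat \<Rightarrow> int ^ 'n::finite \<Rightarrow> (nat \<Rightarrow> ('k::nonarch_field, 'n) series) \<Rightarrow> (nat \<Rightarrow> ('k, 'n) series)" where
  "vshift r m x = (\<lambda>a\<in>{..<r}. \<lambda>j. x a (j - m))"

lemma vadd_apply: "a < r \<Longrightarrow> vadd r x y a j = x a j + y a j"
  and vscale_apply: "a < r \<Longrightarrow> vscale r c x a j = c * x a j"
  and vshift_apply: "a < r \<Longrightarrow> vshift r m x a j = x a (j - m)"
  by (simp_all add: vadd_def vscale_def vshift_def)

lemma vadd_extensional: "vadd r x y \<in> extensional {..<r}"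
  and vscale_extensional: "vscale r c x \<in> extensional {..<r}"
  and vshift_extensional: "vshift r m x \<in> extensional {..<r}"
  by (simp_all add: vadd_def vscale_def vshift_def)

lemma vec_eqI:
  assumes "x \<in> extensional {..<r}" "y \<in> extensional {..<r}" "\<And>a j. a < r \<Longrightarrow> x a j = y a j"
  shows "x = y"
  by (rule extensionalityI[OF assms(1,2)]) (auto intro!: ext assms(3))

lemma free_module_iff:
  "x \<in> free_module R r \<longleftrightarrow> x \<in> extensional {..<r} \<and> (\<forall>a<r. x a \<in> carrier R)"
  by (auto simp: free_module_def PiE_def)

lemma binom_op_Suc:
  "binom_op r T (Suc m) x =
     vscale r (1 / of_nat (Suc m)) (vadd r (T (binom_op r T m x)) (vscale r (- of_nat m) (binom_op r T m x)))"
  by (rule vec_eqI[of _ r]) (simp_all add: vscale_extensional vscale_apply vadd_apply)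

text \<open>
  The relation \<open>T\<^sub>k t\<^sub>k = t\<^sub>k (T\<^sub>k + 1)\<close> between the Euler operators \<open>T\<^sub>k = t\<^sub>k D\<^sub>k\<close> and the
  multiplications by the variables is all that is used about the connection.
\<close>

locale euler_operators =
  fixes r :: nat
    and P :: "(nat \<Rightarrow> ('k::{nonarch_field,field_char_0}, 'n::{finite,linorder}) series) set"
    and T :: "'n \<Rightarrow> (nat \<Rightarrow> ('k, 'n) series) \<Rightarrow> (nat \<Rightarrow> ('k, 'n) series)"
  assumes P_extensional: "P \<subseteq> extensional {..<r}"
    and T_closed: "x \<in> P \<Longrightarrow> T i x \<in> P"
    and vadd_closed: "x \<in> P \<Longrightarrow> y \<in> P \<Longrightarrow> vadd r x y \<in> P"
    and vscale_closed: "x \<in> P \<Longrightarrow> vscale r c x \<in> P"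
    and vshift_closed: "x \<in> P \<Longrightarrow> vshift r m x \<in> P"
    and T_add: "x \<in> P \<Longrightarrow> y \<in> P \<Longrightarrow> T i (vadd r x y) = vadd r (T i x) (T i y)"
    and T_scale: "x \<in> P \<Longrightarrow> T i (vscale r c x) = vscale r c (T i x)"
    and T_shift: "x \<in> P \<Longrightarrow> T i (vshift r (axis k 1) x) =
      vshift r (axis k 1) (vadd r (T i x) (vscale r (if i = k then 1 else 0) x))"
begin

lemma binom_closed: "x \<in> P \<Longrightarrow> binom_op r (T i) m x \<in> P"
proof (induction m)
  case (Suc m)
  then show ?case unfolding binom_op_Suc by (intro vscale_closed vadd_closed T_closed) auto
qed simp

lemma binom_add:
  assumes "x \<in> P" "y \<in> P"
  shows "binom_op r (T i) m (vadd r x y) = vadd r (binom_op r (T i) m x) (binom_op r (T i) m y)"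
proof (induction m)
  case (Suc m)
  show ?case unfolding binom_op_Suc Suc.IH
    by (rule vec_eqI[of _ r])
       (simp_all add: vscale_extensional vadd_extensional vscale_apply vadd_apply
          T_add binom_closed assms algebra_simps flip: add_divide_distrib)
qed simp

lemma binom_scale:
  assumes "x \<in> P"
  shows "binom_op r (T i) m (vscale r c x) = vscale r c (binom_op r (T i) m x)"
proof (induction m)
  case (Suc m)
  show ?case unfolding binom_op_Suc Suc.IH
    by (rule vec_eqI[of _ r])
       (simp_all add: vscale_extensional vadd_extensional vscale_apply vadd_apply
          T_scale binom_closed assms algebra_simps)
qed simp

lemma binom_shift_other:
  assumes "x \<in> P" "i \<noteq> k"
  shows "binom_op r (T i) m (vshift r (axis k 1) x) = vshift r (axis k 1) (binom_op r (T i) m x)"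
proof (induction m)
  case (Suc m)
  show ?case unfolding binom_op_Suc Suc.IH
    by (rule vec_eqI[of _ r])
       (simp_all add: vscale_extensional vshift_extensional vscale_apply vadd_apply vshift_apply
          T_shift binom_closed assms)
qed simp

text \<open>The recursion for binom(T, m + 1) solved for T binom(T, m); characteristic 0 permits
  cancelling m + 1.\<close>

lemma T_binom:
  assumes "a < r"
  shows "T i (binom_op r (T i) m x) a j =
    of_nat (Suc m) * binom_op r (T i) (Suc m) x a j + of_nat m * binom_op r (T i) m x a j"
proof -
  have "(of_nat (Suc m) :: 'k) \<noteq> 0" by (rule of_nat_neq_0)
  then show ?thesis
    unfolding binom_op_Suc using assms
    by (simp add: vscale_apply vadd_apply del: of_nat_Suc)
qed

text \<open>Moving t_k to the left replaces T by T + 1, and Pascal's rule gives binom(T + 1, m + 1)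
  = binom(T, m + 1) + binom(T, m).\<close>

lemma binom_shift_same:
  assumes "x \<in> P"
  shows "binom_op r (T k) (Suc m) (vshift r (axis k 1) x) =
    vshift r (axis k 1) (vadd r (binom_op r (T k) (Suc m) x) (binom_op r (T k) m x))"
proof (induction m)
  case 0
  show ?case unfolding binom_op_Suc binom_op.simps(1)
    by (rule vec_eqI[of _ r])
       (simp_all add: vscale_extensional vshift_extensional vscale_apply vadd_apply vshift_apply
          T_shift assms)
next
  case (Suc m)
  let ?b = "\<lambda>m. binom_op r (T k) m x"
  let ?z = "vadd r (?b (Suc m)) (?b m)"
  have b: "?b m \<in> P" for m by (rule binom_closed[OF assms])
  have n0: "(of_nat (Suc (Suc m)) :: 'k) \<noteq> 0" by (rule of_nat_neq_0)
  have "binom_op r (T k) (Suc (Suc m)) (vshift r (axis k 1) x) =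
      vscale r (1 / of_nat (Suc (Suc m)))
        (vadd r (T k (vshift r (axis k 1) ?z)) (vscale r (- of_nat (Suc m)) (vshift r (axis k 1) ?z)))"
    unfolding binom_op_Suc[of r "T k" "Suc m"] Suc.IH ..
  also have "\<dots> = vshift r (axis k 1) (vadd r (?b (Suc (Suc m))) (?b (Suc m)))"
  proof (rule vec_eqI[of _ r])
    fix a and j :: "(int, 'n) vec" assume a: "a < r"
    let ?j = "j - axis k 1"
    have Tz: "T k ?z a ?j = T k (?b (Suc m)) a ?j + T k (?b m) a ?j"
      using a by (simp only: T_add[OF b b] vadd_apply)
    have "vscale r (1 / of_nat (Suc (Suc m)))
        (vadd r (T k (vshift r (axis k 1) ?z)) (vscale r (- of_nat (Suc m)) (vshift r (axis k 1) ?z))) a j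
      = (T k ?z a ?j + ?z a ?j - of_nat (Suc m) * ?z a ?j) / of_nat (Suc (Suc m))"
      using a by (simp add: T_shift[OF vadd_closed[OF b b]] vscale_apply vadd_apply vshift_apply
          del: of_nat_Suc binom_op.simps)
    \<comment> \<open>With b_i for binom(T, i), expanding T b_(m+1) and T b_m by
      \<open>T_binom\<close> cancels b_m and leaves the common factor m + 2.\<close>
    also have "T k ?z a ?j + ?z a ?j - of_nat (Suc m) * ?z a ?j
        = of_nat (Suc (Suc m)) * (?b (Suc (Suc m)) a ?j + ?b (Suc m) a ?j)"
      unfolding Tz T_binom[OF a] vadd_apply[OF a] by (simp add: algebra_simps del: binom_op.simps)
    finally show "vscale r (1 / of_nat (Suc (Suc m)))
        (vadd r (T k (vshift r (axis k 1) ?z)) (vscale r (- of_nat (Suc m)) (vshift r (axis k 1) ?z))) a j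
      = vshift r (axis k 1) (vadd r (?b (Suc (Suc m))) (?b (Suc m))) a j"
      using a n0 by (simp add: vadd_apply vshift_apply del: of_nat_Suc binom_op.simps)
  qed (simp_all add: vscale_extensional vshift_extensional)
  finally show ?case .
qed

text \<open>The list is arbitrary so that the shift rules can be proved by induction; the action
  uses the sorted list of all variables.\<close>

definition multi :: "'n list \<Rightarrow> (nat, 'n) vec \<Rightarrow> (nat \<Rightarrow> ('k, 'n) series) \<Rightarrow> (nat \<Rightarrow> ('k, 'n) series)" where
  "multi xs \<alpha> x = foldr (\<lambda>i. binom_op r (T i) (\<alpha> $ i)) xs x"

lemma multi_simps:
  "multi [] \<alpha> x = x" "multi (i # xs) \<alpha> x = binom_op r (T i) (\<alpha> $ i) (multi xs \<alpha> x)"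
  by (simp_all add: multi_def)

lemma multi_closed: "x \<in> P \<Longrightarrow> multi xs \<alpha> x \<in> P"
  by (induction xs) (simp_all add: multi_simps binom_closed)

lemma multi_scale: "x \<in> P \<Longrightarrow> multi xs \<alpha> (vscale r c x) = vscale r c (multi xs \<alpha> x)"
  by (induction xs) (simp_all add: multi_simps binom_scale multi_closed)

lemma multi_cong:
  fixes \<alpha> \<beta> :: "(nat, 'n) vec"
  shows "(\<And>i. i \<in> set xs \<Longrightarrow> \<alpha> $ i = \<beta> $ i) \<Longrightarrow> multi xs \<alpha> x = multi xs \<beta> x"
  by (induction xs) (simp_all add: multi_simps)

lemma multi_shift_zero:
  fixes \<alpha> :: "(nat, 'n) vec"
  assumes "x \<in> P" "k \<in> set xs \<Longrightarrow> \<alpha> $ k = 0"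
  shows "multi xs \<alpha> (vshift r (axis k 1) x) = vshift r (axis k 1) (multi xs \<alpha> x)"
  using assms(2)
proof (induction xs)
  case (Cons i xs)
  then show ?case
    by (cases "i = k") (simp_all add: multi_simps binom_shift_other multi_closed assms(1))
qed (simp add: multi_simps)

text \<open>Pascal's rule acts in the single factor belonging to k; \<open>distinct\<close> excludes
  a second one. Writing \<alpha> + e_k instead of assuming \<alpha>_k > 0 avoids truncated
  subtraction.\<close>

lemma multi_shift:
  assumes "x \<in> P" "k \<in> set xs" "distinct xs"
  shows "multi xs (\<alpha> + axis k 1) (vshift r (axis k 1) x) =
    vshift r (axis k 1) (vadd r (multi xs (\<alpha> + axis k 1) x) (multi xs \<alpha> x))"
  using assms(2,3)
proof (induction xs)
  case (Cons i xs)
  show ?case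
  proof (cases "i = k")
    case True
    with Cons have k: "k \<notin> set xs" by simp
    have eq: "multi xs (\<alpha> + axis k 1) y = multi xs \<alpha> y" for y
      using k by (intro multi_cong) (auto simp: axis_def)
    have "(\<alpha> + axis k 1) $ k = Suc (\<alpha> $ k)" by (simp add: axis_def)
    then show ?thesis
      using multi_shift_zero[of x k xs \<alpha>] k assms(1) unfolding multi_simps True eq
      by (simp only: binom_shift_same[OF multi_closed])
  next
    case False
    with Cons have "k \<in> set xs" "distinct xs" by auto
    moreover have "(\<alpha> + axis k 1) $ i = \<alpha> $ i" using False by (simp add: axis_def)
    ultimately show ?thesis
      unfolding multi_simps using Cons.IH
      by (simp only: binom_shift_other[OF _ False] vadd_closed multi_closed assms(1) binom_add)
  qed
qed simp

end

text \<open>Multiplication by t_i undoes the index shift of the derivation, so the derivation part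
  becomes multiplication by j_i. The right-hand side does not mention J, which is what makes
  restriction to a smaller polyannulus harmless.\<close>

lemma (in polyannulus) euler_formula:
  fixes D :: "'n \<Rightarrow> (nat \<Rightarrow> ('k::{nonarch_field,complete_space}, 'n) series) \<Rightarrow> (nat \<Rightarrow> ('k, 'n) series)"
  assumes G: "\<And>b a. b < r \<Longrightarrow> a < r \<Longrightarrow> D i (unit_vector (laurent_ring I) r b) a \<in> laurent_fun J"
    and y: "y \<in> free_module (laurent_ring J) r" and a: "a < r"
  shows "(lmonom (axis i 1) \<otimes>\<^bsub>laurent_ring J\<^esub> restrict_conn I J r D i y a) j =
    of_int (j $ i) * y a j +
    (\<Sum>b<r. convolution (D i (unit_vector (laurent_ring I) r b) a) (y b) (j - axis i 1))"
proof -
  have yb: "y b \<in> laurent_fun J" if "b < r" for b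
    using y that by (auto simp: free_module_def)
  have "restrict_conn I J r D i y a = (\<lambda>j. laurent_deriv i (y a) j +
      (\<Sum>b<r. convolution (D i (unit_vector (laurent_ring I) r b) a) (y b) j))"
    unfolding restrict_conn_def base_change_def
    using a laurent_finsum[of "{..<r}" "\<lambda>b. convolution (D i (unit_vector (laurent_ring I) r b) a) (y b)"]
      laurent_convolution[OF G yb] by simp
  then show ?thesis
    by (simp add: convolution_lmonom laurent_deriv_def axis_def)
qed

text \<open>The matrix part of the connection commutes with monomials; only the factor j_i sees a
  shift by e_k, and it produces the summand 1 exactly when i = k.\<close>

lemma euler_operators_restrict_conn:
  fixes J :: "(real ^ 'n::{finite,linorder}) set"
    and D :: "'n \<Rightarrow> (nat \<Rightarrow> ('k::{nonarch_field,field_char_0,complete_space}, 'n) series) \<Rightarrow> (nat \<Rightarrow> ('k, 'n) series)"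
  assumes "polyannulus J"
    and G: "\<And>i b a. b < r \<Longrightarrow> a < r \<Longrightarrow> D i (unit_vector (laurent_ring I) r b) a \<in> laurent_fun J"
  shows "euler_operators r (free_module (laurent_ring J) r)
    (\<lambda>i y. \<lambda>a\<in>{..<r}. lmonom (axis i 1) \<otimes>\<^bsub>laurent_ring J\<^esub> restrict_conn I J r D i y a)"
    (is "euler_operators r ?P ?T")
proof
  interpret polyannulus J by fact
  have T: "?T i y a j = of_int (j $ i) * y a j +
    (\<Sum>b<r. convolution (D i (unit_vector (laurent_ring I) r b) a) (y b) (j - axis i 1))"
    if "y \<in> ?P" "a < r" for i y a and j :: "(int, 'n) vec"
    using euler_formula[of r D i I y a j, OF G that] that(2) by simp
  show "?P \<subseteq> extensional {..<r}" by (simp add: free_module_iff subset_iff)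
  have P: "y a \<in> laurent_fun J" if "y \<in> ?P" "a < r" for y a
    using that by (simp add: free_module_iff)
  show cl: "vadd r x y \<in> ?P" if "x \<in> ?P" "y \<in> ?P" for x y
    using P[OF that(1)] P[OF that(2)] by (simp add: free_module_iff vadd_def laurent_add)
  show cs: "vscale r c x \<in> ?P" if "x \<in> ?P" for x c
    using P[OF that] by (simp add: free_module_iff vscale_def laurent_scale)
  show ch: "vshift r m x \<in> ?P" if "x \<in> ?P" for x m
    using P[OF that] by (simp add: free_module_iff vshift_def laurent_shift)
  show "?T i x \<in> ?P" if "x \<in> ?P" for x i
  proof -
    have "?T i x a \<in> laurent_fun J" if a: "a < r" for a
    proof -
      have "(\<lambda>j. of_int (j $ i) * x a j) \<in> laurent_fun J"
        by (rule laurent_bounded_mult[OF P[OF \<open>x \<in> ?P\<close> a], of _ 1]) (simp_all add: absval_of_int_le_1)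
      moreover have "(\<lambda>j. \<Sum>b<r. convolution (D i (unit_vector (laurent_ring I) r b) a) (x b) (j - axis i 1))
          \<in> laurent_fun J"
        by (intro laurent_sum laurent_shift laurent_convolution G P[OF \<open>x \<in> ?P\<close>] a) simp_all
      moreover have "?T i x a = (\<lambda>j. of_int (j $ i) * x a j +
          (\<Sum>b<r. convolution (D i (unit_vector (laurent_ring I) r b) a) (x b) (j - axis i 1)))"
        by (rule ext) (rule T[OF \<open>x \<in> ?P\<close> a])
      ultimately show ?thesis by (simp only: laurent_add)
    qed
    then show ?thesis by (simp add: free_module_iff)
  qed
  show "?T i (vadd r x y) = vadd r (?T i x) (?T i y)" if "x \<in> ?P" "y \<in> ?P" for x y i
  proof (rule vec_eqI[of _ r])
    fix a and j :: "(int, 'n) vec" assume a: "a < r"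
    have "convolution g (vadd r x y b) = (\<lambda>j. convolution g (x b) j + convolution g (y b) j)"
      if "g \<in> laurent_fun J" "b < r" for g b
      using convolution_add_right[OF that(1) P[OF \<open>x \<in> ?P\<close> that(2)] P[OF \<open>y \<in> ?P\<close> that(2)]] that(2)
      by (simp add: vadd_def)
    then show "?T i (vadd r x y) a j = vadd r (?T i x) (?T i y) a j"
      unfolding vadd_apply[OF a] T[OF that(1) a] T[OF that(2) a] T[OF cl[OF that] a]
      using G a by (simp add: algebra_simps sum.distrib)
  qed (simp_all add: vadd_extensional)
  show "?T i (vscale r c x) = vscale r c (?T i x)" if "x \<in> ?P" for x i c
  proof (rule vec_eqI[of _ r])
    fix a and j :: "(int, 'n) vec" assume a: "a < r"
    have "convolution g (vscale r c x b) = (\<lambda>j. c * convolution g (x b) j)" if "b < r" for g b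
      using convolution_scale_right[of g c "x b"] that by (simp add: vscale_def)
    then show "?T i (vscale r c x) a j = vscale r c (?T i x) a j"
      unfolding vscale_apply[OF a] T[OF that a] T[OF cs[OF that] a]
      by (simp add: algebra_simps sum_distrib_left)
  qed (simp_all add: vscale_extensional)
  show "?T i (vshift r (axis k 1) x) =
      vshift r (axis k 1) (vadd r (?T i x) (vscale r (if i = k then 1 else 0) x))"
    if "x \<in> ?P" for x i k
  proof (rule vec_eqI[of _ r])
    fix a and j :: "(int, 'n) vec" assume a: "a < r"
    have "convolution g (vshift r m x b) = (\<lambda>j. convolution g (x b) (j - m))" if "b < r" for g b m
      using convolution_shift_right[of g "x b" m] that by (simp add: vshift_def)
    then have c: "(\<Sum>b<r. convolution (D i (unit_vector (laurent_ring I) r b) a) (vshift r (axis k 1) x b) (j - axis i 1))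
      = (\<Sum>b<r. convolution (D i (unit_vector (laurent_ring I) r b) a) (x b) (j - axis k 1 - axis i 1))"
      by (simp add: algebra_simps)
    show "?T i (vshift r (axis k 1) x) a j =
        vshift r (axis k 1) (vadd r (?T i x) (vscale r (if i = k then 1 else 0) x)) a j"
      unfolding vshift_apply[OF a] vadd_apply[OF a] vscale_apply[OF a] T[OF that a] T[OF ch[OF that] a] c
      by (simp add: algebra_simps axis_def)
  qed (simp_all add: vshift_extensional)
qed

section \<open>Uniformly convergent families\<close>

text \<open>Convergence of a family of series in one Gauss norm, expressed through coefficients: w
  plays the role of the weight and the estimate is uniform in j. No supremum occurs, so no
  boundedness has to be carried along.\<close>

definition unif_sum :: "('c \<Rightarrow> real) \<Rightarrow> ('i \<Rightarrow> 'c \<Rightarrow> 'l::nonarch_field) \<Rightarrow> ('c \<Rightarrow> 'l) \<Rightarrow> bool" where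
  "unif_sum w a W \<longleftrightarrow> (\<forall>e>0. \<exists>F0. finite F0 \<and>
     (\<forall>F. finite F \<longrightarrow> F0 \<subseteq> F \<longrightarrow> (\<forall>j. absval ((\<Sum>\<alpha>\<in>F. a \<alpha> j) - W j) * w j \<le> e)))"

lemma unif_sumI:
  assumes "\<And>e. e > 0 \<Longrightarrow> \<exists>F0. finite F0 \<and>
     (\<forall>F. finite F \<longrightarrow> F0 \<subseteq> F \<longrightarrow> (\<forall>j. absval ((\<Sum>\<alpha>\<in>F. a \<alpha> j) - W j) * w j \<le> e))"
  shows "unif_sum w a W"
  unfolding unif_sum_def by (intro allI impI) (rule assms)

lemma unif_sumD:
  assumes "unif_sum w a W" "e > 0"
  obtains F0 where "finite F0"
    "\<And>F j. finite F \<Longrightarrow> F0 \<subseteq> F \<Longrightarrow> absval ((\<Sum>\<alpha>\<in>F. a \<alpha> j) - W j) * w j \<le> e"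
proof -
  from assms obtain F0 where "finite F0"
    and F0: "\<forall>F. finite F \<longrightarrow> F0 \<subseteq> F \<longrightarrow> (\<forall>j. absval ((\<Sum>\<alpha>\<in>F. a \<alpha> j) - W j) * w j \<le> e)"
    unfolding unif_sum_def by (elim allE[of _ e] impE exE conjE)
  then show ?thesis by (intro that[of F0]) simp_all
qed

lemma absval_add_weight_le:
  fixes x y :: "'l::nonarch_field"
  assumes "absval x * w \<le> e" "absval y * w \<le> e" "0 \<le> w"
  shows "absval (x + y) * w \<le> e"
proof -
  have "absval (x + y) * w \<le> max (absval x) (absval y) * w"
    using assms(3) by (intro mult_right_mono absval_add)
  then show ?thesis using assms(1,2) by (auto simp: max_def split: if_splits)
qed

lemma absval_diff_weight_le:
  fixes x y :: "'l::nonarch_field"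
  assumes "absval x * w \<le> e" "absval y * w \<le> e" "0 \<le> w"
  shows "absval (x - y) * w \<le> e"
  using absval_add_weight_le[of x w e "- y"] assms by simp

lemma absval_mult_weight_le:
  fixes x y :: "'l::nonarch_field"
  assumes "absval x \<le> 1" "absval y * w \<le> e" "0 \<le> w"
  shows "absval (x * y) * w \<le> e"
proof -
  have "absval x * (absval y * w) \<le> absval y * w"
    using assms by (intro mult_left_le_one_le) auto
  then show ?thesis using assms(2) by (simp add: absval_mult mult.assoc)
qed

lemma absval_sum_weight_le:
  fixes f :: "'i \<Rightarrow> 'l::nonarch_field"
  assumes "\<And>i. i \<in> F \<Longrightarrow> absval (f i) * w \<le> e" "0 \<le> w" "0 \<le> e"
  shows "absval (sum f F) * w \<le> e"
  using assms by (induction F rule: infinite_finite_induct) (simp_all add: absval_add_weight_le)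

lemma unif_sum_scale:
  assumes "unif_sum w a W" "\<And>j. 0 \<le> w j"
  shows "unif_sum w (\<lambda>\<alpha> j. c * a \<alpha> j) (\<lambda>j. c * W j)"
proof (rule unif_sumI)
  fix e :: real assume "e > 0"
  define d where "d = e / (absval c + 1)"
  have c1: "absval c + 1 > 0" by (simp add: add_nonneg_pos)
  then have "d > 0" using \<open>e > 0\<close> by (simp add: d_def)
  then obtain F0 where F0: "finite F0"
    "\<And>F j. finite F \<Longrightarrow> F0 \<subseteq> F \<Longrightarrow> absval ((\<Sum>\<alpha>\<in>F. a \<alpha> j) - W j) * w j \<le> d"
    using unif_sumD[OF assms(1)] by metis
  show "\<exists>F0. finite F0 \<and> (\<forall>F. finite F \<longrightarrow> F0 \<subseteq> F \<longrightarrow>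
      (\<forall>j. absval ((\<Sum>\<alpha>\<in>F. c * a \<alpha> j) - c * W j) * w j \<le> e))"
  proof (intro exI[of _ F0] conjI allI impI)
    fix F j assume F: "finite F" "F0 \<subseteq> F"
    have "absval ((\<Sum>\<alpha>\<in>F. c * a \<alpha> j) - c * W j) * w j
        = absval c * (absval ((\<Sum>\<alpha>\<in>F. a \<alpha> j) - W j) * w j)"
      by (simp add: absval_mult mult.assoc flip: sum_distrib_left right_diff_distrib)
    also have "\<dots> \<le> (absval c + 1) * d"
      using F0(2)[OF F] assms(2) \<open>d > 0\<close> by (intro mult_mono) auto
    also have "\<dots> = e" using c1 by (simp add: d_def)
    finally show "absval ((\<Sum>\<alpha>\<in>F. c * a \<alpha> j) - c * W j) * w j \<le> e" .
  qed (rule F0(1))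
qed

lemma unif_sum_shift:
  fixes a :: "'i \<Rightarrow> 'c::ab_group_add \<Rightarrow> 'l::nonarch_field"
  assumes "unif_sum w a W" "\<And>j. w j = w (j - m) * c" "0 < c"
  shows "unif_sum w (\<lambda>\<alpha> j. a \<alpha> (j - m)) (\<lambda>j. W (j - m))"
proof (rule unif_sumI)
  fix e :: real assume "e > 0"
  then have "e / c > 0" using assms(3) by simp
  then obtain F0 where F0: "finite F0"
    "\<And>F j. finite F \<Longrightarrow> F0 \<subseteq> F \<Longrightarrow> absval ((\<Sum>\<alpha>\<in>F. a \<alpha> j) - W j) * w j \<le> e / c"
    using unif_sumD[OF assms(1)] by metis
  have "absval ((\<Sum>\<alpha>\<in>F. a \<alpha> (j - m)) - W (j - m)) * w j \<le> e"
    if "finite F" "F0 \<subseteq> F" for F j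
    using F0(2)[OF that, of "j - m"] assms(3)
    by (subst assms(2)) (simp add: pos_le_divide_eq mult.assoc)
  then show "\<exists>F0. finite F0 \<and> (\<forall>F. finite F \<longrightarrow> F0 \<subseteq> F \<longrightarrow>
      (\<forall>j. absval ((\<Sum>\<alpha>\<in>F. a \<alpha> (j - m)) - W (j - m)) * w j \<le> e))"
    using F0(1) by blast
qed

text \<open>
  The family \<open>g\<close> is the formal product of \<open>a\<close> with \<open>1 + \<xi> s\<close>. Multiplication by \<open>1 + \<xi> s\<close> can be
  undone for \<open>|\<xi>| < 1\<close> without completeness, because the sum of the quotient is known in advance.
\<close>

context
  fixes w :: "'c \<Rightarrow> real" and a g :: "'i \<Rightarrow> 'c \<Rightarrow> 'l::nonarch_field" and s :: "'i \<Rightarrow> 'i" and \<xi> :: 'l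
  assumes w: "\<And>j. 0 \<le> w j" and s: "inj s"
    and g_s: "\<And>\<alpha> j. g (s \<alpha>) j = a (s \<alpha>) j + \<xi> * a \<alpha> j"
    and g_0: "\<And>\<alpha> j. \<alpha> \<notin> range s \<Longrightarrow> g \<alpha> j = a \<alpha> j"
begin

text \<open>The indices of F in the range of s are the images of the preimage of F, and there the
  term of g splits in two.\<close>

lemma sum_formal_product:
  assumes "finite F"
  shows "(\<Sum>\<alpha>\<in>F. g \<alpha> j) = (\<Sum>\<alpha>\<in>F. a \<alpha> j) + \<xi> * (\<Sum>\<alpha>\<in>s -` F. a \<alpha> j)"
proof -
  have F: "F \<inter> range s = s ` (s -` F)" by auto
  have fin: "finite (s -` F)" using assms s by (rule finite_vimageI)
  have inj: "inj_on s (s -` F)" using s by (rule inj_on_subset) simp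
  have "(\<Sum>\<alpha>\<in>F. g \<alpha> j) = (\<Sum>\<alpha>\<in>F \<inter> range s. g \<alpha> j) + (\<Sum>\<alpha>\<in>F - range s. g \<alpha> j)"
    using assms by (rule sum.Int_Diff)
  also have "(\<Sum>\<alpha>\<in>F - range s. g \<alpha> j) = (\<Sum>\<alpha>\<in>F - range s. a \<alpha> j)"
    by (intro sum.cong) (auto simp: g_0)
  also have "(\<Sum>\<alpha>\<in>F \<inter> range s. g \<alpha> j) = (\<Sum>\<alpha>\<in>s -` F. a (s \<alpha>) j + \<xi> * a \<alpha> j)"
    unfolding F sum.reindex[OF inj] by (simp add: g_s)
  also have "\<dots> = (\<Sum>\<alpha>\<in>F \<inter> range s. a \<alpha> j) + \<xi> * (\<Sum>\<alpha>\<in>s -` F. a \<alpha> j)"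
    unfolding F sum.reindex[OF inj] by (simp add: sum.distrib sum_distrib_left)
  finally show ?thesis
    using sum.Int_Diff[OF assms, of "\<lambda>\<alpha>. a \<alpha> j" "range s"] by (simp add: algebra_simps)
qed

lemma unif_sum_formal_product:
  assumes "unif_sum w a W" "absval \<xi> \<le> 1"
  shows "unif_sum w g (\<lambda>j. (1 + \<xi>) * W j)"
proof (rule unif_sumI)
  fix e :: real assume "e > 0"
  then obtain F0 where F0: "finite F0"
    "\<And>F j. finite F \<Longrightarrow> F0 \<subseteq> F \<Longrightarrow> absval ((\<Sum>\<alpha>\<in>F. a \<alpha> j) - W j) * w j \<le> e"
    using unif_sumD[OF assms(1)] by metis
  show "\<exists>F0. finite F0 \<and> (\<forall>F. finite F \<longrightarrow> F0 \<subseteq> F \<longrightarrow>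
      (\<forall>j. absval ((\<Sum>\<alpha>\<in>F. g \<alpha> j) - (1 + \<xi>) * W j) * w j \<le> e))"
  \<comment> \<open>Adding the image of F0 makes the preimage of F contain F0 as well, so both
    partial sums are close to W.\<close>
  proof (intro exI[of _ "F0 \<union> s ` F0"] conjI allI impI)
    fix F j assume F: "finite F" "F0 \<union> s ` F0 \<subseteq> F"
    have "finite (s -` F)" using F(1) s by (rule finite_vimageI)
    moreover have "F0 \<subseteq> s -` F" using F(2) by auto
    ultimately have 1: "absval ((\<Sum>\<alpha>\<in>s -` F. a \<alpha> j) - W j) * w j \<le> e" by (rule F0(2))
    have 2: "absval ((\<Sum>\<alpha>\<in>F. a \<alpha> j) - W j) * w j \<le> e" using F by (intro F0(2)) auto
    have "(\<Sum>\<alpha>\<in>F. g \<alpha> j) - (1 + \<xi>) * W j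
        = ((\<Sum>\<alpha>\<in>F. a \<alpha> j) - W j) + \<xi> * ((\<Sum>\<alpha>\<in>s -` F. a \<alpha> j) - W j)"
      by (simp add: sum_formal_product[OF F(1)] algebra_simps)
    then show "absval ((\<Sum>\<alpha>\<in>F. g \<alpha> j) - (1 + \<xi>) * W j) * w j \<le> e"
      using absval_add_weight_le[OF 2 absval_mult_weight_le[OF assms(2) 1 w] w] by (simp only:)
  qed (use F0(1) in simp)
qed

text \<open>The terms of a are first shown to be uniformly null by solving the recursion a(s
  \<alpha>) = g(s \<alpha>) - \<xi> a(\<alpha>). The partial sums of a over F and over its preimage
  then nearly agree, so the partial sum of g is nearly 1 + \<xi> times that of a, and |1 + \<xi>| =
  1 lets the factor be removed without loss.\<close>

lemma unif_sum_formal_quotient: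
  fixes \<mu> :: "'i \<Rightarrow> nat"
  assumes sum: "unif_sum w g (\<lambda>j. (1 + \<xi>) * W j)"
    and \<xi>: "absval \<xi> < 1" "absval (1 + \<xi>) = 1"
    and \<mu>: "\<And>\<alpha>. \<mu> (s \<alpha>) = Suc (\<mu> \<alpha>)"
    and bd: "\<And>\<alpha>. \<exists>B. \<forall>j. absval (g \<alpha> j) * w j \<le> B"
  shows "unif_sum w a W"
proof -
  \<comment> \<open>A single term is the difference of two partial sums, both close to the
    limit.\<close>
  have g_null: "\<exists>F0. finite F0 \<and> (\<forall>\<alpha> j. \<alpha> \<notin> F0 \<longrightarrow> absval (g \<alpha> j) * w j \<le> e)" if e: "e > 0" for e
  proof -
    obtain F0 where F0: "finite F0"
      "\<And>F j. finite F \<Longrightarrow> F0 \<subseteq> F \<Longrightarrow> absval ((\<Sum>\<alpha>\<in>F. g \<alpha> j) - (1 + \<xi>) * W j) * w j \<le> e"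
      using unif_sumD[OF sum e] by metis
    have "absval (g \<alpha> j) * w j \<le> e" if "\<alpha> \<notin> F0" for \<alpha> j
    proof -
      have "g \<alpha> j = ((\<Sum>\<alpha>\<in>insert \<alpha> F0. g \<alpha> j) - (1 + \<xi>) * W j) - ((\<Sum>\<alpha>\<in>F0. g \<alpha> j) - (1 + \<xi>) * W j)"
        using F0(1) that by simp
      moreover have "absval ((\<Sum>\<alpha>\<in>insert \<alpha> F0. g \<alpha> j) - (1 + \<xi>) * W j) * w j \<le> e"
        using F0(1) by (intro F0(2)) auto
      moreover have "absval ((\<Sum>\<alpha>\<in>F0. g \<alpha> j) - (1 + \<xi>) * W j) * w j \<le> e"
        using F0(1) by (intro F0(2)) auto
      ultimately show ?thesis using w by (simp only: absval_diff_weight_le)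
    qed
    with F0(1) show ?thesis by blast
  qed
  obtain B where B: "\<And>\<alpha> j. absval (g \<alpha> j) * w j \<le> B" "B \<ge> 0"
  proof -
    obtain F0 where F0: "finite F0" "\<And>\<alpha> j. \<alpha> \<notin> F0 \<Longrightarrow> absval (g \<alpha> j) * w j \<le> 1"
      using g_null[of 1] by auto
    obtain b where b: "\<And>\<alpha> j. absval (g \<alpha> j) * w j \<le> b \<alpha>" using bd by metis
    have "absval (g \<alpha> j) * w j \<le> Max (insert 1 (b ` F0))" for \<alpha> j
    proof (cases "\<alpha> \<in> F0")
      case True
      then have "b \<alpha> \<le> Max (insert 1 (b ` F0))" using F0(1) by (intro Max_ge) auto
      then show ?thesis using b[of \<alpha> j] by linarith
    next
      case False
      have "1 \<le> Max (insert 1 (b ` F0))" using F0(1) by (intro Max_ge) auto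
      then show ?thesis using F0(2)[OF False, of j] by linarith
    qed
    moreover have "1 \<le> Max (insert 1 (b ` F0))" using F0(1) by (intro Max_ge) auto
    ultimately show ?thesis by (intro that[of "Max (insert 1 (b ` F0))"]) auto
  qed
  have a_s: "a (s \<alpha>) j = g (s \<alpha>) j - \<xi> * a \<alpha> j" for \<alpha> j by (simp add: g_s)
  \<comment> \<open>The recursion goes back along s and stops because \<mu> drops by one each time;
    as |\<xi>| < 1, the bound for g survives every step.\<close>
  have aB: "absval (a \<alpha> j) * w j \<le> B" for \<alpha> j
  proof (induction "\<mu> \<alpha>" arbitrary: \<alpha> rule: less_induct)
    case less
    show ?case
    proof (cases "\<alpha> \<in> range s")
      case True
      then obtain \<beta> where \<beta>: "\<alpha> = s \<beta>" by blast
      then have "absval (a \<beta> j) * w j \<le> B" by (intro less) (simp add: \<mu>)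
      then show ?thesis
        unfolding \<beta> a_s using \<xi>(1) w B(1)
        by (intro absval_diff_weight_le absval_mult_weight_le) auto
    next
      case False
      then show ?thesis using B(1)[of \<alpha> j] by (simp add: g_0)
    qed
  qed
  have a_null: "\<exists>E. finite E \<and> (\<forall>\<alpha> j. \<alpha> \<notin> E \<longrightarrow> absval (a \<alpha> j) * w j \<le> e)" if e: "e > 0" for e
  proof -
    obtain F0 where F0: "finite F0" "\<And>\<alpha> j. \<alpha> \<notin> F0 \<Longrightarrow> absval (g \<alpha> j) * w j \<le> e"
      using g_null[OF e] by blast
    \<comment> \<open>Each use of the recursion improves the bound by a factor |\<xi>|, while the
      exceptional set E is replaced by the union of F0 with the image of E under s, still
      finite.\<close>
    have ex: "\<exists>E. finite E \<and> (\<forall>\<alpha> j. \<alpha> \<notin> E \<longrightarrow> absval (a \<alpha> j) * w j \<le> max e (absval \<xi> ^ n * B))" for n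
    proof (induction n)
      case 0
      have "absval (a \<alpha> j) * w j \<le> max e B" for \<alpha> j
        using aB[of \<alpha> j] by simp
      then show ?case by (intro exI[of _ "{}"]) simp
    next
      case (Suc n)
      then obtain E where E: "finite E"
        "\<And>\<alpha> j. \<alpha> \<notin> E \<Longrightarrow> absval (a \<alpha> j) * w j \<le> max e (absval \<xi> ^ n * B)" by blast
      let ?m = "max e (absval \<xi> ^ Suc n * B)"
      have "absval (a \<alpha> j) * w j \<le> ?m" if \<alpha>: "\<alpha> \<notin> F0 \<union> s ` E" for \<alpha> j
      proof -
        have gm: "absval (g \<alpha> j) * w j \<le> ?m" using F0(2)[of \<alpha> j] \<alpha> by simp
        show ?thesis
        proof (cases "\<alpha> \<in> range s")
          case True
          then obtain \<beta> where \<beta>: "\<alpha> = s \<beta>" by blast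
          with \<alpha> have "\<beta> \<notin> E" by blast
          then have "absval \<xi> * (absval (a \<beta> j) * w j) \<le> absval \<xi> * max e (absval \<xi> ^ n * B)"
            by (intro mult_left_mono E(2)) simp_all
          also have "\<dots> = max (absval \<xi> * e) (absval \<xi> ^ Suc n * B)"
            by (simp add: max_mult_distrib_left mult.assoc)
          also have "\<dots> \<le> ?m"
            using e \<xi>(1) mult_left_le_one_le[of e "absval \<xi>"] by (intro max.mono) auto
          finally have "absval (\<xi> * a \<beta> j) * w j \<le> ?m" by (simp only: absval_mult mult.assoc)
          then show ?thesis
            using gm w unfolding \<beta> a_s by (intro absval_diff_weight_le)
        next
          case False
          then show ?thesis using gm by (simp add: g_0)
        qed
      qed
      then show ?case using E(1) F0(1) by (intro exI[of _ "F0 \<union> s ` E"]) simp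
    qed
    have "(\<lambda>n. absval \<xi> ^ n * B) \<longlonglongrightarrow> 0 * B"
      using \<xi>(1) by (intro tendsto_intros LIMSEQ_power_zero) simp
    then have "\<forall>\<^sub>F n in sequentially. absval \<xi> ^ n * B < e" using e by (simp add: order_tendsto_iff)
    then obtain n where "absval \<xi> ^ n * B < e" unfolding eventually_sequentially by blast
    then have "max e (absval \<xi> ^ n * B) = e" by simp
    then show ?thesis using ex[of n] by (simp only:)
  qed
  show ?thesis
  proof (rule unif_sumI)
    fix e :: real assume e: "e > 0"
    obtain F0 where F0: "finite F0"
      "\<And>F j. finite F \<Longrightarrow> F0 \<subseteq> F \<Longrightarrow> absval ((\<Sum>\<alpha>\<in>F. g \<alpha> j) - (1 + \<xi>) * W j) * w j \<le> e"
      using unif_sumD[OF sum e] by metis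
    obtain E where E: "finite E" "\<And>\<alpha> j. \<alpha> \<notin> E \<Longrightarrow> absval (a \<alpha> j) * w j \<le> e"
      using a_null[OF e] by blast
    show "\<exists>F0. finite F0 \<and> (\<forall>F. finite F \<longrightarrow> F0 \<subseteq> F \<longrightarrow>
      (\<forall>j. absval ((\<Sum>\<alpha>\<in>F. a \<alpha> j) - W j) * w j \<le> e))"
    \<comment> \<open>With this choice E lies in F and in the preimage of F, so the two sets differ
      only by indices with small terms.\<close>
    proof (intro exI[of _ "F0 \<union> E \<union> s ` E"] conjI allI impI)
      fix F j assume F: "finite F" "F0 \<union> E \<union> s ` E \<subseteq> F"
      let ?A = "\<lambda>F. \<Sum>\<alpha>\<in>F. a \<alpha> j"
      have G: "finite (s -` F)" using F(1) s by (rule finite_vimageI)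
      have small: "absval (?A H) * w j \<le> e" if "H \<inter> E = {}" for H
        using that E(2) w e by (intro absval_sum_weight_le) auto
      have "?A F - ?A (s -` F) = ?A (F - s -` F) - ?A (s -` F - F)"
        using sum.Int_Diff[OF F(1), of "\<lambda>\<alpha>. a \<alpha> j" "s -` F"]
          sum.Int_Diff[OF G, of "\<lambda>\<alpha>. a \<alpha> j" F] by (simp add: Int_commute)
      moreover have "(F - s -` F) \<inter> E = {}" "(s -` F - F) \<inter> E = {}" using F(2) by auto
      ultimately have d: "absval (?A F - ?A (s -` F)) * w j \<le> e"
        using small absval_diff_weight_le[OF small small w] by simp
      have id: "(1 + \<xi>) * (?A F - W j) = ((\<Sum>\<alpha>\<in>F. g \<alpha> j) - (1 + \<xi>) * W j) + \<xi> * (?A F - ?A (s -` F))"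
        by (simp add: sum_formal_product[OF F(1)] algebra_simps)
      have "absval ((\<Sum>\<alpha>\<in>F. g \<alpha> j) - (1 + \<xi>) * W j) * w j \<le> e" using F by (intro F0(2)) auto
      then have "absval ((1 + \<xi>) * (?A F - W j)) * w j \<le> e"
        unfolding id using d \<xi>(1) w by (intro absval_add_weight_le absval_mult_weight_le) auto
      then show "absval (?A F - W j) * w j \<le> e" by (simp add: absval_mult \<xi>(2))
    qed (use F0(1) E(1) in simp)
  qed
qed

end

section \<open>The action of roots of unity\<close>

context polyannulus
begin

lemma gauss_norm_le_iff:
  assumes "f \<in> laurent_fun J" "\<rho> \<in> J"
  shows "gauss_norm \<rho> f \<le> e \<longleftrightarrow> (\<forall>j. absval (f j) * weight \<rho> j \<le> e)"
  unfolding gauss_norm_def by (subst cSUP_le_iff) (use laurent_bounded[OF assms] in auto)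

lemma gauss_norm_nonneg:
  assumes "f \<in> laurent_fun J" "\<rho> \<in> J"
  shows "0 \<le> gauss_norm \<rho> f"
  by (rule order_trans[OF _ gauss_norm_upper[OF assms, of 0]]) (simp add: assms(2))

text \<open>Membership in \<open>laurent_fun\<close> bounds the weighted coefficients; for an
  unbounded set the real supremum in \<open>gauss_norm\<close> would carry no information.\<close>

lemma gauss_norm_tendsto_iff_unif_sum:
  assumes L: "\<And>F. finite F \<Longrightarrow> (\<lambda>j. (\<Sum>\<alpha>\<in>F. a \<alpha> j) - W j) \<in> laurent_fun J" and \<rho>: "\<rho> \<in> J"
  shows "((\<lambda>F. gauss_norm \<rho> (\<lambda>j. (\<Sum>\<alpha>\<in>F. a \<alpha> j) - W j)) \<longlongrightarrow> 0) (finite_subsets_at_top UNIV)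
    \<longleftrightarrow> unif_sum (weight \<rho>) a W" (is "?L \<longleftrightarrow> ?R")
proof
  assume ?L
  show ?R
  proof (rule unif_sumI)
    fix e :: real assume "e > 0"
    with \<open>?L\<close> have "\<forall>\<^sub>F F in finite_subsets_at_top UNIV. gauss_norm \<rho> (\<lambda>j. (\<Sum>\<alpha>\<in>F. a \<alpha> j) - W j) < e"
      by (rule order_tendstoD(2))
    then obtain F0 where F0: "finite F0"
      "\<And>F. finite F \<Longrightarrow> F0 \<subseteq> F \<Longrightarrow> gauss_norm \<rho> (\<lambda>j. (\<Sum>\<alpha>\<in>F. a \<alpha> j) - W j) < e"
      unfolding eventually_finite_subsets_at_top by auto
    show "\<exists>F0. finite F0 \<and> (\<forall>F. finite F \<longrightarrow> F0 \<subseteq> F \<longrightarrow>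
        (\<forall>j. absval ((\<Sum>\<alpha>\<in>F. a \<alpha> j) - W j) * weight \<rho> j \<le> e))"
    proof (intro exI[of _ F0] conjI allI impI)
      fix F j assume F: "finite F" "F0 \<subseteq> F"
      show "absval ((\<Sum>\<alpha>\<in>F. a \<alpha> j) - W j) * weight \<rho> j \<le> e"
        using less_imp_le[OF F0(2)[OF F]] gauss_norm_le_iff[OF L[OF F(1)] \<rho>] by blast
    qed (rule F0(1))
  qed
next
  assume ?R
  show ?L
  proof (rule tendstoI)
    fix e :: real assume "e > 0"
    \<comment> \<open>The half absorbs the passage to the supremum, which keeps only weak
      inequalities.\<close>
    then have "e / 2 > 0" by simp
    then obtain F0 where F0: "finite F0"
      "\<And>F j. finite F \<Longrightarrow> F0 \<subseteq> F \<Longrightarrow> absval ((\<Sum>\<alpha>\<in>F. a \<alpha> j) - W j) * weight \<rho> j \<le> e / 2"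
      using unif_sumD[OF \<open>?R\<close>] by metis
    have "dist (gauss_norm \<rho> (\<lambda>j. (\<Sum>\<alpha>\<in>F. a \<alpha> j) - W j)) 0 < e" if F: "finite F" "F0 \<subseteq> F" for F
    proof -
      have "gauss_norm \<rho> (\<lambda>j. (\<Sum>\<alpha>\<in>F. a \<alpha> j) - W j) \<le> e / 2"
        using F0(2)[OF F] gauss_norm_le_iff[OF L[OF F(1)] \<rho>] by blast
      then show ?thesis
        using gauss_norm_nonneg[OF L[OF F(1)] \<rho>] \<open>e > 0\<close> by (simp add: dist_real_def)
    qed
    then show "\<forall>\<^sub>F F in finite_subsets_at_top UNIV. dist (gauss_norm \<rho> (\<lambda>j. (\<Sum>\<alpha>\<in>F. a \<alpha> j) - W j)) 0 < e"
      unfolding eventually_finite_subsets_at_top using F0(1) by blast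
  qed
qed

end

section \<open>Compatibility of the action with scalars and monomials\<close>

lemma vshift_vshift: "vshift r m (vshift r m' v) = vshift r (m + m') v"
  by (rule vec_eqI[of _ r]) (simp_all add: vshift_extensional vshift_apply algebra_simps)

lemma vshift_zero: "v \<in> extensional {..<r} \<Longrightarrow> vshift r 0 v = v"
  by (rule vec_eqI[of _ r]) (simp_all add: vshift_extensional vshift_apply)

text \<open>Of roots of unity only |\<zeta>_i| = 1 and |\<zeta>_i - 1| < 1 enter here; of the
  connection only the relations in \<open>euler_operators\<close>.\<close>

locale zeta_setting =
  polyannulus J +
  euler_operators r "free_module (laurent_ring J) r" T
  for J :: "(real ^ 'n::{finite,linorder}) set" and r
    and T :: "'n \<Rightarrow> (nat \<Rightarrow> ('k::{nonarch_field,field_char_0}, 'n) series) \<Rightarrow> (nat \<Rightarrow> ('k, 'n) series)" +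
  fixes D :: "'n \<Rightarrow> (nat \<Rightarrow> ('k, 'n) series) \<Rightarrow> (nat \<Rightarrow> ('k, 'n) series)"
    and \<iota> :: "'k \<Rightarrow> 'l::nonarch_field" and \<zeta> :: "('l, 'n) vec"
  assumes T_eq: "T = (\<lambda>i y. \<lambda>a\<in>{..<r}. lmonom (axis i 1) \<otimes>\<^bsub>laurent_ring J\<^esub> D i y a)"
    and \<iota>_add: "\<iota> (x + y) = \<iota> x + \<iota> y"
    and \<iota>_mult: "\<iota> (x * y) = \<iota> x * \<iota> y"
    and \<iota>_absval: "absval (\<iota> x) = absval x"
    and absval_\<zeta>: "absval (\<zeta> $ i) = 1"
    and absval_\<zeta>_diff_one: "absval (\<zeta> $ i - 1) < 1"
begin

abbreviation P :: "(nat \<Rightarrow> ('k, 'n) series) set" where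
  "P \<equiv> free_module (laurent_ring J) r"

abbreviation M :: "(nat, 'n) vec \<Rightarrow> (nat \<Rightarrow> ('k, 'n) series) \<Rightarrow> (nat \<Rightarrow> ('k, 'n) series)" where
  "M \<equiv> multi (sorted_list_of_set UNIV)"

definition coef :: "(nat, 'n) vec \<Rightarrow> 'l" where
  "coef \<alpha> = (\<Prod>i\<in>UNIV. (\<zeta> $ i - 1) ^ (\<alpha> $ i))"

definition zterm :: "(nat \<Rightarrow> ('k, 'n) series) \<Rightarrow> nat \<Rightarrow> (nat, 'n) vec \<Rightarrow> (int, 'n) vec \<Rightarrow> 'l" where
  "zterm v a \<alpha> j = coef \<alpha> * \<iota> (M \<alpha> v a j)"

lemma multi_binom_op_eq: "multi_binom_op J r D \<alpha> v = M \<alpha> v"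
  by (simp only: multi_binom_op_def multi_def fun_cong[OF T_eq])

lemma \<iota>_laurent: "f \<in> laurent_fun J \<Longrightarrow> (\<lambda>j. \<iota> (f j)) \<in> laurent_fun J"
  by (simp add: laurent_iff \<iota>_absval)

lemma zterm_laurent:
  assumes "v \<in> P" "a < r"
  shows "zterm v a \<alpha> \<in> laurent_fun J"
proof -
  have "M \<alpha> v a \<in> laurent_fun J"
    using multi_closed[OF assms(1)] assms(2) by (simp add: free_module_iff)
  then have "(\<lambda>j. coef \<alpha> * \<iota> (M \<alpha> v a j)) \<in> laurent_fun J"
    by (intro laurent_scale \<iota>_laurent)
  then show ?thesis by (simp add: zterm_def[abs_def])
qed

lemma zeta_action_iff:
  assumes "v \<in> P"
  shows "zeta_action \<iota> J r D \<zeta> v w \<longleftrightarrow>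
    (\<forall>a<r. w a \<in> laurent_fun J \<and> (\<forall>\<rho>\<in>J. unif_sum (weight \<rho>) (zterm v a) (w a)))"
proof -
  have "((\<lambda>F. gauss_norm \<rho> (\<lambda>j. (\<Sum>\<alpha>\<in>F. zterm v a \<alpha> j) - w a j)) \<longlongrightarrow> 0) (finite_subsets_at_top UNIV)
      \<longleftrightarrow> unif_sum (weight \<rho>) (zterm v a) (w a)"
    if "a < r" "w a \<in> laurent_fun J" "\<rho> \<in> J" for a \<rho>
  proof (rule gauss_norm_tendsto_iff_unif_sum[OF _ \<open>\<rho> \<in> J\<close>])
    fix F :: "(nat, 'n) vec set" assume "finite F"
    have "(\<lambda>j. (\<Sum>\<alpha>\<in>F. zterm v a \<alpha> j) + - w a j) \<in> laurent_fun J"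
      by (intro laurent_add laurent_sum laurent_uminus zterm_laurent assms that)
    then show "(\<lambda>j. (\<Sum>\<alpha>\<in>F. zterm v a \<alpha> j) - w a j) \<in> laurent_fun J" by simp
  qed
  then show ?thesis
    unfolding zeta_action_def multi_binom_op_eq coef_def[symmetric] zterm_def[symmetric] by blast
qed

lemma zeta_action_cong:
  assumes "\<And>a j. a < r \<Longrightarrow> w a j = w' a j"
  shows "zeta_action \<iota> J r D \<zeta> v w \<longleftrightarrow> zeta_action \<iota> J r D \<zeta> v w'"
proof -
  have "w a = w' a" if "a < r" for a using assms[OF that] by (rule ext)
  then show ?thesis unfolding zeta_action_def by simp
qed

lemma zeta_action_scale:
  assumes "v \<in> P" "zeta_action \<iota> J r D \<zeta> v w"
  shows "zeta_action \<iota> J r D \<zeta> (vscale r c v) (\<lambda>a j. \<iota> c * w a j)"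
  unfolding zeta_action_iff[OF vscale_closed[OF assms(1)]]
proof (intro allI impI conjI ballI)
  fix a assume a: "a < r"
  have w: "w a \<in> laurent_fun J" "\<And>\<rho>. \<rho> \<in> J \<Longrightarrow> unif_sum (weight \<rho>) (zterm v a) (w a)"
    using assms(2) a unfolding zeta_action_iff[OF assms(1)] by auto
  show "(\<lambda>j. \<iota> c * w a j) \<in> laurent_fun J" by (intro laurent_scale w)
  fix \<rho> assume \<rho>: "\<rho> \<in> J"
  have "zterm (vscale r c v) a = (\<lambda>\<alpha> j. \<iota> c * zterm v a \<alpha> j)"
    using a by (auto simp: zterm_def multi_scale assms(1) vscale_apply \<iota>_mult intro!: ext)
  then show "unif_sum (weight \<rho>) (zterm (vscale r c v) a) (\<lambda>j. \<iota> c * w a j)"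
    using unif_sum_scale[OF w(2)[OF \<rho>], of "\<iota> c"] \<rho> by simp
qed

lemma coef_shift: "coef (\<alpha> + axis k 1) = coef \<alpha> * (\<zeta> $ k - 1)"
proof -
  have "(\<Prod>i\<in>UNIV. (\<zeta> $ i - 1) ^ (axis k 1 $ i)) = (\<Prod>i\<in>UNIV. if i = k then \<zeta> $ i - 1 else 1)"
    by (intro prod.cong) (auto simp: axis_def)
  then show ?thesis by (simp add: coef_def power_add prod.distrib)
qed

text \<open>With \<xi> = \<zeta>_k - 1 the series of t_k v is t_k times the formal product of the
  series of v with 1 + \<xi> s, and 1 + \<xi> = \<zeta>_k. The equivalence matters: its reverse
  direction, where the series is divided, yields the inverse monomial.\<close>

lemma zeta_action_shift_axis:
  assumes v: "v \<in> P"
  shows "zeta_action \<iota> J r D \<zeta> (vshift r (axis k 1) v) (\<lambda>a j. \<zeta> $ k * w a (j - axis k 1)) \<longleftrightarrow>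
    zeta_action \<iota> J r D \<zeta> v w"
proof -
  let ?t = "axis k 1 :: (int, 'n) vec" and ?u = "axis k 1 :: (nat, 'n) vec"
  let ?\<xi> = "\<zeta> $ k - 1"
  have \<zeta>0: "\<zeta> $ k \<noteq> 0" using absval_\<zeta>[of k] by auto
  have "w a \<in> laurent_fun J \<longleftrightarrow> (\<lambda>j. \<zeta> $ k * w a (j - ?t)) \<in> laurent_fun J" for a
  proof
    assume "w a \<in> laurent_fun J"
    then show "(\<lambda>j. \<zeta> $ k * w a (j - ?t)) \<in> laurent_fun J" by (intro laurent_scale laurent_shift)
  next
    assume "(\<lambda>j. \<zeta> $ k * w a (j - ?t)) \<in> laurent_fun J"
    from laurent_scale[OF laurent_shift[OF this, of "- ?t"], of "inverse (\<zeta> $ k)"]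
    show "w a \<in> laurent_fun J" using \<zeta>0 by (simp add: mult.assoc[symmetric])
  qed
  moreover have "unif_sum (weight \<rho>) (zterm v a) (w a) \<longleftrightarrow>
      unif_sum (weight \<rho>) (zterm (vshift r ?t v) a) (\<lambda>j. \<zeta> $ k * w a (j - ?t))"
    if a: "a < r" and \<rho>: "\<rho> \<in> J" for a \<rho>
  proof -
    let ?a = "\<lambda>\<alpha> j. zterm v a \<alpha> (j - ?t)" and ?g = "zterm (vshift r ?t v) a"
    have shift: "unif_sum (weight \<rho>) (zterm v a) (w a) \<longleftrightarrow> unif_sum (weight \<rho>) ?a (\<lambda>j. w a (j - ?t))"
    proof
      assume "unif_sum (weight \<rho>) (zterm v a) (w a)"
      then show "unif_sum (weight \<rho>) ?a (\<lambda>j. w a (j - ?t))"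
        by (rule unif_sum_shift[of _ _ _ _ "weight \<rho> ?t"]) (use \<rho> in \<open>simp_all flip: wadd\<close>)
    next
      assume "unif_sum (weight \<rho>) ?a (\<lambda>j. w a (j - ?t))"
      then have "unif_sum (weight \<rho>) (\<lambda>\<alpha> j. ?a \<alpha> (j - - ?t)) (\<lambda>j. w a (j - - ?t - ?t))"
        by (rule unif_sum_shift[of _ _ _ _ "weight \<rho> (- ?t)"]) (use \<rho> in \<open>simp_all flip: wadd\<close>)
      then show "unif_sum (weight \<rho>) (zterm v a) (w a)" by simp
    qed
    \<comment> \<open>Pascal's rule in \<open>multi_shift\<close>; the coefficient of the second
      summand has one factor \<zeta>_k - 1 more than \<open>coef\<close> at \<alpha>, which is
      \<xi>.\<close>
    have g_s: "?g (\<alpha> + ?u) j = ?a (\<alpha> + ?u) j + ?\<xi> * ?a \<alpha> j" for \<alpha> j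
      using a multi_shift[OF v, of k "sorted_list_of_set UNIV" \<alpha>]
      by (simp add: zterm_def vshift_apply vadd_apply \<iota>_add coef_shift algebra_simps del: One_nat_def)
    have g_0: "?g \<alpha> j = ?a \<alpha> j" if "\<alpha> \<notin> range (\<lambda>\<alpha>. \<alpha> + ?u)" for \<alpha> j
    proof -
      have "\<alpha> $ k = 0"
      proof (rule ccontr)
        assume "\<alpha> $ k \<noteq> 0"
        \<comment> \<open>Subtraction of naturals is exact here because \<alpha>_k is
          nonzero.\<close>
        then have "\<alpha> = (\<alpha> - ?u) + ?u" by (auto simp: vec_eq_iff axis_def)
        with that show False by blast
      qed
      then show ?thesis
        using a multi_shift_zero[OF v, of k "sorted_list_of_set UNIV" \<alpha>]
        by (simp add: zterm_def vshift_apply)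
    qed
    have inj: "inj (\<lambda>\<alpha>. \<alpha> + ?u)" by (simp add: inj_def)
    have w: "0 \<le> weight \<rho> j" for j using \<rho> by simp
    have \<xi>: "1 + ?\<xi> = \<zeta> $ k" by simp
    have bd: "\<exists>B. \<forall>j. absval (?g \<alpha> j) * weight \<rho> j \<le> B" for \<alpha>
      using gauss_norm_upper[OF zterm_laurent[OF vshift_closed[OF v] a] \<rho>] by blast
    have \<mu>: "(\<alpha> + ?u) $ k = Suc (\<alpha> $ k)" for \<alpha> by (simp add: axis_def)
    show ?thesis
      unfolding shift
    proof
      assume h: "unif_sum (weight \<rho>) ?a (\<lambda>j. w a (j - ?t))"
      have "unif_sum (weight \<rho>) ?g (\<lambda>j. (1 + ?\<xi>) * w a (j - ?t))"
        by (rule unif_sum_formal_product[where a = ?a and g = ?g and s = "\<lambda>\<alpha>. \<alpha> + ?u"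
              and \<xi> = ?\<xi>, OF w inj g_s _ h less_imp_le[OF absval_\<zeta>_diff_one]])
           (rule g_0)
      then show "unif_sum (weight \<rho>) ?g (\<lambda>j. \<zeta> $ k * w a (j - ?t))" by (simp only: \<xi>)
    next
      assume "unif_sum (weight \<rho>) ?g (\<lambda>j. \<zeta> $ k * w a (j - ?t))"
      then have h: "unif_sum (weight \<rho>) ?g (\<lambda>j. (1 + ?\<xi>) * w a (j - ?t))" by (simp only: \<xi>)
      show "unif_sum (weight \<rho>) ?a (\<lambda>j. w a (j - ?t))"
        by (rule unif_sum_formal_quotient[where \<mu> = "\<lambda>\<alpha>. \<alpha> $ k" and a = ?a and g = ?g and s = "\<lambda>\<alpha>. \<alpha> + ?u"
              and \<xi> = ?\<xi>, OF w inj g_s _ h absval_\<zeta>_diff_one _ \<mu> bd])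
           (simp_all add: g_0 absval_\<zeta>)
    qed
  qed
  ultimately show ?thesis
    unfolding zeta_action_iff[OF v] zeta_action_iff[OF vshift_closed[OF v]] by blast
qed

text \<open>Quantified over all v and w, so that shifts compose and the unit vectors with both signs
  generate all exponents.\<close>

definition shiftable :: "(int, 'n) vec \<Rightarrow> bool" where
  "shiftable m \<longleftrightarrow> (\<forall>v\<in>P. \<forall>w. zeta_action \<iota> J r D \<zeta> v w \<longrightarrow>
     zeta_action \<iota> J r D \<zeta> (vshift r m v) (\<lambda>a j. (\<Prod>i\<in>UNIV. \<zeta> $ i powi (m $ i)) * w a (j - m)))"

lemma \<zeta>_nonzero: "\<zeta> $ i \<noteq> 0"
  using absval_\<zeta>[of i] by auto

lemma shiftable_add:
  assumes "shiftable m" "shiftable m'"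
  shows "shiftable (m + m')"
  unfolding shiftable_def
proof (intro ballI allI impI)
  fix v w assume v: "v \<in> P" "zeta_action \<iota> J r D \<zeta> v w"
  then have "zeta_action \<iota> J r D \<zeta> (vshift r m (vshift r m' v))
      (\<lambda>a j. (\<Prod>i\<in>UNIV. \<zeta> $ i powi (m $ i)) * ((\<Prod>i\<in>UNIV. \<zeta> $ i powi (m' $ i)) * w a (j - m - m')))"
    using assms vshift_closed[OF v(1)] unfolding shiftable_def by blast
  then show "zeta_action \<iota> J r D \<zeta> (vshift r (m + m') v)
      (\<lambda>a j. (\<Prod>i\<in>UNIV. \<zeta> $ i powi ((m + m') $ i)) * w a (j - (m + m')))"
    by (simp add: vshift_vshift power_int_add \<zeta>_nonzero prod.distrib mult.assoc diff_diff_eq)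
qed

lemma prod_powi_axis: "(\<Prod>i\<in>UNIV. \<zeta> $ i powi (axis k z $ i)) = \<zeta> $ k powi z"
proof -
  have "(\<Prod>i\<in>UNIV. \<zeta> $ i powi (axis k z $ i)) = (\<Prod>i\<in>UNIV. if i = k then \<zeta> $ i powi z else 1)"
    by (intro prod.cong) (auto simp: axis_def)
  then show ?thesis by simp
qed

lemma shiftable_zero: "shiftable 0"
  unfolding shiftable_def by (auto simp: vshift_zero free_module_iff)

lemma shiftable_axis: "shiftable (axis k z)"
proof -
  have 1: "shiftable (axis k 1)"
    unfolding shiftable_def by (simp add: prod_powi_axis zeta_action_shift_axis)
  have "zeta_action \<iota> J r D \<zeta> (vshift r (axis k (- 1)) v)
      (\<lambda>a j. (\<Prod>i\<in>UNIV. \<zeta> $ i powi (axis k (- 1) $ i)) * w a (j - axis k (- 1)))"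
    if "v \<in> P" "zeta_action \<iota> J r D \<zeta> v w" for v w
  proof -
    have m: "axis k 1 + axis k (- 1) = (0 :: (int, 'n) vec)" by (simp add: vec_eq_iff axis_def)
    \<comment> \<open>Applying t_k to the vector t_k^(-1) v gives back v and turns \<open>?w\<close>
      into w, so the reverse direction of \<open>zeta_action_shift_axis\<close> applies.\<close>
    let ?w = "\<lambda>a j. (\<Prod>i\<in>UNIV. \<zeta> $ i powi (axis k (- 1) $ i)) * w a (j - axis k (- 1))"
    have "(\<lambda>a j. \<zeta> $ k * ?w a (j - axis k 1)) = w"
      by (simp add: prod_powi_axis power_int_minus \<zeta>_nonzero m diff_diff_eq flip: mult.assoc)
    moreover have "vshift r (axis k 1) (vshift r (axis k (- 1)) v) = v"
      using that(1) by (simp add: vshift_vshift m vshift_zero free_module_iff)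
    ultimately have "zeta_action \<iota> J r D \<zeta> (vshift r (axis k 1) (vshift r (axis k (- 1)) v))
        (\<lambda>a j. \<zeta> $ k * ?w a (j - axis k 1))"
      using that(2) by (simp only:)
    then show ?thesis
      by (rule iffD1[OF zeta_action_shift_axis[OF vshift_closed[OF that(1)]]])
  qed
  then have 2: "shiftable (axis k (- 1))" unfolding shiftable_def by blast
  show ?thesis
  proof (induction z rule: int_induct[of _ 0])
    case base
    have "axis k 0 = (0 :: (int, 'n) vec)" by (simp add: vec_eq_iff axis_def)
    then show ?case using shiftable_zero by (simp only:)
  next
    case (step1 z)
    have "axis k (z + 1) = axis k z + (axis k 1 :: (int, 'n) vec)" by (simp add: vec_eq_iff axis_def)
    then show ?case using shiftable_add[OF step1(2) 1] by simp
  next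
    case (step2 z)
    have "axis k (z - 1) = axis k z + (axis k (- 1) :: (int, 'n) vec)" by (simp add: vec_eq_iff axis_def)
    then show ?case using shiftable_add[OF step2(2) 2] by simp
  qed
qed

lemma zeta_action_shift:
  assumes "v \<in> P" "zeta_action \<iota> J r D \<zeta> v w"
  shows "zeta_action \<iota> J r D \<zeta> (vshift r m v) (\<lambda>a j. (\<Prod>i\<in>UNIV. \<zeta> $ i powi (m $ i)) * w a (j - m))"
proof -
  have "shiftable (\<Sum>k\<in>A. axis k (m $ k))" for A
    by (induction A rule: infinite_finite_induct)
       (simp_all add: shiftable_zero shiftable_add shiftable_axis)
  moreover have "(\<Sum>k\<in>UNIV. axis k (m $ k)) = m"
    by (simp add: vec_eq_iff axis_def if_distrib[of "\<lambda>f. f _"])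
  ultimately have "shiftable m" by metis
  then show ?thesis using assms unfolding shiftable_def by blast
qed

end

text \<open>The formula in \<open>euler_formula\<close> is the same over J and J', so the Euler
  operators agree on vectors over J, and so do all their binomials because these vectors are
  preserved.\<close>

lemma multi_binom_op_restrict:
  fixes J J' :: "(real ^ 'n::{finite,linorder}) set"
    and D :: "'n \<Rightarrow> (nat \<Rightarrow> ('k::{nonarch_field,field_char_0,complete_space}, 'n) series) \<Rightarrow> (nat \<Rightarrow> ('k, 'n) series)"
  assumes J: "polyannulus J" "polyannulus J'" "J' \<subseteq> J"
    and G: "\<And>i b a. b < r \<Longrightarrow> a < r \<Longrightarrow> D i (unit_vector (laurent_ring I) r b) a \<in> laurent_fun J"
    and v: "v \<in> free_module (laurent_ring J) r"
  shows "multi_binom_op J' r (restrict_conn I J' r D) \<alpha> v = multi_binom_op J r (restrict_conn I J r D) \<alpha> v"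
proof -
  let ?P = "free_module (laurent_ring J) r"
  let ?T = "\<lambda>J i y. \<lambda>a\<in>{..<r}. lmonom (axis i 1) \<otimes>\<^bsub>laurent_ring J\<^esub> restrict_conn I J r D i y a"
  interpret E: euler_operators r ?P "?T J" 
    by (rule euler_operators_restrict_conn[OF J(1)]) (rule G)
  have sub: "laurent_fun J \<subseteq> (laurent_fun J' :: ('k, 'n) series set)"
    using J(3) by (auto simp: laurent_fun_def)
  have T: "?T J' i y = ?T J i y" if y: "y \<in> ?P" for i y
  proof (rule vec_eqI[of _ r])
    fix a and j :: "(int, 'n) vec" assume a: "a < r"
    have y': "y \<in> free_module (laurent_ring J') r" using y sub by (auto simp: free_module_iff)
    have G': "D i (unit_vector (laurent_ring I) r b) a \<in> laurent_fun J'" if "b < r" "a < r" for b a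
      using G[OF that] sub by blast
    show "?T J' i y a j = ?T J i y a j"
      using polyannulus.euler_formula[of J r D i I y a j, OF J(1) G y a]
        polyannulus.euler_formula[of J' r D i I y a j, OF J(2) G' y' a] a by simp
  qed simp_all
  have b: "binom_op r (?T J' i) m y = binom_op r (?T J i) m y" if "y \<in> ?P" for i m y
    by (induction m) (simp_all only: binom_op.simps(1) binom_op_Suc T E.binom_closed that)
  have "foldr (\<lambda>i. binom_op r (?T J' i) (\<alpha> $ i)) xs v = E.multi xs \<alpha> v" for xs
    by (induction xs) (simp_all only: foldr.simps o_apply id_apply E.multi_simps b E.multi_closed v)
  then show ?thesis by (simp only: multi_binom_op_def E.multi_def)
qed

lemma zeta_action_restrict:
  fixes J J' :: "(real ^ 'n::{finite,linorder}) set"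
    and D :: "'n \<Rightarrow> (nat \<Rightarrow> ('k::{nonarch_field,field_char_0,complete_space}, 'n) series) \<Rightarrow> (nat \<Rightarrow> ('k, 'n) series)"
  assumes "polyannulus J" "polyannulus J'" "J' \<subseteq> J"
    and "\<And>i b a. b < r \<Longrightarrow> a < r \<Longrightarrow> D i (unit_vector (laurent_ring I) r b) a \<in> laurent_fun J"
    and "v \<in> free_module (laurent_ring J) r"
    and "zeta_action \<iota> J r (restrict_conn I J r D) \<zeta> v w"
  shows "zeta_action \<iota> J' r (restrict_conn I J' r D) \<zeta> v w"
proof -
  have "multi_binom_op J' r (restrict_conn I J' r D) \<alpha> v = multi_binom_op J r (restrict_conn I J r D) \<alpha> v" for \<alpha>
    by (rule multi_binom_op_restrict[OF assms(1-3) _ assms(5)]) (rule assms(4))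
  then show ?thesis
    using assms(3,6) unfolding zeta_action_def by (auto simp: laurent_fun_def)
qed

section \<open>Shrinking the polyannulus and twisting by monomials\<close>

context polyannulus
begin

lemma laurent_a_inv:
  fixes f :: "('k::{nonarch_field,complete_space}, 'n) series"
  assumes "f \<in> laurent_fun J"
  shows "\<ominus>\<^bsub>laurent_ring J\<^esub> f = (\<lambda>j. - f j)"
proof -
  interpret R: cring "laurent_ring J :: ('k, 'n) series ring" by (rule laurent_ring_cring)
  show ?thesis
    by (rule R.minus_equality) (simp_all add: assms laurent_uminus)
qed

lemma laurent_finprod_closed:
  fixes f :: "'b \<Rightarrow> ('k::{nonarch_field,complete_space}, 'n) series"
  assumes "\<And>b. b \<in> F \<Longrightarrow> f b \<in> laurent_fun J"
  shows "(\<Otimes>\<^bsub>laurent_ring J\<^esub>b\<in>F. f b) \<in> laurent_fun J"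
proof -
  interpret R: cring "laurent_ring J :: ('k, 'n) series ring" by (rule laurent_ring_cring)
  show ?thesis using R.finprod_closed[of f F] assms by auto
qed

lemma laurent_finprod_insert:
  fixes f :: "'b \<Rightarrow> ('k::{nonarch_field,complete_space}, 'n) series"
  assumes "finite F" "b \<notin> F" "\<And>c. c \<in> insert b F \<Longrightarrow> f c \<in> laurent_fun J"
  shows "(\<Otimes>\<^bsub>laurent_ring J\<^esub>c\<in>insert b F. f c) =
    convolution (f b) (\<Otimes>\<^bsub>laurent_ring J\<^esub>c\<in>F. f c)"
proof -
  interpret R: cring "laurent_ring J :: ('k, 'n) series ring" by (rule laurent_ring_cring)
  show ?thesis using R.finprod_insert[of F b f] assms by auto
qed

lemma gauss_norm_monomial_le:
  assumes "f \<in> laurent_fun J" "\<rho> \<in> J"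
  shows "gauss_norm \<rho> (convolution (\<lambda>j. if j = m then c else 0) f)
    \<le> absval c * weight \<rho> m * gauss_norm \<rho> f"
proof -
  have "absval (c * f (j - m)) * weight \<rho> j \<le> absval c * weight \<rho> m * gauss_norm \<rho> f" for j
  proof -
    have "weight \<rho> j = weight \<rho> m * weight \<rho> (j - m)"
      using wadd[OF assms(2), of m "j - m"] by simp
    then have "absval (c * f (j - m)) * weight \<rho> j
        = absval c * weight \<rho> m * (absval (f (j - m)) * weight \<rho> (j - m))"
      by (simp add: absval_mult)
    also have "\<dots> \<le> absval c * weight \<rho> m * gauss_norm \<rho> f"
      using gauss_norm_upper[OF assms, of "j - m"] assms(2) by (intro mult_left_mono) simp_all
    finally show ?thesis .
  qed
  moreover have "(\<lambda>j. c * f (j - m)) \<in> laurent_fun J"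
    by (intro laurent_scale laurent_shift assms(1))
  ultimately show ?thesis
    unfolding convolution_monomial by (subst gauss_norm_le_iff) (simp_all add: assms(2))
qed

text \<open>Multiplication by c t^m carries coefficient j to j + m and scales its weighted size by
  |c| \<rho>^m, which is at least 1.\<close>

lemma gauss_norm_monomial_ge:
  assumes "f \<in> laurent_fun J" "\<rho> \<in> J" "1 \<le> absval c * weight \<rho> m"
  shows "gauss_norm \<rho> f \<le> gauss_norm \<rho> (convolution (\<lambda>j. if j = m then c else 0) f)"
  unfolding convolution_monomial gauss_norm_le_iff[OF assms(1,2)]
proof
  fix j
  let ?h = "\<lambda>j. c * f (j - m)"
  have "?h \<in> laurent_fun J" by (intro laurent_scale laurent_shift assms(1))
  from gauss_norm_upper[OF this assms(2), of "j + m"]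
  have "absval c * weight \<rho> m * (absval (f j) * weight \<rho> j) \<le> gauss_norm \<rho> ?h"
    by (simp add: absval_mult wadd[OF assms(2)] mult_ac)
  moreover have "1 * (absval (f j) * weight \<rho> j) \<le> absval c * weight \<rho> m * (absval (f j) * weight \<rho> j)"
    using assms(2,3) by (intro mult_right_mono) simp_all
  ultimately show "absval (f j) * weight \<rho> j \<le> gauss_norm \<rho> ?h" by simp
qed

lemma gauss_norm_finprod_monomials_ge:
  fixes f :: "('k::{nonarch_field,complete_space}, 'n) series"
  assumes "finite F" "f \<in> laurent_fun J" "\<rho> \<in> J" "\<And>b. b \<in> F \<Longrightarrow> 1 \<le> absval (c b) * weight \<rho> (m b)"
  shows "gauss_norm \<rho> f
    \<le> gauss_norm \<rho> (convolution (\<Otimes>\<^bsub>laurent_ring J\<^esub>b\<in>F. (\<lambda>j. if j = m b then c b else 0)) f)"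
  using assms(1,4)
proof (induction F)
  case empty
  interpret R: cring "laurent_ring J :: ('k, 'n) series ring" by (rule laurent_ring_cring)
  show ?case by (simp add: convolution_lmonom)
next
  case (insert b F)
  let ?u = "\<lambda>b j. if j = m b then c b else 0"
  let ?p = "\<Otimes>\<^bsub>laurent_ring J\<^esub>b\<in>F. ?u b"
  have u: "?u b \<in> laurent_fun J" for b by (rule monomial_closed)
  have p: "?p \<in> laurent_fun J" by (rule laurent_finprod_closed) (rule u)
  have "gauss_norm \<rho> f \<le> gauss_norm \<rho> (convolution ?p f)" by (rule insert.IH) (simp add: insert.prems)
  also have "\<dots> \<le> gauss_norm \<rho> (convolution (?u b) (convolution ?p f))"
    by (intro gauss_norm_monomial_ge laurent_convolution p assms(2,3)) (simp add: insert.prems)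
  also have "convolution (?u b) (convolution ?p f) = convolution (convolution (?u b) ?p) f"
    by (rule convolution_assoc[symmetric]) (rule u p assms(2))+
  also have "convolution (?u b) ?p = (\<Otimes>\<^bsub>laurent_ring J\<^esub>b\<in>insert b F. ?u b)"
    by (rule laurent_finprod_insert[symmetric]) (use insert.hyps u in auto)
  finally show ?case .
qed

text \<open>The twisted determinant is the old one times a sign and one monomial per column; each
  multiplication leaves the Gauss norm at least as large.\<close>

lemma gauss_norm_ring_det_twist_ge:
  fixes S :: "nat \<Rightarrow> nat \<Rightarrow> ('k::{nonarch_field,complete_space}, 'n) series"
  assumes S: "\<And>a b. a < r \<Longrightarrow> b < r \<Longrightarrow> S a b \<in> laurent_fun J" and \<tau>: "\<tau> permutes {..<r}"
    and \<rho>: "\<rho> \<in> J" and m: "\<And>b. b < r \<Longrightarrow> 1 \<le> absval (c b) * weight \<rho> (m b)"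
  shows "gauss_norm \<rho> (ring_det (laurent_ring J) r S) \<le> gauss_norm \<rho>
    (ring_det (laurent_ring J) r (\<lambda>a b. convolution (\<lambda>j. if j = m b then c b else 0) (S a (\<tau> b))))"
proof -
  interpret R: cring "laurent_ring J :: ('k, 'n) series ring" by (rule laurent_ring_cring)
  let ?R = "laurent_ring J :: ('k, 'n) series ring"
  let ?sg = "if evenperm \<tau> then \<one>\<^bsub>?R\<^esub> else \<ominus>\<^bsub>?R\<^esub> \<one>\<^bsub>?R\<^esub>" and ?d = "ring_det ?R r S"
  define s :: 'k where "s = (if evenperm \<tau> then 1 else - 1)"
  \<comment> \<open>Writing the sign as a constant monomial puts it under the same estimate as the
    other factors.\<close>
  have sg: "?sg = (\<lambda>j. if j = 0 then s else 0)"
    unfolding laurent_ring_simps laurent_a_inv[OF lmonom_closed[of 0]] by (auto simp: s_def lmonom_def)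
  have d: "?d \<in> laurent_fun J"
    using R.ring_det_closed[of r S] S by simp
  have w0: "weight \<rho> 0 = 1" by (simp add: weight_def)
  have "gauss_norm \<rho> ?d \<le> gauss_norm \<rho> (convolution ?sg ?d)"
    unfolding sg by (rule gauss_norm_monomial_ge[OF d \<rho>]) (simp add: s_def w0)
  also have "\<dots> \<le> gauss_norm \<rho> (convolution
      (\<Otimes>\<^bsub>laurent_ring J\<^esub>b\<in>{..<r}. (\<lambda>j. if j = m b then c b else 0)) (convolution ?sg ?d))"
    unfolding sg using m
    by (intro gauss_norm_finprod_monomials_ge laurent_convolution monomial_closed d \<rho>) simp_all
  also have "\<dots> = gauss_norm \<rho> (ring_det ?R r
      (\<lambda>a b. convolution (\<lambda>j. if j = m b then c b else 0) (S a (\<tau> b))))"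
    using R.ring_det_scale_permute_columns[of r S "\<lambda>b j. if j = m b then c b else 0" \<tau>] S \<tau>
    by (simp add: monomial_closed)
  finally show ?thesis .
qed

lemma lincomb_laurent:
  fixes e :: "nat \<Rightarrow> nat \<Rightarrow> ('k::{nonarch_field,complete_space}, 'n) series"
  assumes "\<And>b a. b < r \<Longrightarrow> a < r \<Longrightarrow> e b a \<in> laurent_fun J" "\<And>b. b < r \<Longrightarrow> c b \<in> laurent_fun J"
  shows "lincomb (laurent_ring J) r e c = (\<lambda>a\<in>{..<r}. \<lambda>j. \<Sum>b<r. convolution (c b) (e b a) j)"
  unfolding lincomb_def
  unfolding laurent_ring_simps
  by (intro restrict_ext laurent_finsum laurent_convolution assms) simp_all

lemma lincomb_laurent_closed:
  fixes e :: "nat \<Rightarrow> nat \<Rightarrow> ('k::{nonarch_field,complete_space}, 'n) series"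
  assumes "\<And>b a. b < r \<Longrightarrow> a < r \<Longrightarrow> e b a \<in> laurent_fun J" "\<And>b. b < r \<Longrightarrow> c b \<in> laurent_fun J"
  shows "lincomb (laurent_ring J) r e c \<in> free_module (laurent_ring J) r"
proof -
  have "(\<lambda>j. \<Sum>b<r. convolution (c b) (e b a) j) \<in> laurent_fun J" if "a < r" for a
    by (intro laurent_sum laurent_convolution assms that) simp_all
  then show ?thesis by (simp add: free_module_iff lincomb_laurent[OF assms])
qed

lemma lincomb_monomial:
  fixes e :: "nat \<Rightarrow> nat \<Rightarrow> ('k::{nonarch_field,complete_space}, 'n) series"
  assumes "\<And>b a. b < r \<Longrightarrow> a < r \<Longrightarrow> e b a \<in> laurent_fun J" "\<And>b. b < r \<Longrightarrow> x b \<in> laurent_fun J"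
  shows "lincomb (laurent_ring J) r e (\<lambda>b. convolution (\<lambda>j. if j = m then c else 0) (x b)) =
    vshift r m (vscale r c (lincomb (laurent_ring J) r e x))"
proof -
  have "(\<lambda>j. c * x b (j - m)) \<in> laurent_fun J" if "b < r" for b
    by (intro laurent_scale laurent_shift assms that)
  moreover have "convolution (\<lambda>j. c * f (j - m)) g j = c * convolution f g (j - m)"
    for f g :: "('k, 'n) series" and j
    using convolution_scale_right[of g c "\<lambda>j. f (j - m)"] convolution_shift_right[of g f m]
    by (simp add: convolution_commute[of _ g])
  ultimately show ?thesis
    unfolding convolution_monomial
    by (subst (1 2) lincomb_laurent)
       (auto simp: assms vshift_def vscale_def sum_distrib_left intro!: restrict_ext)
qed

end

section \<open>Sums, products, determinants and bases under restriction\<close>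

context
  fixes J J' :: "(real ^ 'n::finite) set"
  assumes J: "polyannulus J" "polyannulus J'" "J' \<subseteq> J"
begin

lemma laurent_fun_restrict: "f \<in> laurent_fun J \<Longrightarrow> f \<in> laurent_fun J'"
  using J(3) by (auto simp: laurent_fun_def)

text \<open>The addition is the same function, but \<open>finsum\<close> is a fold that depends on
  the carrier; both folds are identified with the coefficientwise sum.\<close>

lemma laurent_finsum_restrict:
  fixes f :: "'b \<Rightarrow> ('k::{nonarch_field,complete_space}, 'n) series"
  assumes "finite F" "\<And>b. b \<in> F \<Longrightarrow> f b \<in> laurent_fun J"
  shows "(\<Oplus>\<^bsub>laurent_ring J'\<^esub>b\<in>F. f b) = (\<Oplus>\<^bsub>laurent_ring J\<^esub>b\<in>F. f b)"
  using polyannulus.laurent_finsum[OF J(1) assms]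
    polyannulus.laurent_finsum[OF J(2) assms(1) laurent_fun_restrict[OF assms(2)]] by simp

lemma laurent_finprod_restrict:
  fixes f :: "'b \<Rightarrow> ('k::{nonarch_field,complete_space}, 'n) series"
  assumes "finite F" "\<And>b. b \<in> F \<Longrightarrow> f b \<in> laurent_fun J"
  shows "(\<Otimes>\<^bsub>laurent_ring J'\<^esub>b\<in>F. f b) = (\<Otimes>\<^bsub>laurent_ring J\<^esub>b\<in>F. f b)"
  using assms
proof (induction F)
  case empty
  interpret R: cring "laurent_ring J :: ('k, 'n) series ring"
    by (rule polyannulus.laurent_ring_cring[OF J(1)])
  interpret R': cring "laurent_ring J' :: ('k, 'n) series ring"
    by (rule polyannulus.laurent_ring_cring[OF J(2)])
  show ?case using R.finprod_empty R'.finprod_empty by simp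
next
  case (insert b F)
  have "(\<Otimes>\<^bsub>laurent_ring J'\<^esub>c\<in>F. f c) = (\<Otimes>\<^bsub>laurent_ring J\<^esub>c\<in>F. f c)"
    by (rule insert.IH) (simp add: insert.prems)
  then show ?case
    using polyannulus.laurent_finprod_insert[OF J(1) insert.hyps insert.prems]
      polyannulus.laurent_finprod_insert[OF J(2) insert.hyps laurent_fun_restrict[OF insert.prems]]
    by simp
qed

lemma ring_det_restrict:
  fixes S :: "nat \<Rightarrow> nat \<Rightarrow> ('k::{nonarch_field,complete_space}, 'n) series"
  assumes S: "\<And>a b. a < r \<Longrightarrow> b < r \<Longrightarrow> S a b \<in> laurent_fun J"
  shows "ring_det (laurent_ring J') r S = ring_det (laurent_ring J) r S"
proof -
  interpret J: polyannulus J by (rule J(1))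
  interpret J': polyannulus J' by (rule J(2))
  have S\<sigma>: "S a (\<sigma> a) \<in> laurent_fun J" if "\<sigma> permutes {..<r}" "a < r" for \<sigma> a
    using S that permutes_in_image[OF that(1), of a] by simp
  define sg where "sg \<sigma> = (if evenperm \<sigma> then lmonom 0 else (\<lambda>j. - lmonom 0 j) :: ('k, 'n) series)"
    for \<sigma> :: "nat \<Rightarrow> nat"
  have sg: "(if evenperm \<sigma> then \<one>\<^bsub>laurent_ring J\<^esub> else \<ominus>\<^bsub>laurent_ring J\<^esub> \<one>\<^bsub>laurent_ring J\<^esub>) = sg \<sigma>"
    "(if evenperm \<sigma> then \<one>\<^bsub>laurent_ring J'\<^esub> else \<ominus>\<^bsub>laurent_ring J'\<^esub> \<one>\<^bsub>laurent_ring J'\<^esub>) = sg \<sigma>" for \<sigma>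
    by (simp_all add: sg_def J.laurent_a_inv J.lmonom_closed J'.laurent_a_inv J'.lmonom_closed)
  let ?t = "\<lambda>\<sigma>. convolution (sg \<sigma>) (\<Otimes>\<^bsub>laurent_ring J\<^esub>a\<in>{..<r}. S a (\<sigma> a))"
  have t: "?t \<sigma> \<in> laurent_fun J" if "\<sigma> permutes {..<r}" for \<sigma>
    by (intro J.laurent_convolution J.laurent_finprod_closed S\<sigma> that)
       (simp_all add: sg_def J.lmonom_closed J.laurent_uminus)
  have "ring_det (laurent_ring J') r S = (\<Oplus>\<^bsub>laurent_ring J'\<^esub>\<sigma>\<in>{\<sigma>. \<sigma> permutes {..<r}}. ?t \<sigma>)"
    unfolding ring_det_def sg unfolding laurent_ring_simps
  proof (rule abelian_monoid.finsum_cong')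
    show "abelian_monoid (laurent_ring J' :: ('k, 'n) series ring)"
      using J'.laurent_ring_cring by (meson cring.axioms(1) ring.is_abelian_group abelian_group_def)
    fix \<sigma> assume "\<sigma> \<in> {\<sigma>. \<sigma> permutes {..<r}}"
    then have "(\<Otimes>\<^bsub>laurent_ring J'\<^esub>a\<in>{..<r}. S a (\<sigma> a)) = (\<Otimes>\<^bsub>laurent_ring J\<^esub>a\<in>{..<r}. S a (\<sigma> a))"
      by (intro laurent_finprod_restrict S\<sigma>) simp_all
    then show "convolution (sg \<sigma>) (\<Otimes>\<^bsub>laurent_ring J'\<^esub>a\<in>{..<r}. S a (\<sigma> a)) = ?t \<sigma>" by simp
  qed (use t in \<open>auto intro: laurent_fun_restrict\<close>)
  also have "\<dots> = (\<Oplus>\<^bsub>laurent_ring J\<^esub>\<sigma>\<in>{\<sigma>. \<sigma> permutes {..<r}}. ?t \<sigma>)"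
    by (intro laurent_finsum_restrict t) (simp_all add: finite_permutations)
  also have "\<dots> = ring_det (laurent_ring J) r S"
    unfolding ring_det_def sg unfolding laurent_ring_simps ..
  finally show ?thesis .
qed

text \<open>Existence and uniqueness of coordinates do not pass directly to a larger ring, but the
  inverse matrix and its two identities do.\<close>

lemma module_basis_restrict:
  fixes e :: "nat \<Rightarrow> nat \<Rightarrow> ('k::{nonarch_field,complete_space}, 'n) series"
  assumes e: "module_basis (laurent_ring J) r e"
  shows "module_basis (laurent_ring J') r e"
proof -
  interpret J: polyannulus J by (rule J(1))
  interpret J': polyannulus J' by (rule J(2))
  interpret R: cring "laurent_ring J :: ('k, 'n) series ring" by (rule J.laurent_ring_cring)
  interpret R': cring "laurent_ring J' :: ('k, 'n) series ring" by (rule J'.laurent_ring_cring)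
  obtain C where C: "\<And>b a. b < r \<Longrightarrow> a < r \<Longrightarrow> C b a \<in> laurent_fun J"
    and 1: "\<And>b a. b < r \<Longrightarrow> a < r \<Longrightarrow> (\<Oplus>\<^bsub>laurent_ring J\<^esub>d\<in>{..<r}. convolution (C b d) (e d a)) =
      (if a = b then lmonom 0 else (\<lambda>j. 0))"
    and 2: "\<And>b a. b < r \<Longrightarrow> a < r \<Longrightarrow> (\<Oplus>\<^bsub>laurent_ring J\<^esub>d\<in>{..<r}. convolution (e b d) (C d a)) =
      (if a = b then lmonom 0 else (\<lambda>j. 0))"
    using R.module_basis_inverse[OF e] unfolding laurent_ring_simps by blast
  have eP: "e b \<in> free_module (laurent_ring J) r" if "b < r" for b
    using e that by (simp add: module_basis_def)
  then have ec: "e b a \<in> laurent_fun J" if "b < r" "a < r" for a b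
    using that by (simp add: free_module_iff)
  show ?thesis
  proof (rule R'.module_basis_if_inverse[where C = C])
    show "e b \<in> free_module (laurent_ring J') r" if "b < r" for b
      using eP[OF that] by (simp add: free_module_iff laurent_fun_restrict)
    show "C b a \<in> carrier (laurent_ring J')" if "b < r" "a < r" for a b
      using laurent_fun_restrict[OF C[OF that]] by simp
    show "(\<Oplus>\<^bsub>laurent_ring J'\<^esub>d\<in>{..<r}. C b d \<otimes>\<^bsub>laurent_ring J'\<^esub> e d a) =
        (if a = b then \<one>\<^bsub>laurent_ring J'\<^esub> else \<zero>\<^bsub>laurent_ring J'\<^esub>)" if "b < r" "a < r" for a b
      unfolding laurent_ring_simps 1[OF that, symmetric]
      by (intro laurent_finsum_restrict J.laurent_convolution C ec that) simp_all
    show "(\<Oplus>\<^bsub>laurent_ring J'\<^esub>d\<in>{..<r}. e b d \<otimes>\<^bsub>laurent_ring J'\<^esub> C d a) =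
        (if a = b then \<one>\<^bsub>laurent_ring J'\<^esub> else \<zero>\<^bsub>laurent_ring J'\<^esub>)" if "b < r" "a < r" for a b
      unfolding laurent_ring_simps 2[OF that, symmetric]
      by (intro laurent_finsum_restrict J.laurent_convolution C ec that) simp_all
  qed
qed

end

section \<open>Size of monomials on a compact box, and the integer twists\<close>

lemma weight_exp:
  fixes \<rho> :: "real ^ 'n::finite" and m :: "int ^ 'n"
  assumes "\<And>i. 0 < \<rho> $ i"
  shows "weight \<rho> m = exp (\<Sum>i\<in>UNIV. real_of_int (m $ i) * ln (\<rho> $ i))"
proof -
  have "\<rho> $ i powi (m $ i) = exp (real_of_int (m $ i) * ln (\<rho> $ i))" for i
    using powr_real_of_int'[of "\<rho> $ i" "m $ i"] assms[of i] by (simp add: powr_def)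
  then show ?thesis by (simp add: weight_def exp_sum)
qed

lemma weight_bounds:
  fixes \<rho> :: "real ^ 'n::finite" and m :: "int ^ 'n"
  assumes "\<And>i. 0 < \<rho> $ i" "\<And>i. \<bar>ln (\<rho> $ i)\<bar> \<le> \<Lambda>" "\<And>i. \<bar>real_of_int (m $ i)\<bar> \<le> L"
  shows "exp (- (real CARD('n) * L * \<Lambda>)) \<le> weight \<rho> m" "weight \<rho> m \<le> exp (real CARD('n) * L * \<Lambda>)"
proof -
  have "\<bar>real_of_int (m $ i) * ln (\<rho> $ i)\<bar> \<le> L * \<Lambda>" for i
    unfolding abs_mult using assms(2)[of i] assms(3)[of i] by (intro mult_mono) auto
  then have "\<bar>\<Sum>i\<in>UNIV. real_of_int (m $ i) * ln (\<rho> $ i)\<bar> \<le> (\<Sum>i\<in>(UNIV::'n set). L * \<Lambda>)"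
    by (intro order_trans[OF sum_abs] sum_mono)
  then have "\<bar>\<Sum>i\<in>UNIV. real_of_int (m $ i) * ln (\<rho> $ i)\<bar> \<le> real CARD('n) * L * \<Lambda>" by simp
  then show "exp (- (real CARD('n) * L * \<Lambda>)) \<le> weight \<rho> m" "weight \<rho> m \<le> exp (real CARD('n) * L * \<Lambda>)"
    unfolding weight_exp[OF assms(1)] by simp_all
qed

text \<open>A closed box inside the interior stays away from 0 and from infinity, so the logarithms
  of its radii are bounded by one constant.\<close>

lemma compact_box_in_polysegment:
  fixes J :: "(real ^ 'n::finite) set"
  assumes "interior J \<noteq> {}" and pos: "\<And>\<rho> i. \<rho> \<in> J \<Longrightarrow> 0 < \<rho> $ i"
  obtains J' :: "(real ^ 'n) set" and \<Lambda> where "J' \<subseteq> J" "polysegment J'" "interior J' \<noteq> {}"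
    "\<And>\<rho> i. \<rho> \<in> J' \<Longrightarrow> \<bar>ln (\<rho> $ i)\<bar> \<le> \<Lambda>"
proof -
  obtain x where "x \<in> interior J" using assms(1) by blast
  then obtain a b where ab: "x \<in> box a b" "cbox a b \<subseteq> interior J"
    by (rule open_contains_cbox[OF open_interior])
  have sub: "cbox a b \<subseteq> J" by (rule subset_trans[OF ab(2) interior_subset])
  have "x \<in> cbox a b" using ab(1) box_subset_cbox by blast
  then have le: "a $ i \<le> b $ i" for i by (meson mem_box_cart(2) order_trans)
  then have "a \<in> cbox a b" by (simp add: mem_box_cart)
  then have a: "0 < a $ i" for i using sub pos by blast
  define \<Lambda> where "\<Lambda> = (\<Sum>i\<in>UNIV. \<bar>ln (a $ i)\<bar> + \<bar>ln (b $ i)\<bar>)"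
  show ?thesis
  proof (rule that[of "cbox a b" \<Lambda>])
    have "cbox a b = {\<rho>. \<forall>i. \<rho> $ i \<in> {a $ i..b $ i}}" by (auto simp: mem_box_cart)
    moreover have "is_interval {a $ i..b $ i} \<and> {a $ i..b $ i} \<subseteq> {0<..}" for i
      using a[of i] by (auto simp: is_interval_cc)
    ultimately show "polysegment (cbox a b)"
      unfolding polysegment_def by (intro exI[of _ "\<lambda>i. {a $ i..b $ i}"]) simp
    show "interior (cbox a b) \<noteq> {}" using ab(1) by (auto simp: interior_cbox)
    fix \<rho> i assume \<rho>: "\<rho> \<in> cbox a b"
    then have "a $ i \<le> \<rho> $ i" "\<rho> $ i \<le> b $ i" by (auto simp: mem_box_cart)
    then have "ln (a $ i) \<le> ln (\<rho> $ i)" "ln (\<rho> $ i) \<le> ln (b $ i)"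
      using a[of i] by (auto intro!: ln_mono)
    then have "\<bar>ln (\<rho> $ i)\<bar> \<le> \<bar>ln (a $ i)\<bar> + \<bar>ln (b $ i)\<bar>" by linarith
    also have "\<dots> \<le> \<Lambda>" unfolding \<Lambda>_def by (rule member_le_sum) auto
    finally show "\<bar>ln (\<rho> $ i)\<bar> \<le> \<Lambda>" .
  qed (rule sub)
qed

lemma weakly_equivalent_twists:
  fixes A B :: "nat \<Rightarrow> 'k::{nonarch_field,field_char_0} ^ 'n::finite"
  assumes p: "prime p" "absval (of_nat p :: 'k) < 1"
    and A: "\<And>j i. j < r \<Longrightarrow> A j $ i \<in> Zp" and B: "\<And>j i. j < r \<Longrightarrow> B j $ i \<in> Zp"
    and AB: "weakly_equivalent p r A B"
  obtains c and \<sigma> :: "nat \<Rightarrow> nat \<Rightarrow> nat" and m :: "nat \<Rightarrow> nat \<Rightarrow> int ^ 'n"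
  where "c > 0" "\<And>h. h \<ge> 1 \<Longrightarrow> \<sigma> h permutes {..<r}"
    "\<And>h j i. h \<ge> 1 \<Longrightarrow> j < r \<Longrightarrow> \<bar>real_of_int (m h j $ i)\<bar> \<le> c * real h"
    "\<And>h j i. h \<ge> 1 \<Longrightarrow> j < r \<Longrightarrow> A (\<sigma> h j) $ i + of_int (m h j $ i) - B j $ i \<in> pow_Zp p h"
proof -
  obtain c \<sigma> where c: "c > 0" and \<sigma>: "\<And>h. h \<ge> 1 \<Longrightarrow> \<sigma> h permutes {..<r}"
    and angle: "\<And>h j i. h \<ge> 1 \<Longrightarrow> j < r \<Longrightarrow> real (angle p h (A (\<sigma> h j) $ i - B j $ i)) \<le> c * real h"
    using AB unfolding weakly_equivalent_def by blast
  have "\<exists>z. \<bar>real_of_int z\<bar> \<le> c * real h \<and> A (\<sigma> h j) $ i + of_int z - B j $ i \<in> pow_Zp p h"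
    if h: "h \<ge> 1" "j < r" for h j i
  proof -
    have "\<sigma> h j < r" using permutes_in_image[OF \<sigma>[OF h(1)], of j] h(2) by simp
    then have "A (\<sigma> h j) $ i - B j $ i \<in> Zp" by (intro Zp_diff A B h(2))
    from angle_witness[OF p this]
    obtain z where z: "\<bar>z\<bar> = int (angle p h (A (\<sigma> h j) $ i - B j $ i))"
      "A (\<sigma> h j) $ i - B j $ i - of_int z \<in> pow_Zp p h" .
    have "\<bar>real_of_int z\<bar> = real (angle p h (A (\<sigma> h j) $ i - B j $ i))"
      using arg_cong[OF z(1), of real_of_int] by simp
    then show ?thesis
      \<comment> \<open>The sign changes because z measures A - B while the twist has to move A to
        B.\<close>
      using angle[OF h, of i] z(2) by (intro exI[of _ "- z"]) (simp add: algebra_simps)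
  qed
  then obtain z where z: "\<And>h j i. h \<ge> 1 \<Longrightarrow> j < r \<Longrightarrow> \<bar>real_of_int (z h j i)\<bar> \<le> c * real h"
    "\<And>h j i. h \<ge> 1 \<Longrightarrow> j < r \<Longrightarrow> A (\<sigma> h j) $ i + of_int (z h j i) - B j $ i \<in> pow_Zp p h"
    by metis
  show ?thesis
    by (rule that[of c \<sigma> "\<lambda>h j. \<chi> i. z h j i"]) (simp_all add: c \<sigma> z)
qed

text \<open>\<omega> is the value of the old character at \<zeta>. The eigenvector equation is
  restricted to J', scaled by c and shifted by m; only the shift alters the eigenvalue, since c is a
  constant.\<close>

lemma zeta_action_twist:
  fixes J J' :: "(real ^ 'n::{finite,linorder}) set"
    and D :: "'n \<Rightarrow> (nat \<Rightarrow> ('k::{nonarch_field,field_char_0,complete_space}, 'n) series) \<Rightarrow> (nat \<Rightarrow> ('k, 'n) series)"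
    and \<iota> :: "'k \<Rightarrow> 'l::nonarch_field" and \<zeta> :: "('l, 'n) vec" and m :: "(int, 'n) vec" and c :: 'k
  assumes J: "polyannulus J" "polyannulus J'" "J' \<subseteq> J"
    and G: "\<And>i b a. b < r \<Longrightarrow> a < r \<Longrightarrow> D i (unit_vector (laurent_ring I) r b) a \<in> laurent_fun J"
    and \<iota>: "\<And>x y. \<iota> (x + y) = \<iota> x + \<iota> y" "\<And>x y. \<iota> (x * y) = \<iota> x * \<iota> y"
      "\<And>x. absval (\<iota> x) = absval x"
    and \<zeta>: "\<And>i. absval (\<zeta> $ i) = 1" "\<And>i. absval (\<zeta> $ i - 1) < 1"
    and e: "\<And>b a. b < r \<Longrightarrow> a < r \<Longrightarrow> e b a \<in> laurent_fun J"
    and x: "\<And>b. b < r \<Longrightarrow> x b \<in> laurent_fun J"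
    and z: "zeta_action \<iota> J r (restrict_conn I J r D) \<zeta> (lincomb (laurent_ring J) r e x)
      (\<lambda>a j. \<omega> * \<iota> (lincomb (laurent_ring J) r e x a j))"
  defines "v \<equiv> lincomb (laurent_ring J') r e (\<lambda>b. convolution (\<lambda>j. if j = m then c else 0) (x b))"
  shows "zeta_action \<iota> J' r (restrict_conn I J' r D) \<zeta> v
      (\<lambda>a j. (\<Prod>i\<in>UNIV. \<zeta> $ i powi (m $ i)) * \<omega> * \<iota> (v a j))"
proof -
  interpret J: polyannulus J by (rule J(1))
  interpret J': polyannulus J' by (rule J(2))
  let ?D = "restrict_conn I J' r D"
  let ?T = "\<lambda>i y. \<lambda>a\<in>{..<r}. lmonom (axis i 1) \<otimes>\<^bsub>laurent_ring J'\<^esub> ?D i y a"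
  interpret E: euler_operators r "free_module (laurent_ring J') r" ?T
    by (rule euler_operators_restrict_conn[OF J(2)]) (rule laurent_fun_restrict[OF J G])
  interpret Z: zeta_setting J' r ?T ?D \<iota> \<zeta>
    by unfold_locales (simp_all only: \<iota> \<zeta>)
  let ?v = "lincomb (laurent_ring J) r e x"
  note eJ' = laurent_fun_restrict[OF J e] and xJ' = laurent_fun_restrict[OF J x]
  have v0: "?v = lincomb (laurent_ring J') r e x"
    using J.lincomb_laurent[of r e x, OF e x] J'.lincomb_laurent[of r e x, OF eJ' xJ'] by simp
  have vJ: "?v \<in> free_module (laurent_ring J) r" by (rule J.lincomb_laurent_closed[OF e x])
  have vJ': "?v \<in> free_module (laurent_ring J') r"
    unfolding v0 by (rule J'.lincomb_laurent_closed[OF eJ' xJ'])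
  have v: "v = vshift r m (vscale r c ?v)"
    unfolding v_def v0 by (rule J'.lincomb_monomial[OF eJ' xJ'])
  have "zeta_action \<iota> J' r ?D \<zeta> ?v (\<lambda>a j. \<omega> * \<iota> (?v a j))"
    by (rule zeta_action_restrict[OF J _ vJ z]) (rule G)
  from Z.zeta_action_shift[OF E.vscale_closed[OF vJ'] Z.zeta_action_scale[OF vJ' this], of m c]
  have "zeta_action \<iota> J' r ?D \<zeta> v
      (\<lambda>a j. (\<Prod>i\<in>UNIV. \<zeta> $ i powi (m $ i)) * (\<iota> c * (\<omega> * \<iota> (?v a (j - m)))))"
    unfolding v .
  then show ?thesis
    by (rule iffD1[OF Z.zeta_action_cong, rotated])
       (simp add: v vshift_apply vscale_apply \<iota>(2))
qed

lemma exponent_free_gauss_norm_le: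
  assumes "(SUP b\<in>{..<r}. SUP c\<in>{..<r}. gauss_norm_on J (S b c)) \<le> ereal K"
    and "b < r" "c < r" "\<rho> \<in> J"
  shows "gauss_norm \<rho> (S b c) \<le> K"
proof -
  have "ereal (gauss_norm \<rho> (S b c)) \<le> gauss_norm_on J (S b c)"
    unfolding gauss_norm_on_def by (rule SUP_upper[OF assms(4)])
  also have "\<dots> \<le> (SUP c\<in>{..<r}. gauss_norm_on J (S b c))"
    by (rule SUP_upper) (simp add: assms(3))
  also have "\<dots> \<le> (SUP b\<in>{..<r}. SUP c\<in>{..<r}. gauss_norm_on J (S b c))"
    by (rule SUP_upper) (simp add: assms(2))
  also note assms(1)
  finally show ?thesis by simp
qed

text \<open>Here q is to be 1 / |p| and w the weight of a twisting monomial, confined between exp(-E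
  k) and exp(E k). The power q^(N k) must outweigh the smallest weight and still grow only
  exponentially in k.\<close>

lemma power_scalar_bounds:
  fixes q E :: real
  assumes "1 < q" "1 < P"
  obtains N :: nat and l where "l > 0" "\<And>k w. exp (- (E * real k)) \<le> w \<Longrightarrow> 1 \<le> q ^ (N * k) * w"
    "\<And>k w. w \<le> exp (E * real k) \<Longrightarrow> q ^ (N * k) * w \<le> P powr (l * real k)"
proof -
  obtain N where N: "exp \<bar>E\<bar> < q ^ N" using real_arch_pow[OF assms(1)] by blast
  have Nk: "exp (E * real k) \<le> q ^ (N * k)" for k
  proof -
    have "E * real k \<le> \<bar>E\<bar> * real k" by (intro mult_right_mono) simp_all
    then have "exp (E * real k) \<le> exp \<bar>E\<bar> ^ k"
      by (simp add: mult.commute flip: exp_of_nat_mult)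
    also have "\<dots> \<le> (q ^ N) ^ k" using N by (intro power_mono) simp_all
    finally show ?thesis by (simp add: power_mult)
  qed
  \<comment> \<open>Both q^(N k) and the largest weight are at most q^(N k), which accounts for 2 N;
    the logarithm converts base q to base P, and the 1 gives positivity at once.\<close>
  define l where "l = 2 * real N * log P q + 1"
  have l0: "log P q > 0" using assms by simp
  have qP: "q ^ i = P powr (real i * log P q)" for i :: nat
  proof -
    have "q = P powr log P q" using assms by simp
    then have "q ^ i = (P powr log P q) powr real i" using assms by (simp add: powr_realpow)
    then show ?thesis by (simp add: powr_powr mult.commute)
  qed
  show ?thesis
  proof (rule that[of l N])
    show "l > 0" unfolding l_def using l0 by (intro add_nonneg_pos mult_nonneg_nonneg) simp_all
    show "1 \<le> q ^ (N * k) * w" if "exp (- (E * real k)) \<le> w" for k w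
    proof -
      have "1 = exp (E * real k) * exp (- (E * real k))" by (simp flip: exp_add)
      also have "\<dots> \<le> q ^ (N * k) * w" using Nk[of k] that assms by (intro mult_mono) simp_all
      finally show ?thesis .
    qed
    show "q ^ (N * k) * w \<le> P powr (l * real k)" if "w \<le> exp (E * real k)" for k w
    proof -
      have "q ^ (N * k) * w \<le> q ^ (N * k) * q ^ (N * k)"
        using Nk[of k] that assms by (intro mult_left_mono) simp_all
      also have "\<dots> = P powr (real (N * k + N * k) * log P q)"
        unfolding power_add[symmetric] by (rule qP)
      also have "\<dots> \<le> P powr (l * real k)"
        using assms by (intro powr_mono) (simp_all add: l_def algebra_simps)
      finally show ?thesis .
    qed
  qed
qed

theorem propositionA3:
  fixes p r :: nat
    and \<iota> :: "'k::{nonarch_field,field_char_0,complete_space} \<Rightarrow> 'l::{nonarch_field,alg_closed_field}"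
    and \<alpha> \<beta> :: "ereal ^ 'n::{finite,linorder}"
    and D :: "'n \<Rightarrow> (nat \<Rightarrow> ('k, 'n) series) \<Rightarrow> (nat \<Rightarrow> ('k, 'n) series)"
    and A B :: "nat \<Rightarrow> 'k ^ 'n::{finite,linorder}"
  defines "I \<equiv> open_polysegment \<alpha> \<beta>"
  assumes "prime p" and "absval (of_nat p :: 'k) < 1"
    and "algebraic_closure_map \<iota>"
    and "\<And>i. 0 \<le> \<alpha> $ i" and "\<And>i. \<alpha> $ i < \<beta> $ i"
    and "integrable_connection I r D"
    and "robba_condition I r D"
    and "exponent p \<iota> I r D A"
    and "\<And>j i. j < r \<Longrightarrow> B j $ i \<in> Zp"
    and "weakly_equivalent p r A B"
  shows "exponent p \<iota> I r D B"
proof -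
  note p = \<open>prime p\<close> \<open>absval (of_nat p :: 'k) < 1\<close>
  have I_pos: "0 < \<rho> $ i" if "\<rho> \<in> I" for \<rho> :: "(real, 'n) vec" and i
  proof -
    have "0 \<le> \<alpha> $ i" "\<alpha> $ i < ereal (\<rho> $ i)" using assms(5) that by (auto simp: I_def open_polysegment_def)
    then have "0 < ereal (\<rho> $ i)" by (rule le_less_trans)
    then show ?thesis by simp
  qed
  obtain J :: "((real, 'n) vec) set" where J: "polysegment J" "J \<subseteq> I" "interior J \<noteq> {}"
    and free: "exponent_free p \<iota> J r (restrict_conn I J r D) A"
    using \<open>exponent p \<iota> I r D A\<close> unfolding exponent_def by blast
  from free obtain e S l where A: "\<forall>c<r. \<forall>i. A c $ i \<in> Zp"
    and e: "module_basis (laurent_ring J) r e"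
    and S: "\<forall>k\<ge>1. \<forall>b<r. \<forall>c<r. S k b c \<in> laurent_fun J"
    and zeta: "\<forall>k\<ge>1. \<forall>\<zeta>. (\<forall>i. (\<zeta> $ i) ^ (p ^ k) = 1) \<longrightarrow>
      (\<forall>c<r. zeta_action \<iota> J r (restrict_conn I J r D) \<zeta> (lincomb (laurent_ring J) r e (\<lambda>b. S k b c))
        (\<lambda>a j. (\<Prod>i\<in>UNIV. root_pow p (\<zeta> $ i) (A c $ i)) *
          \<iota> (lincomb (laurent_ring J) r e (\<lambda>b. S k b c) a j)))"
    and l: "l > 0" "\<forall>k\<ge>1. (SUP b\<in>{..<r}. SUP c\<in>{..<r}. gauss_norm_on J (S k b c))
        \<le> ereal (real p powr (l * real k))"
    and det: "\<forall>k\<ge>1. \<forall>\<rho>\<in>J. 1 \<le> gauss_norm \<rho> (ring_det (laurent_ring J) r (S k))"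
    unfolding exponent_free_def Let_def laurent_ring_simps by (elim conjE exE)
  note A = A[rule_format] and S = S[rule_format] and zeta = zeta[rule_format] and l = l[rule_format]
    and det = det[rule_format]
  have J_pos: "0 < \<rho> $ i" if "\<rho> \<in> J" for \<rho> :: "(real, 'n) vec" and i using I_pos J(2) that by blast
  obtain J' :: "((real, 'n) vec) set" and \<Lambda> where J': "J' \<subseteq> J" "polysegment J'" "interior J' \<noteq> {}"
    and \<Lambda>: "\<And>\<rho> i. \<rho> \<in> J' \<Longrightarrow> \<bar>ln (\<rho> $ i)\<bar> \<le> \<Lambda>"
    by (rule compact_box_in_polysegment[OF J(3)], erule J_pos, rule that)
  have J'_pos: "0 < \<rho> $ i" if "\<rho> \<in> J'" for \<rho> :: "(real, 'n) vec" and i using J_pos J'(1) that by blast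
  have "J' \<noteq> {}" "J \<noteq> {}" "I \<noteq> {}" using J'(1,3) J(2) interior_subset by auto
  then interpret I: polyannulus I + J: polyannulus J + J': polyannulus J'
    using I_pos J_pos J'_pos by unfold_locales auto
  note JJ' = J.polyannulus_axioms J'.polyannulus_axioms J'(1)

  \<comment> \<open>The entries of the connection matrix are defined over I, hence over J; this is
    what the results on Euler operators require.\<close>
  have G: "D i (unit_vector (laurent_ring I) r b) a \<in> laurent_fun J" if "a < r" for i b a
  proof -
    have "unit_vector (laurent_ring I) r b \<in> free_module (laurent_ring I) r"
      by (auto simp: free_module_iff unit_vector_def I.lmonom_closed intro!: I.laurent_finite_support)
    then have "D i (unit_vector (laurent_ring I) r b) \<in> free_module (laurent_ring I) r"
      using \<open>integrable_connection I r D\<close> unfolding integrable_connection_def Let_def by blast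
    then show ?thesis
      using that
      by (intro laurent_fun_restrict[OF I.polyannulus_axioms J.polyannulus_axioms J(2)])
         (simp add: free_module_iff)
  qed
  have e_closed: "e b a \<in> laurent_fun J" if "b < r" "a < r" for a b
    using e that by (simp add: module_basis_def free_module_iff)
  have \<iota>: "\<And>x y. \<iota> (x + y) = \<iota> x + \<iota> y" "\<And>x y. \<iota> (x * y) = \<iota> x * \<iota> y"
      "\<And>x. absval (\<iota> x) = absval x" "\<iota> 1 = 1"
    using \<open>algebraic_closure_map \<iota>\<close> by (auto simp: algebraic_closure_map_def)
  \<comment> \<open>Transfers |p| < 1 to the algebraic closure, where the roots of unity live and
    |\<zeta> - 1| < 1 is to be shown.\<close>
  have "\<iota> (of_nat n) = of_nat n" for n
  proof (induction n)
    case 0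
    show ?case using \<iota>(3)[of 0] by simp
  qed (simp add: \<iota>)
  then have p': "absval (of_nat p :: 'l) < 1" using \<iota>(3)[of "of_nat p"] p(2) by simp

  obtain C and \<sigma> :: "nat \<Rightarrow> nat \<Rightarrow> nat" and m :: "nat \<Rightarrow> nat \<Rightarrow> (int, 'n) vec" where "C > 0"
    and \<sigma>: "\<And>h. h \<ge> 1 \<Longrightarrow> \<sigma> h permutes {..<r}"
    and m: "\<And>h j i. h \<ge> 1 \<Longrightarrow> j < r \<Longrightarrow> \<bar>real_of_int (m h j $ i)\<bar> \<le> C * real h"
    and AB: "\<And>h j i. h \<ge> 1 \<Longrightarrow> j < r \<Longrightarrow> A (\<sigma> h j) $ i + of_int (m h j $ i) - B j $ i \<in> pow_Zp p h"
    by (rule weakly_equivalent_twists[OF p _ _ \<open>weakly_equivalent p r A B\<close>], erule A, erule assms(10), rule that)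
  have \<sigma>_less: "\<sigma> k c < r" if "k \<ge> 1" "c < r" for k c
    using permutes_in_image[OF \<sigma>[OF that(1)], of c] that(2) by simp

  \<comment> \<open>The exponent in \<open>weight_bounds\<close> for entries of m of size at most C
    k, divided by k.\<close>
  define E where "E = real CARD('n) * C * \<Lambda>"
  have weight: "exp (- (E * real k)) \<le> weight \<rho> (m k c)" "weight \<rho> (m k c) \<le> exp (E * real k)"
    if "k \<ge> 1" "c < r" "\<rho> \<in> J'" for k c \<rho>
    using weight_bounds[of \<rho> \<Lambda> "m k c" "C * real k", OF J'_pos \<Lambda> m] that
    by (simp_all add: E_def mult_ac)
  define q where "q = inverse (absval (of_nat p :: 'k))"
  have q: "1 < q"
    using p prime_gt_0_nat[OF p(1)] by (simp add: q_def one_less_inverse_iff)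
  have p1: "1 < real p" using prime_gt_1_nat[OF p(1)] by simp
  obtain N l' where l': "l' > 0"
    and scalar: "\<And>k w. exp (- (E * real k)) \<le> w \<Longrightarrow> 1 \<le> q ^ (N * k) * w"
      "\<And>k w. w \<le> exp (E * real k) \<Longrightarrow> q ^ (N * k) * w \<le> real p powr (l' * real k)"
    by (rule power_scalar_bounds[OF q p1]) (rule that)
  \<comment> \<open>The same scalar p^(-N k) for all columns; its absolute value is q^(N k).\<close>
  define \<kappa> :: "nat \<Rightarrow> 'k" where "\<kappa> k = inverse (of_nat p) ^ (N * k)" for k
  have \<kappa>: "absval (\<kappa> k) = q ^ (N * k)" for k
    by (simp add: \<kappa>_def q_def absval_power absval_inverse)
  define S' where "S' k b c = convolution (\<lambda>j. if j = m k c then \<kappa> k else 0) (S k b (\<sigma> k c))" for k b c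
  have S_J': "S k b c \<in> laurent_fun J'" if "k \<ge> 1" "b < r" "c < r" for k b c
    by (rule laurent_fun_restrict[OF JJ' S[OF that]])

  have "S' k b c \<in> carrier (laurent_ring J')" if "k \<ge> 1" "b < r" "c < r" for k b c
    unfolding S'_def laurent_ring_simps
    by (intro J'.laurent_convolution J'.monomial_closed S_J' \<sigma>_less that)
  moreover have "zeta_action \<iota> J' r (restrict_conn I J' r D) \<zeta>
      (lincomb (laurent_ring J') r e (\<lambda>b. S' k b c))
      (\<lambda>a j. (\<Prod>i\<in>UNIV. root_pow p (\<zeta> $ i) (B c $ i)) *
        \<iota> (lincomb (laurent_ring J') r e (\<lambda>b. S' k b c) a j))"
    if k: "k \<ge> 1" and \<zeta>: "\<forall>i. (\<zeta> $ i) ^ (p ^ k) = 1" and c: "c < r"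
    for k c and \<zeta> :: "('l, 'n) vec"
  proof -
    \<comment> \<open>The congruence modulo p^k is precisely enough, because \<zeta> ranges over
      p^k-th roots of unity.\<close>
    have "\<zeta> $ i powi (m k c $ i) * root_pow p (\<zeta> $ i) (A (\<sigma> k c) $ i) = root_pow p (\<zeta> $ i) (B c $ i)" for i
      by (rule root_pow_shift[OF p A[OF \<sigma>_less[OF k c]] AB[OF k c]]) (simp add: \<zeta>)
    then have \<omega>: "(\<Prod>i\<in>UNIV. \<zeta> $ i powi (m k c $ i)) * (\<Prod>i\<in>UNIV. root_pow p (\<zeta> $ i) (A (\<sigma> k c) $ i))
        = (\<Prod>i\<in>UNIV. root_pow p (\<zeta> $ i) (B c $ i))"
      by (simp flip: prod.distrib)
    show ?thesis
      unfolding S'_def \<omega>[symmetric]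
    proof (rule zeta_action_twist[OF JJ' _ \<iota>(1-3) _ _ e_closed])
      show "absval (\<zeta> $ i) = 1" for i
        using absval_root_of_unity[of "\<zeta> $ i" "p ^ k"] \<zeta> prime_gt_0_nat[OF p(1)] by simp
      show "absval (\<zeta> $ i - 1) < 1" for i
        by (rule absval_root_of_unity_diff_one[OF p(1) p']) (use \<zeta> in blast)
      show "S k b (\<sigma> k c) \<in> laurent_fun J" if "b < r" for b
        by (rule S[OF k that \<sigma>_less[OF k c]])
    qed (simp_all add: G zeta[OF k spec[OF \<zeta>] \<sigma>_less[OF k c]])
  qed
  moreover have "(SUP b\<in>{..<r}. SUP c\<in>{..<r}. gauss_norm_on J' (S' k b c)) \<le> ereal (real p powr ((l + l') * real k))"
    if k: "k \<ge> 1" for k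
  proof (intro SUP_least)
    fix b c assume bc: "b \<in> {..<r}" "c \<in> {..<r}"
    show "gauss_norm_on J' (S' k b c) \<le> ereal (real p powr ((l + l') * real k))"
      unfolding gauss_norm_on_def
    proof (intro SUP_least, unfold ereal_less_eq)
      fix \<rho> assume \<rho>: "\<rho> \<in> J'"
      have Sn: "gauss_norm \<rho> (S k b (\<sigma> k c)) \<le> real p powr (l * real k)"
        by (rule exponent_free_gauss_norm_le[where S = "S k", OF l(2)[OF k]])
           (use bc k \<rho> J'(1) \<sigma>_less in auto)
      have "gauss_norm \<rho> (S' k b c) \<le> absval (\<kappa> k) * weight \<rho> (m k c) * gauss_norm \<rho> (S k b (\<sigma> k c))"
        unfolding S'_def by (rule J'.gauss_norm_monomial_le) (use bc k \<rho> S_J' \<sigma>_less in auto)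
      \<comment> \<open>The twist contributes l' and the old matrix l; the exponents add up to the
        new growth rate.\<close>
      also have "\<dots> \<le> real p powr (l' * real k) * real p powr (l * real k)"
        unfolding \<kappa> using bc k \<rho> S_J' \<sigma>_less
        by (intro mult_mono scalar(2) weight(2) Sn J'.gauss_norm_nonneg) auto
      also have "\<dots> = real p powr ((l + l') * real k)"
        by (simp add: algebra_simps flip: powr_add)
      finally show "gauss_norm \<rho> (S' k b c) \<le> real p powr ((l + l') * real k)" .
    qed
  qed
  moreover have "1 \<le> gauss_norm \<rho> (ring_det (laurent_ring J') r (S' k))"
    if k: "k \<ge> 1" and \<rho>: "\<rho> \<in> J'" for k \<rho>
  proof -
    have "1 \<le> gauss_norm \<rho> (ring_det (laurent_ring J) r (S k))"
      using det k \<rho> J'(1) by blast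
    \<comment> \<open>The lower bound is known for the determinant over J, while the twist is
      estimated in the ring of the box.\<close>
    also have "ring_det (laurent_ring J) r (S k) = ring_det (laurent_ring J') r (S k)"
      by (rule ring_det_restrict[OF JJ' S[OF k], symmetric])
    also have "gauss_norm \<rho> \<dots> \<le> gauss_norm \<rho> (ring_det (laurent_ring J') r (S' k))"
      unfolding S'_def
      by (rule J'.gauss_norm_ring_det_twist_ge[OF S_J'[OF k] \<sigma>[OF k] \<rho>])
         (simp_all only: \<kappa> scalar(1)[OF weight(1)[OF k _ \<rho>]])
    finally show ?thesis .
  qed
  moreover have "module_basis (laurent_ring J') r e" by (rule module_basis_restrict[OF JJ' e])
  ultimately have "exponent_free p \<iota> J' r (restrict_conn I J' r D) B"
    unfolding exponent_free_def Let_def using assms(10) l(1) l'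
    by (intro conjI exI[of _ e] exI[of _ S'] exI[of _ "l + l'"] allI impI) auto
  then show ?thesis
    unfolding exponent_def using J' J(2) by blast
qed

end
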